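(* Let $PV_3$ be the group with generators $\lambda_{12},\lambda_{21},\lambda_{13},\lambda_{31},\lambda_{23},\lambda_{32}$ and the six defining relations $\lambda_{ki}\lambda_{kj}\lambda_{ij}=\lambda_{ij}\lambda_{kj}\lambda_{ki}$ for every ordering $(k,i,j)$ of the three distinct indices $1,2,3$. Its abelianization is free abelian with basis the classes of the $\lambda_{ij}$; let $\lambda_{ij}^*\in H^1(PV_3;\mathbb{Z})$ be the dual basis. Then the integral cohomology ring $H^*(PV_3;\mathbb{Z})$ is the quotient of the exterior algebra $E(\lambda_{12}^*,\lambda_{21}^*,\lambda_{13}^*,\lambda_{31}^*,\lambda_{23}^*,\lambda_{32}^* )$ by the relations (1) $\lambda_{ij}^*\lambda_{ji}^*=0$ for $1\le i<j\le 3$; (2) $(\lambda_{13}^*-\lambda_{31}^* )\lambda_{ij}^*=(\lambda_{12}^*-\lambda_{21}^* )\lambda_{ij}^*+(\lambda_{23}^*-\lambda_{32}^* )\lambda_{ij}^*$ for all $1\le i\neq j\le 3$; (3) $\lambda_{21}^*\lambda_{31}^*=\lambda_{21}^*\lambda_{32}^*+\lambda_{23}^*\lambda_{31}^*$.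
   Context: $PV_3$ is the pure virtual braid group on three strands; the presentation above may be taken as its definition. *)

theory Defs
  imports "HOL-Algebra.Algebra"
begin

text \<open>Generators lambda_ij are indexed by pairs (i,j) with i,j in {1,2,3}, i ~= j.
  A letter is a generator index together with a flag: False = the generator,
  True = its inverse.\<close>

type_synonym letter = "(nat \<times> nat) \<times> bool"

definition idxs :: "(nat \<times> nat) set" where
  "idxs = {(i, j). i \<in> {1, 2, 3} \<and> j \<in> {1, 2, 3} \<and> i \<noteq> j}"

definition lam :: "nat \<Rightarrow> nat \<Rightarrow> letter list" where
  "lam i j = [((i, j), False)]"

definition pv3_relators :: "(letter list \<times> letter list) set" where
  "pv3_relators = {(lam k i @ lam k j @ lam i j, lam i j @ lam k j @ lam k i) | k i j.
                    {k, i, j} = {1, 2, 3 :: nat} \<and> k \<noteq> i \<and> k \<noteq> j \<and> i \<noteq> j}"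

definition words :: "letter list set" where
  "words = {w. \<forall>x \<in> set w. fst x \<in> idxs}"

inductive pv3_eq :: "letter list \<Rightarrow> letter list \<Rightarrow> bool" where
  refl: "pv3_eq w w"
| sym: "pv3_eq v w \<Longrightarrow> pv3_eq w v"
| trans: "pv3_eq u v \<Longrightarrow> pv3_eq v w \<Longrightarrow> pv3_eq u w"
| cancel: "pv3_eq (xs @ [(a, b), (a, \<not> b)] @ ys) (xs @ ys)"
| relator: "(r, s) \<in> pv3_relators \<Longrightarrow> pv3_eq (xs @ r @ ys) (xs @ s @ ys)"

definition pv3_class :: "letter list \<Rightarrow> letter list set" where
  "pv3_class w = {v \<in> words. pv3_eq w v}"

definition PV3 :: "letter list set monoid" where
  "PV3 = \<lparr>carrier = pv3_class ` words,
          monoid.mult = (\<lambda>A B. pv3_class ((SOME a. a \<in> A) @ (SOME b. b \<in> B))),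
          monoid.one = pv3_class []\<rparr>"

definition cochains :: "('g, 'm) monoid_scheme \<Rightarrow> nat \<Rightarrow> ('g list \<Rightarrow> int) set" where
  "cochains G n = {f. \<forall>xs. f xs \<noteq> 0 \<longrightarrow> length xs = n \<and> set xs \<subseteq> carrier G}"

definition coboundary :: "('g, 'm) monoid_scheme \<Rightarrow> nat \<Rightarrow> ('g list \<Rightarrow> int) \<Rightarrow> ('g list \<Rightarrow> int)" where
  "coboundary G n f = (\<lambda>xs. if length xs = Suc n \<and> set xs \<subseteq> carrier G then
      f (tl xs)
      + (\<Sum>i\<in>{1..n}. (-1) ^ i * f (take (i - 1) xs @ [xs ! (i - 1) \<otimes>\<^bsub>G\<^esub> xs ! i] @ drop (i + 1) xs))
      + (-1) ^ Suc n * f (take n xs)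
    else 0)"

definition cocycles :: "('g, 'm) monoid_scheme \<Rightarrow> nat \<Rightarrow> ('g list \<Rightarrow> int) set" where
  "cocycles G n = {f \<in> cochains G n. coboundary G n f = (\<lambda>_. 0)}"

definition coboundaries :: "('g, 'm) monoid_scheme \<Rightarrow> nat \<Rightarrow> ('g list \<Rightarrow> int) set" where
  "coboundaries G n = (case n of 0 \<Rightarrow> {\<lambda>_. 0} | Suc m \<Rightarrow> coboundary G m ` cochains G m)"

definition cohom_class :: "('g, 'm) monoid_scheme \<Rightarrow> nat \<Rightarrow> ('g list \<Rightarrow> int) \<Rightarrow> ('g list \<Rightarrow> int) set" where
  "cohom_class G n f = {g \<in> cocycles G n. (\<lambda>xs. f xs - g xs) \<in> coboundaries G n}"

definition cup :: "nat \<Rightarrow> ('g list \<Rightarrow> int) \<Rightarrow> ('g list \<Rightarrow> int) \<Rightarrow> ('g list \<Rightarrow> int)" where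
  "cup p f g = (\<lambda>xs. f (take p xs) * g (drop p xs))"

definition cohom_rep :: "(nat \<Rightarrow> ('g list \<Rightarrow> int) set) \<Rightarrow> nat \<Rightarrow> ('g list \<Rightarrow> int)" where
  "cohom_rep x n = (SOME f. f \<in> x n)"

definition cohom_ring :: "('g, 'm) monoid_scheme \<Rightarrow> (nat \<Rightarrow> ('g list \<Rightarrow> int) set) ring" where
  "cohom_ring G = \<lparr>carrier = {x. (\<forall>n. x n \<in> cohom_class G n ` cocycles G n)
                                  \<and> finite {n. x n \<noteq> cohom_class G n (\<lambda>_. 0)}},
     monoid.mult = (\<lambda>x y n. cohom_class G n (\<lambda>xs. \<Sum>p\<in>{0..n}. cup p (cohom_rep x p) (cohom_rep y (n - p)) xs)),
     monoid.one = (\<lambda>n. cohom_class G n (if n = 0 then (\<lambda>xs. if xs = [] then 1 else 0) else (\<lambda>_. 0))),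
     ring.zero = (\<lambda>n. cohom_class G n (\<lambda>_. 0)),
     ring.add = (\<lambda>x y n. cohom_class G n (\<lambda>xs. cohom_rep x n xs + cohom_rep y n xs))\<rparr>"

definition deg1 :: "('g, 'm) monoid_scheme \<Rightarrow> ('g list \<Rightarrow> int) \<Rightarrow> (nat \<Rightarrow> ('g list \<Rightarrow> int) set)" where
  "deg1 G f = (\<lambda>n. if n = 1 then cohom_class G 1 f else cohom_class G n (\<lambda>_. 0))"

definition expsum :: "nat \<times> nat \<Rightarrow> letter list \<Rightarrow> int" where
  "expsum ij w = int (length (filter (\<lambda>x. x = (ij, False)) w)) - int (length (filter (\<lambda>x. x = (ij, True)) w))"

text \<open>lam_ij^* : the homomorphism PV_3 -> Z dual to the basis of the abelianization,
  as a 1-cocycle.\<close>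
definition lamstar :: "nat \<times> nat \<Rightarrow> (letter list set list \<Rightarrow> int)" where
  "lamstar ij = (\<lambda>xs. if length xs = 1 \<and> set xs \<subseteq> carrier PV3
                      then expsum ij (SOME w. w \<in> hd xs) else 0)"

text \<open>Elements: Z-linear combinations of basis monomials e_S, S a subset of idxs.
  The monomial e_S is the wedge of its generators in increasing rank order.\<close>

definition rk :: "nat \<times> nat \<Rightarrow> nat" where
  "rk ij = 3 * fst ij + snd ij"

definition ext_sign :: "(nat \<times> nat) set \<Rightarrow> (nat \<times> nat) set \<Rightarrow> int" where
  "ext_sign T U = (-1) ^ card {(t, u). t \<in> T \<and> u \<in> U \<and> rk u < rk t}"

definition ext_alg :: "((nat \<times> nat) set \<Rightarrow> int) ring" where
  "ext_alg = \<lparr>carrier = {a. \<forall>S. a S \<noteq> 0 \<longrightarrow> S \<subseteq> idxs},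
     monoid.mult = (\<lambda>a b S. if S \<subseteq> idxs then (\<Sum>T\<in>Pow S. ext_sign T (S - T) * a T * b (S - T)) else 0),
     monoid.one = (\<lambda>S. if S = {} then 1 else 0),
     ring.zero = (\<lambda>S. 0),
     ring.add = (\<lambda>a b S. a S + b S)\<rparr>"

definition egen :: "nat \<Rightarrow> nat \<Rightarrow> ((nat \<times> nat) set \<Rightarrow> int)" where
  "egen i j = (\<lambda>S. if S = {(i, j)} then 1 else 0)"

definition pv3_relations :: "((nat \<times> nat) set \<Rightarrow> int) set" where
  "pv3_relations =
     {egen i j \<otimes>\<^bsub>ext_alg\<^esub> egen j i | i j. 1 \<le> i \<and> i < j \<and> j \<le> 3}
   \<union> {((egen 1 3 \<ominus>\<^bsub>ext_alg\<^esub> egen 3 1) \<otimes>\<^bsub>ext_alg\<^esub> egen i j)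
        \<ominus>\<^bsub>ext_alg\<^esub> (((egen 1 2 \<ominus>\<^bsub>ext_alg\<^esub> egen 2 1) \<otimes>\<^bsub>ext_alg\<^esub> egen i j)
                   \<oplus>\<^bsub>ext_alg\<^esub> ((egen 2 3 \<ominus>\<^bsub>ext_alg\<^esub> egen 3 2) \<otimes>\<^bsub>ext_alg\<^esub> egen i j))
       | i j. (i, j) \<in> idxs}
   \<union> {(egen 2 1 \<otimes>\<^bsub>ext_alg\<^esub> egen 3 1)
        \<ominus>\<^bsub>ext_alg\<^esub> ((egen 2 1 \<otimes>\<^bsub>ext_alg\<^esub> egen 3 2) \<oplus>\<^bsub>ext_alg\<^esub> (egen 2 3 \<otimes>\<^bsub>ext_alg\<^esub> egen 3 1))}"

definition pv3_ideal :: "((nat \<times> nat) set \<Rightarrow> int) set" where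
  "pv3_ideal = genideal ext_alg pv3_relations"

end

theory Submission
  imports Defs
begin

text \<open>
  Put the generators, with alternating signs, into the cyclic order
  \<open>g\<^sub>0 = \<lambda>\<^sub>1\<^sub>3, g\<^sub>1 = -\<lambda>\<^sub>1\<^sub>2, g\<^sub>2 = \<lambda>\<^sub>3\<^sub>2, g\<^sub>3 = -\<lambda>\<^sub>3\<^sub>1, g\<^sub>4 = \<lambda>\<^sub>2\<^sub>1, g\<^sub>5 = -\<lambda>\<^sub>2\<^sub>3\<close> (groups are written
  additively). In terms of \<open>s\<^sub>i = g\<^sub>i - g\<^sub>i\<^sub>-\<^sub>1\<close> the six relations say that cyclically adjacent \<open>s\<^sub>i\<close>
  commute, so the group is the free product of the integers, generated by \<open>g\<^sub>0\<close>, with a semidirect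
  product of two free groups: \<open>t\<^sub>1 = s\<^sub>1\<close> and \<open>t\<^sub>3 = s\<^sub>3\<close> act on the free group on \<open>p = s\<^sub>2\<close>, \<open>q = s\<^sub>4\<close>,
  \<open>r = s\<^sub>6\<close>.

  In degree at least three a homogeneous cocycle has a (non-invariant) primitive \<open>F\<close>, and
  \<open>g \<mapsto> F\<cdot>g - F\<close> is a derivation with values in closed cochains. It suffices to lift it to a
  derivation with values in all cochains. By the semidirect presentation this means prescribing the
  lift on \<open>p, q, r\<close> so that it is compatible with \<open>t\<^sub>1\<close> and \<open>t\<^sub>3\<close>, which is a common fixed point
  problem for two invertible affine maps; since those generate an action of a free group, it is
  solved by following the orbit of zero.

  In degree two, a cocycle is a coboundary iff it vanishes on the six relators, and the six chains
  \<open>\<lambda>\<^sub>k\<^sub>i\<^sup>* \<lambda>\<^sub>i\<^sub>j\<^sup>*\<close> form the dual basis. In the quotient of the exterior algebra all products of two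
  generators are integral combinations of these chains and all triple products vanish.
\<close>

section \<open>Homogeneous cochains\<close>

text \<open>Alternating sum over the deletions of one entry. All degrees live in one function on
  lists, and the empty list augments the complex: \<open>hdiff [x] c\<close> is
  \<open>c []\<close>.\<close>

primrec hdiff :: "'a list \<Rightarrow> ('a list \<Rightarrow> int) \<Rightarrow> int" where
  "hdiff [] c = 0"
| "hdiff (x # xs) c = c xs - hdiff xs (\<lambda>ys. c (x # ys))"

definition hd_cob :: "('a list \<Rightarrow> int) \<Rightarrow> 'a list \<Rightarrow> int" where
  "hd_cob c xs = hdiff xs c"

definition cone :: "('a::zero list \<Rightarrow> int) \<Rightarrow> 'a list \<Rightarrow> int" where
  "cone c xs = c (0 # xs)"

text \<open>A right action: acting by \<open>g\<close> and then by \<open>h\<close> is acting by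
  \<open>g + h\<close>.\<close>

definition act :: "('a::plus list \<Rightarrow> int) \<Rightarrow> 'a \<Rightarrow> 'a list \<Rightarrow> int" where
  "act c g xs = c (map ((+) g) xs)"

lemma hdiff_add: "hdiff xs (\<lambda>ys. c ys + e ys) = hdiff xs c + hdiff xs e"
  by (induction xs arbitrary: c e) auto

lemma hdiff_diff: "hdiff xs (\<lambda>ys. c ys - e ys) = hdiff xs c - hdiff xs e"
  by (induction xs arbitrary: c e) auto

lemma hdiff_uminus: "hdiff xs (\<lambda>ys. - c ys) = - hdiff xs c"
  by (induction xs arbitrary: c) auto

lemma hdiff_zero: "hdiff xs (\<lambda>ys. 0) = 0"
  by (induction xs) auto

lemma hdiff_scale: "hdiff xs (\<lambda>ys. k * c ys) = k * hdiff xs c"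
  by (induction xs arbitrary: c) (auto simp: algebra_simps)

lemma hdiff_map: "hdiff xs (\<lambda>ys. c (map f ys)) = hdiff (map f xs) c"
  by (induction xs arbitrary: c) auto

lemma hdiff_cong:
  "(\<And>ys. Suc (length ys) = length xs \<Longrightarrow> c ys = e ys) \<Longrightarrow> hdiff xs c = hdiff xs e"
proof (induction xs arbitrary: c e)
  case (Cons x xs)
  have "hdiff xs (\<lambda>ys. c (x # ys)) = hdiff xs (\<lambda>ys. e (x # ys))"
    using Cons.prems by (intro Cons.IH) auto
  then show ?case using Cons.prems[of xs] by simp
qed simp

lemma hdiff_hdiff: "hdiff xs (\<lambda>ys. hdiff ys c) = 0"
  by (induction xs arbitrary: c) (auto simp: hdiff_diff)

lemma hdiff_sum:
  "hdiff xs c = (\<Sum>i<length xs. (-1) ^ i * c (take i xs @ drop (Suc i) xs))"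
proof (induction xs arbitrary: c)
  case (Cons x xs)
  have "hdiff (x # xs) c = c xs - (\<Sum>i<length xs. (-1) ^ i * c (x # take i xs @ drop (Suc i) xs))"
    by (simp add: Cons.IH)
  also have "\<dots> = (\<Sum>i<length (x # xs). (-1) ^ i * c (take i (x # xs) @ drop (Suc i) (x # xs)))"
    by (simp add: sum.lessThan_Suc_shift sum_negf del: sum.lessThan_Suc)
  finally show ?case .
qed simp

lemma hd_cob_simps:
  "hd_cob (\<lambda>ys. c ys + e ys) = (\<lambda>xs. hd_cob c xs + hd_cob e xs)"
  "hd_cob (\<lambda>ys. c ys - e ys) = (\<lambda>xs. hd_cob c xs - hd_cob e xs)"
  "hd_cob (\<lambda>ys. - c ys) = (\<lambda>xs. - hd_cob c xs)"
  "hd_cob (\<lambda>ys. 0) = (\<lambda>xs. 0)"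
  "hd_cob (hd_cob c) = (\<lambda>xs. 0)"
  by (auto simp: fun_eq_iff hd_cob_def[abs_def] hdiff_add hdiff_diff hdiff_uminus hdiff_zero
      hdiff_hdiff)

lemma hd_cob_act: "hd_cob (act c g) = act (hd_cob c) g"
  by (auto simp: fun_eq_iff hd_cob_def act_def[abs_def] hdiff_map)

text \<open>Evaluate the closed cochain at \<open>0 # xs\<close>: deleting the head gives
  \<open>c xs\<close>, the other faces give the coboundary of \<open>cone c\<close>. Hence the
  complex without invariance is acyclic.\<close>

lemma hd_cob_cone: "hd_cob c = (\<lambda>_. 0) \<Longrightarrow> hd_cob (cone c) = c"
proof
  fix xs assume "hd_cob c = (\<lambda>_. 0)"
  from fun_cong[OF this, of "0 # xs"] show "hd_cob (cone c) xs = c xs"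
    by (simp add: hd_cob_def cone_def[abs_def])
qed

lemma act_act: "act (act c g) h = act c (g + h)" for g :: "'a::semigroup_add"
  by (simp add: fun_eq_iff act_def o_def add.assoc[abs_def])

lemma act_0 [simp]: "act c (0 :: 'a::monoid_add) = c"
  by (auto simp: fun_eq_iff act_def map_idI)

lemma act_simps:
  "act (\<lambda>ys. c ys + e ys) g = (\<lambda>xs. act c g xs + act e g xs)"
  "act (\<lambda>ys. c ys - e ys) g = (\<lambda>xs. act c g xs - act e g xs)"
  "act (\<lambda>ys. - c ys) g = (\<lambda>xs. - act c g xs)"
  "act (\<lambda>ys. 0) g = (\<lambda>xs. 0)"
  by (auto simp: fun_eq_iff act_def)

subsection \<open>The semidirect product of a group with its cochains\<close>

text \<open>The map taking \<open>g\<close> to \<open>Sdp g (D g)\<close> is additive iff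
  \<open>D\<close> is a derivation: \<open>D (g + h)\<close> is \<open>act (D g) h\<close> plus
  \<open>D h\<close>. Lifting derivations thus becomes lifting homomorphisms, which a presentation
  controls.\<close>

datatype 'a sdp = Sdp (gp: 'a) (fn: "'a list \<Rightarrow> int")

instantiation sdp :: (group_add) group_add
begin

definition zero_sdp :: "'a sdp" where "0 = Sdp 0 (\<lambda>_. 0)"

definition plus_sdp :: "'a sdp \<Rightarrow> 'a sdp \<Rightarrow> 'a sdp" where
  "A + B = Sdp (gp A + gp B) (\<lambda>xs. act (fn A) (gp B) xs + fn B xs)"

definition uminus_sdp :: "'a sdp \<Rightarrow> 'a sdp" where
  "- A = Sdp (- gp A) (\<lambda>xs. - act (fn A) (- gp A) xs)"

definition minus_sdp :: "'a sdp \<Rightarrow> 'a sdp \<Rightarrow> 'a sdp" where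
  "minus_sdp A B = A + - B"

instance
proof
  fix A B C :: "'a sdp"
  show "A + B + C = A + (B + C)"
    by (auto simp: plus_sdp_def act_simps act_act add.assoc)
  show "0 + A = A" "A + 0 = A"
    by (auto simp: plus_sdp_def zero_sdp_def act_simps)
  show "- A + A = 0"
    by (auto simp: plus_sdp_def uminus_sdp_def zero_sdp_def act_simps act_act)
  show "A + - B = A - B" by (simp add: minus_sdp_def)
qed

end

lemma gp_simps [simp]:
  "gp (A + B) = gp A + gp B" "gp (- A) = - gp A" "gp (A - B) = gp A - gp B" "gp 0 = 0"
  by (auto simp: plus_sdp_def uminus_sdp_def minus_sdp_def zero_sdp_def)

lemma fn_simps:
  "fn (A + B) = (\<lambda>xs. act (fn A) (gp B) xs + fn B xs)"
  "fn (- A) = (\<lambda>xs. - act (fn A) (- gp A) xs)"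
  "fn 0 = (\<lambda>xs. 0)"
  by (auto simp: plus_sdp_def uminus_sdp_def zero_sdp_def)

definition sdp_cob :: "'a sdp \<Rightarrow> 'a sdp" where
  "sdp_cob A = Sdp (gp A) (hd_cob (fn A))"

lemma sdp_cob_add: "sdp_cob (A + B) = sdp_cob A + sdp_cob B"
  by (auto simp: sdp_cob_def plus_sdp_def hd_cob_simps hd_cob_act)

subsection \<open>The group of bijections\<close>

text \<open>Bijections under composition, written additively, so that an action on a set is a
  homomorphism like any other and can be defined from a presentation.\<close>

typedef 'a bijn = "{f :: 'a \<Rightarrow> 'a. bij f}" morphisms bapp Bijn
  using bij_id by blast

setup_lifting type_definition_bijn

instantiation bijn :: (type) group_add
begin

lift_definition zero_bijn :: "'a bijn" is id by (rule bij_id)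
lift_definition plus_bijn :: "'a bijn \<Rightarrow> 'a bijn \<Rightarrow> 'a bijn" is comp by (rule bij_comp)
lift_definition uminus_bijn :: "'a bijn \<Rightarrow> 'a bijn" is "inv_into UNIV" by (rule bij_imp_bij_inv)
definition minus_bijn :: "'a bijn \<Rightarrow> 'a bijn \<Rightarrow> 'a bijn" where "minus_bijn f g = f + - g"

instance
proof
  fix a b c :: "'a bijn"
  show "a + b + c = a + (b + c)" by transfer auto
  show "0 + a = a" by transfer auto
  show "a + 0 = a" by transfer auto
  show "- a + a = 0" by transfer (auto simp: bij_def)
  show "a + - b = a - b" by (simp add: minus_bijn_def)
qed

end

section \<open>The group\<close>

definition inv_word :: "letter list \<Rightarrow> letter list" where
  "inv_word w = rev (map (\<lambda>(a, b). (a, \<not> b)) w)"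

lemma pv3_eq_context: "pv3_eq u v \<Longrightarrow> pv3_eq (xs @ u @ ys) (xs @ v @ ys)"
proof (induction rule: pv3_eq.induct)
  case (cancel us a b vs)
  then show ?case using pv3_eq.cancel[of "xs @ us" a b "vs @ ys"] by simp
next
  case (relator r s us vs)
  then show ?case using pv3_eq.relator[of r s "xs @ us" "vs @ ys"] by simp
qed (blast intro: pv3_eq.refl pv3_eq.sym pv3_eq.trans)+

lemma pv3_eq_append: "pv3_eq u u' \<Longrightarrow> pv3_eq v v' \<Longrightarrow> pv3_eq (u @ v) (u' @ v')"
  using pv3_eq_context[of u u' "[]" v] pv3_eq_context[of v v' u' "[]"] pv3_eq.trans
  by fastforce

lemma pv3_eq_inv_word: "pv3_eq (w @ inv_word w) []"
proof (induction w)
  case (Cons x w)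
  obtain a b where x: "x = (a, b)" by (cases x)
  have "pv3_eq ([x] @ (w @ inv_word w) @ [(a, \<not> b)]) ([x] @ [] @ [(a, \<not> b)])"
    by (rule pv3_eq_context[OF Cons.IH])
  moreover have "pv3_eq ([] @ [(a, b), (a, \<not> b)] @ []) ([] @ [])"
    by (rule pv3_eq.cancel)
  ultimately show ?case
    using pv3_eq.trans by (fastforce simp: inv_word_def x)
qed (auto simp: inv_word_def intro: pv3_eq.refl)

lemma inv_word_inv_word: "inv_word (inv_word w) = w"
  by (auto simp: inv_word_def rev_map o_def case_prod_beta map_idI)

lemma words_simps [simp]:
  "[] \<in> words" "u @ v \<in> words \<longleftrightarrow> u \<in> words \<and> v \<in> words"
  "x # u \<in> words \<longleftrightarrow> fst x \<in> idxs \<and> u \<in> words"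
  "inv_word u \<in> words \<longleftrightarrow> u \<in> words"
  by (auto simp: words_def inv_word_def)

lemma mem_pv3_class: "u \<in> words \<Longrightarrow> u \<in> pv3_class u"
  by (auto simp: pv3_class_def intro: pv3_eq.refl)

lemma pv3_class_eq_iff:
  assumes "u \<in> words" "v \<in> words"
  shows "pv3_class u = pv3_class v \<longleftrightarrow> pv3_eq u v"
proof
  assume "pv3_class u = pv3_class v"
  then show "pv3_eq u v" using mem_pv3_class[OF assms(2)] by (auto simp: pv3_class_def)
next
  assume "pv3_eq u v"
  then show "pv3_class u = pv3_class v"
    using pv3_eq.sym pv3_eq.trans unfolding pv3_class_def by blast
qed

typedef pv3 = "carrier PV3"
proof
  show "pv3_class [] \<in> carrier PV3" by (simp add: PV3_def)
qed

definition cls :: "letter list \<Rightarrow> pv3" where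
  "cls w = Abs_pv3 (pv3_class w)"

lemma Rep_cls: "w \<in> words \<Longrightarrow> Rep_pv3 (cls w) = pv3_class w"
  unfolding cls_def by (rule Abs_pv3_inverse) (auto simp: PV3_def)

lemma cls_eq_iff: "u \<in> words \<Longrightarrow> v \<in> words \<Longrightarrow> cls u = cls v \<longleftrightarrow> pv3_eq u v"
  by (metis Rep_cls pv3_class_eq_iff cls_def)

definition rep_word :: "pv3 \<Rightarrow> letter list" where
  "rep_word x = (SOME w. w \<in> Rep_pv3 x)"

lemma rep_word: "rep_word x \<in> words" "cls (rep_word x) = x"
proof -
  obtain w where w: "w \<in> words" "Rep_pv3 x = pv3_class w"
    using Rep_pv3[of x] by (auto simp: PV3_def)
  then have "rep_word x \<in> pv3_class w"
    unfolding rep_word_def using mem_pv3_class by (metis someI)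
  then have "rep_word x \<in> words" "pv3_eq w (rep_word x)" by (auto simp: pv3_class_def)
  moreover have "cls w = x" using w Rep_cls by (simp add: Rep_pv3_inject[symmetric])
  ultimately show "rep_word x \<in> words" "cls (rep_word x) = x"
    using w cls_eq_iff[of w "rep_word x"] by auto
qed

lemma rep_word_cls: "w \<in> words \<Longrightarrow> pv3_eq (rep_word (cls w)) w"
  using cls_eq_iff rep_word by blast

lemma pv3_cases: obtains w where "w \<in> words" "x = cls w"
  using rep_word[of x] by metis

instantiation pv3 :: group_add
begin

definition zero_pv3 :: pv3 where "0 = cls []"
definition plus_pv3 :: "pv3 \<Rightarrow> pv3 \<Rightarrow> pv3" where "plus_pv3 x y = cls (rep_word x @ rep_word y)"
definition uminus_pv3 :: "pv3 \<Rightarrow> pv3" where "uminus_pv3 x = cls (inv_word (rep_word x))"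
definition minus_pv3 :: "pv3 \<Rightarrow> pv3 \<Rightarrow> pv3" where "minus_pv3 x y = x + - y"

lemma cls_append: "u \<in> words \<Longrightarrow> v \<in> words \<Longrightarrow> cls u + cls v = cls (u @ v)"
  by (simp add: plus_pv3_def cls_eq_iff rep_word pv3_eq_append rep_word_cls)

instance
proof
  fix x y z :: pv3
  obtain u v w where "u \<in> words" "x = cls u" "v \<in> words" "y = cls v" "w \<in> words" "z = cls w"
    by (metis pv3_cases)
  then show "x + y + z = x + (y + z)" "0 + x = x" "x + 0 = x"
    by (auto simp: cls_append zero_pv3_def)
  have "- x + x = cls (inv_word (rep_word x)) + cls (rep_word x)"
    by (simp add: uminus_pv3_def rep_word)
  also have "\<dots> = cls (inv_word (rep_word x) @ rep_word x)"
    by (rule cls_append) (simp_all add: rep_word)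
  also have "\<dots> = 0"
    using pv3_eq_inv_word[of "inv_word (rep_word x)"]
    by (simp add: rep_word zero_pv3_def cls_eq_iff inv_word_inv_word)
  finally show "- x + x = 0" .
  show "x + - y = x - y" by (simp add: minus_pv3_def)
qed

end

lemma mult_PV3: "Rep_pv3 x \<otimes>\<^bsub>PV3\<^esub> Rep_pv3 y = Rep_pv3 (x + y)"
  by (simp add: PV3_def plus_pv3_def Rep_cls rep_word rep_word_def[symmetric])

section \<open>Generators, evaluation of words, and the universal property\<close>

definition gen :: "nat \<times> nat \<Rightarrow> pv3" where
  "gen s = cls [(s, False)]"

lemma cls_inv_letter: "s \<in> idxs \<Longrightarrow> cls [(s, True)] = - gen s"
proof -
  assume s: "s \<in> idxs"
  have "gen s + cls [(s, True)] = 0"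
    using s pv3_eq.cancel[of "[]" s False "[]"]
    by (simp add: gen_def cls_append zero_pv3_def cls_eq_iff)
  then show ?thesis using minus_unique by metis
qed

lemma pv3_induct [case_names zero gen plus uminus]:
  assumes "P 0" "\<And>s. s \<in> idxs \<Longrightarrow> P (gen s)" "\<And>x y. P x \<Longrightarrow> P y \<Longrightarrow> P (x + y)"
    "\<And>x. P x \<Longrightarrow> P (- x)"
  shows "P x"
proof -
  have "w \<in> words \<Longrightarrow> P (cls w)" for w
  proof (induction w)
    case Nil
    then show ?case using assms(1) by (simp add: zero_pv3_def)
  next
    case (Cons x w)
    obtain s b where x: "x = (s, b)" by (cases x)
    have "P (cls [x])"
      using Cons.prems assms(2,4) cls_inv_letter[of s] by (cases b) (auto simp: x gen_def)
    then show ?case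
      using Cons assms(3)[of "cls [x]" "cls w"] by (simp add: cls_append)
  qed
  then show ?thesis by (metis pv3_cases)
qed

definition pv3_rel :: "(nat \<times> nat \<Rightarrow> 'a::plus) \<Rightarrow> bool" where
  "pv3_rel b \<longleftrightarrow> (\<forall>k i j. {k, i, j} = {1, 2, 3} \<longrightarrow>
     b (k, i) + b (k, j) + b (i, j) = b (i, j) + b (k, j) + b (k, i))"

text \<open>Defined on words in arbitrary letters, since a derivation of \<open>pv3_eq\<close> may
  insert and cancel letters with indices outside \<open>idxs\<close>.\<close>

definition ev :: "(nat \<times> nat \<Rightarrow> 'a::group_add) \<Rightarrow> letter list \<Rightarrow> 'a" where
  "ev b w = sum_list (map (\<lambda>(s, neg). if neg then - b s else b s) w)"

lemma ev_simps [simp]: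
  "ev b [] = 0" "ev b (x # w) = (if snd x then - b (fst x) else b (fst x)) + ev b w"
  "ev b (u @ v) = ev b u + ev b v"
  by (auto simp: ev_def case_prod_beta)

lemma three_distinct: "{k, i, j} = {1, 2, 3 :: nat} \<Longrightarrow> k \<noteq> i \<and> k \<noteq> j \<and> i \<noteq> j"
proof -
  assume "{k, i, j} = {1, 2, 3 :: nat}"
  then have "card {k, i, j} = 3" by simp
  then show ?thesis by (auto simp: card_insert_if split: if_splits)
qed

lemma three_eq:
  "{k, i, j} = {1, 2, 3 :: nat} \<longleftrightarrow> (k, i, j) \<in> {(1,2,3), (1,3,2), (2,1,3), (2,3,1), (3,1,2), (3,2,1)}"
proof
  assume h: "{k, i, j} = {1, 2, 3 :: nat}"
  have "k \<in> {k,i,j}" "i \<in> {k,i,j}" "j \<in> {k,i,j}" by simp_all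
  then have "k \<in> {1,2,3}" "i \<in> {1,2,3}" "j \<in> {1,2,3}"
    unfolding h .
  then show "(k, i, j) \<in> {(1,2,3), (1,3,2), (2,1,3), (2,3,1), (3,1,2), (3,2,1)}"
    using three_distinct[OF h] by (elim insertE emptyE) simp_all
next
  assume "(k, i, j) \<in> {(1,2,3), (1,3,2), (2,1,3), (2,3,1), (3,1,2), (3,2,1)}"
  then show "{k, i, j} = {1, 2, 3 :: nat}"
    by (elim insertE emptyE) (simp_all add: insert_commute)
qed

lemma ev_pv3_eq:
  assumes "pv3_rel b" "pv3_eq u v"
  shows "ev b u = ev b v"
  using assms(2)
proof (induction rule: pv3_eq.induct)
  case (cancel xs a neg ys)
  then show ?case by (cases neg) (simp_all add: add.assoc[symmetric])
next
  case (relator r s xs ys)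
  then obtain k i j where "{k, i, j} = {1, 2, 3}" and rs: "r = lam k i @ lam k j @ lam i j"
    "s = lam i j @ lam k j @ lam k i"
    unfolding pv3_relators_def by blast
  then have "b (k, i) + b (k, j) + b (i, j) = b (i, j) + b (k, j) + b (k, i)"
    using assms(1) unfolding pv3_rel_def by blast
  then have "ev b r = ev b s" by (simp add: rs lam_def add.assoc[symmetric])
  then show ?case by simp
qed simp_all

definition lift_hom :: "(nat \<times> nat \<Rightarrow> 'a::group_add) \<Rightarrow> pv3 \<Rightarrow> 'a" where
  "lift_hom b x = ev b (rep_word x)"

lemma lift_hom_gen: "pv3_rel b \<Longrightarrow> s \<in> idxs \<Longrightarrow> lift_hom b (gen s) = b s"
  using ev_pv3_eq[OF _ rep_word_cls, of b "[(s, False)]"] by (simp add: lift_hom_def gen_def)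

lemma lift_hom_add: "pv3_rel b \<Longrightarrow> lift_hom b (x + y) = lift_hom b x + lift_hom b y"
  using ev_pv3_eq[OF _ rep_word_cls, of b "rep_word x @ rep_word y"]
  by (simp add: lift_hom_def plus_pv3_def rep_word)

lemma pv3_rel_gen: "pv3_rel gen"
  unfolding pv3_rel_def
proof (intro allI impI)
  fix k i j :: nat assume h: "{k, i, j} = {1, 2, 3}"
  then have ix: "(k, i) \<in> idxs" "(k, j) \<in> idxs" "(i, j) \<in> idxs"
    using h unfolding three_eq by (auto simp: idxs_def)
  have "(lam k i @ lam k j @ lam i j, lam i j @ lam k j @ lam k i) \<in> pv3_relators"
    unfolding pv3_relators_def using h three_distinct[OF h] by blast
  from pv3_eq.relator[OF this, of "[]" "[]"]
  show "gen (k, i) + gen (k, j) + gen (i, j) = gen (i, j) + gen (k, j) + gen (k, i)"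
    using ix by (simp add: gen_def cls_append lam_def cls_eq_iff)
qed

definition additive :: "('a::plus \<Rightarrow> 'b::plus) \<Rightarrow> bool" where
  "additive h \<longleftrightarrow> (\<forall>x y. h (x + y) = h x + h y)"

lemma additive_simps:
  fixes h :: "'a::group_add \<Rightarrow> 'b::group_add"
  assumes "additive h"
  shows "h (x + y) = h x + h y" "h 0 = 0" "h (- x) = - h x" "h (x - y) = h x - h y"
proof -
  show add: "h (x + y) = h x + h y" for x y using assms by (auto simp: additive_def)
  show 0: "h 0 = 0" using add[of 0 0] add_left_cancel[of "h 0" "h 0" 0] by simp
  show minus: "h (- x) = - h x" for x
    using add[of "- x" x] 0 by (simp add: eq_neg_iff_add_eq_0)
  show "h (x - y) = h x - h y" using add[of x "- y"] minus by simp
qed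

lemma additive_lift_hom: "pv3_rel b \<Longrightarrow> additive (lift_hom b)"
  by (simp add: additive_def lift_hom_add)

section \<open>A presentation as a semidirect product\<close>

text \<open>Free reduction of words bracketed to the right, without commutativity.\<close>

lemmas group_word_simps = diff_conv_add_uminus add.assoc minus_add minus_minus minus_zero
  add_minus_cancel minus_add_cancel left_minus right_minus add_0_left add_0_right

text \<open>Each equation reads \<open>x + t = t + x'\<close>, so \<open>x'\<close> is the conjugate
  \<open>- t + x + t\<close>: the first three describe the action of \<open>t1\<close> on
  \<open>p, q, r\<close>, the last three that of \<open>t3\<close>. Nothing relates
  \<open>t1\<close> to \<open>t3\<close>.\<close>

definition semidirect_rel :: "'a::group_add \<Rightarrow> 'a \<Rightarrow> 'a \<Rightarrow> 'a \<Rightarrow> 'a \<Rightarrow> bool" where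
  "semidirect_rel p q r t1 t3 \<longleftrightarrow>
     p + t1 = t1 + p \<and> q + t1 = t1 + (p + r + q - r - p) \<and> r + t1 = t1 + r
     \<and> p + t3 = t3 + p \<and> q + t3 = t3 + q \<and> r + t3 = t3 + (q + p + r - p - q)"

text \<open>The values forced on the six generators by those on \<open>p, q, r, t\<^sub>1, t\<^sub>3\<close> and \<open>\<lambda>\<^sub>1\<^sub>3\<close>.\<close>

definition hexb :: "'a::group_add \<Rightarrow> 'a \<Rightarrow> 'a \<Rightarrow> 'a \<Rightarrow> 'a \<Rightarrow> 'a \<Rightarrow> nat \<times> nat \<Rightarrow> 'a" where
  "hexb p q r t1 t3 g s =
     (if s = (1,3) then g else if s = (1,2) then - (t1 + g) else if s = (3,2) then p + t1 + g
      else if s = (3,1) then - (t3 + p + t1 + g) else if s = (2,1) then q + t3 + p + t1 + g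
      else - g + r)"

lemma group_eq_moves:
  fixes a b c :: "'a::group_add"
  shows "- a + b = c \<longleftrightarrow> b = a + c" "b + - a = c \<longleftrightarrow> b = c + a"
    "c = - a + b \<longleftrightarrow> a + c = b" "c = b + - a \<longleftrightarrow> c + a = b"
  by (auto simp: add.assoc[symmetric])

text \<open>In the notation of the overview \<open>s\<^sub>5\<close> is
  \<open>- (q + t3 + p + t1 + r)\<close>; the last two equations on the right say that it commutes
  with \<open>s\<^sub>4 = q\<close> and with \<open>s\<^sub>6 = r\<close>. Modulo the four
  commutations they can be solved for the conjugates of \<open>q\<close> by \<open>t1\<close> and of
  \<open>r\<close> by \<open>t3\<close>.\<close>

lemma semidirect_rel_iff:
  "semidirect_rel p q r t1 t3 \<longleftrightarrow>
     p + t1 = t1 + p \<and> r + t1 = t1 + r \<and> p + t3 = t3 + p \<and> q + t3 = t3 + q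
     \<and> (t3 + p + t1) + r + q = q + (t3 + p + t1) + r \<and> (q + t3 + p + t1) + r = r + (q + t3 + p + t1)"
  (is "?L \<longleftrightarrow> ?A \<and> ?B \<and> ?C \<and> ?D \<and> ?E \<and> ?F")
proof (cases "?A \<and> ?B \<and> ?C \<and> ?D")
  case True
  then have c: "p + t1 = t1 + p" "r + t1 = t1 + r" "p + t3 = t3 + p" "q + t3 = t3 + q"
    by auto
  then have c': "p + (t1 + x) = t1 + (p + x)" "r + (t1 + x) = t1 + (r + x)"
    "p + (t3 + x) = t3 + (p + x)" "q + (t3 + x) = t3 + (q + x)" for x
    by (metis add.assoc)+
  \<comment> \<open>Adding \<open>p + r\<close> on the right clears the inverses; for the conjugate
    of \<open>r\<close> the term \<open>q + p + t1\<close> does the same below.\<close>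
  have "q + t1 = t1 + (p + r + q - r - p) \<longleftrightarrow> q + t1 + (p + r) = t1 + (p + r + q - r - p) + (p + r)"
    by simp
  also have "\<dots> \<longleftrightarrow> q + (t1 + (p + r)) = t1 + (p + (r + q))"
    by (simp only: group_word_simps)
  also have "\<dots> \<longleftrightarrow> ?E"
    by (simp only: add.assoc c c' add_left_cancel) (rule eq_commute)
  finally have E: "q + t1 = t1 + (p + r + q - r - p) \<longleftrightarrow> ?E" .
  have "r + t3 = t3 + (q + p + r - p - q) \<longleftrightarrow> r + t3 + (q + p + t1) = t3 + (q + p + r - p - q) + (q + p + t1)"
    by simp
  also have "\<dots> \<longleftrightarrow> r + (t3 + (q + (p + t1))) = t3 + (q + (p + (r + t1)))"
    by (simp only: group_word_simps)
  also have "\<dots> \<longleftrightarrow> ?F"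
    by (simp only: add.assoc c c' add_left_cancel) (rule eq_commute)
  finally have F: "r + t3 = t3 + (q + p + r - p - q) \<longleftrightarrow> ?F" .
  show ?thesis
    using c E F unfolding semidirect_rel_def by simp
next
  case False
  then show ?thesis
    unfolding semidirect_rel_def by auto
qed

text \<open>Taken in the order 132, 312, 321, 231, 213, 123, the relators become the commutations of
  \<open>s\<^sub>1\<close> with \<open>s\<^sub>2\<close>, \<open>s\<^sub>2\<close> with
  \<open>s\<^sub>3\<close>, and so on, up to \<open>s\<^sub>6\<close> with \<open>s\<^sub>1\<close>.
  The value \<open>g\<close> cancels from all of them.\<close>

lemma pv3_rel_hexb: "pv3_rel (hexb p q r t1 t3 g) \<longleftrightarrow> semidirect_rel p q r t1 t3"
proof -
  let ?b = "hexb p q r t1 t3 g"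
  have b: "?b (1,3) = g" "?b (1,2) = - (t1 + g)" "?b (3,2) = p + t1 + g"
    "?b (3,1) = - (t3 + p + t1 + g)" "?b (2,1) = q + t3 + p + t1 + g" "?b (2,3) = - g + r"
    by (auto simp: hexb_def)
  have all: "(\<forall>k i j. {k, i, j} = {1, 2, 3 :: nat} \<longrightarrow> P k i j) \<longleftrightarrow>
      P 1 2 3 \<and> P 1 3 2 \<and> P 2 1 3 \<and> P 2 3 1 \<and> P 3 1 2 \<and> P 3 2 1" for P
    unfolding three_eq by auto
  define v where "v = t3 + p + t1"
  have v: "t3 + p + t1 + x = v + x" "t3 + (p + (t1 + x)) = v + x" for x
    by (simp_all add: v_def add.assoc)
  have 123: "?b (1,2) + ?b (1,3) + ?b (2,3) = ?b (2,3) + ?b (1,3) + ?b (1,2) \<longleftrightarrow> r + t1 = t1 + r"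
    unfolding b by (simp only: group_word_simps add_left_cancel group_eq_moves)
  have 132: "?b (1,3) + ?b (1,2) + ?b (3,2) = ?b (3,2) + ?b (1,2) + ?b (1,3) \<longleftrightarrow> p + t1 = t1 + p"
    unfolding b by (simp only: group_word_simps group_eq_moves)
      (simp only: add.assoc[symmetric] add_right_cancel)
  have 312: "?b (3,1) + ?b (3,2) + ?b (1,2) = ?b (1,2) + ?b (3,2) + ?b (3,1) \<longleftrightarrow> p + t3 = t3 + p"
    unfolding b by (simp only: group_word_simps add_left_cancel group_eq_moves)
  have 321: "?b (3,2) + ?b (3,1) + ?b (2,1) = ?b (2,1) + ?b (3,1) + ?b (3,2) \<longleftrightarrow> q + t3 = t3 + q"
    unfolding b by (simp only: group_word_simps group_eq_moves)
      (simp only: add.assoc[symmetric] add_right_cancel)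
  have 213: "?b (2,1) + ?b (2,3) + ?b (1,3) = ?b (1,3) + ?b (2,3) + ?b (2,1) \<longleftrightarrow>
      (q + t3 + p + t1) + r = r + (q + t3 + p + t1)"
    unfolding b by (simp only: group_word_simps) (simp only: add.assoc[symmetric] add_right_cancel)
  have 231: "?b (2,3) + ?b (2,1) + ?b (3,1) = ?b (3,1) + ?b (2,1) + ?b (2,3) \<longleftrightarrow>
      (t3 + p + t1) + r + q = q + (t3 + p + t1) + r"
    unfolding b by (simp only: group_word_simps v) (simp only: group_word_simps add_left_cancel group_eq_moves v)
  show ?thesis
    unfolding pv3_rel_def all 123 132 213 231 312 321 semidirect_rel_iff by blast
qed

text \<open>\<open>hexb\<close> solved for its arguments:
  \<open>s\<^sub>2, s\<^sub>4, s\<^sub>6, s\<^sub>1, s\<^sub>3\<close> in terms of the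
  generators.\<close>

definition "gp0 = gen (3,2) + gen (1,2)"
definition "gq0 = gen (2,1) + gen (3,1)"
definition "gr0 = gen (1,3) + gen (2,3)"
definition "gt1 = - gen (1,2) - gen (1,3)"
definition "gt3 = - gen (3,1) - gen (3,2)"

lemma gen_hexb: "s \<in> idxs \<Longrightarrow> gen s = hexb gp0 gq0 gr0 gt1 gt3 (gen (1,3)) s"
  unfolding hexb_def gp0_def gq0_def gr0_def gt1_def gt3_def
  by (auto simp: idxs_def group_word_simps simp del: add_uminus_conv_diff)

lemma semidirect_rel_gen: "semidirect_rel gp0 gq0 gr0 gt1 gt3"
proof -
  have "pv3_rel (hexb gp0 gq0 gr0 gt1 gt3 (gen (1,3)))"
    unfolding pv3_rel_def
  proof (intro allI impI)
    fix k i j :: nat assume h: "{k, i, j} = {1, 2, 3}"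
    then have "(k, i) \<in> idxs" "(k, j) \<in> idxs" "(i, j) \<in> idxs"
      unfolding three_eq by (auto simp: idxs_def)
    with pv3_rel_gen[unfolded pv3_rel_def, rule_format, OF h]
    show "hexb gp0 gq0 gr0 gt1 gt3 (gen (1,3)) (k, i) + hexb gp0 gq0 gr0 gt1 gt3 (gen (1,3)) (k, j)
        + hexb gp0 gq0 gr0 gt1 gt3 (gen (1,3)) (i, j)
      = hexb gp0 gq0 gr0 gt1 gt3 (gen (1,3)) (i, j) + hexb gp0 gq0 gr0 gt1 gt3 (gen (1,3)) (k, j)
        + hexb gp0 gq0 gr0 gt1 gt3 (gen (1,3)) (k, i)"
      by (simp only: gen_hexb[symmetric])
  qed
  then show ?thesis by (simp add: pv3_rel_hexb)
qed

lemma additive_hexb: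
  assumes "additive h"
  shows "h (hexb p q r t1 t3 g s) = hexb (h p) (h q) (h r) (h t1) (h t3) (h g) s"
  by (simp add: hexb_def additive_simps[OF assms])

lemma hom_ext_gen:
  fixes h k :: "pv3 \<Rightarrow> 'a::group_add"
  assumes "additive h" "additive k" "\<And>s. s \<in> idxs \<Longrightarrow> h (gen s) = k (gen s)"
  shows "h x = k x"
  by (induction x rule: pv3_induct)
    (simp_all add: assms additive_simps[OF assms(1)] additive_simps[OF assms(2)])

lemma hom_ext_semidirect:
  fixes h k :: "pv3 \<Rightarrow> 'a::group_add"
  assumes "additive h" "additive k" "h gp0 = k gp0" "h gq0 = k gq0" "h gr0 = k gr0"
    "h gt1 = k gt1" "h gt3 = k gt3" "h (gen (1,3)) = k (gen (1,3))"
  shows "h x = k x"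
proof (rule hom_ext_gen[OF assms(1,2)])
  fix s :: "nat \<times> nat" assume "s \<in> idxs"
  then show "h (gen s) = k (gen s)"
    by (simp only: gen_hexb additive_hexb[OF assms(1)] additive_hexb[OF assms(2)] assms(3-8))
qed

text \<open>Universal property of the new presentation. That \<open>g\<close> is arbitrary reflects
  the free factor generated by \<open>gen (1,3)\<close>.\<close>

lemma ex_hom_semidirect:
  fixes p q r t1 t3 g :: "'a::group_add"
  assumes "semidirect_rel p q r t1 t3"
  obtains h :: "pv3 \<Rightarrow> 'a" where "additive h" "h gp0 = p" "h gq0 = q" "h gr0 = r" "h gt1 = t1"
    "h gt3 = t3" "h (gen (1,3)) = g"
proof
  let ?b = "hexb p q r t1 t3 g"
  have rel: "pv3_rel ?b" using assms by (simp add: pv3_rel_hexb)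
  show h: "additive (lift_hom ?b)" by (rule additive_lift_hom[OF rel])
  have ix: "(1,2) \<in> idxs" "(1,3) \<in> idxs" "(2,1) \<in> idxs" "(2,3) \<in> idxs" "(3,1) \<in> idxs" "(3,2) \<in> idxs"
    by (auto simp: idxs_def)
  note s = additive_simps[OF h] lift_hom_gen[OF rel] ix ix[unfolded One_nat_def] hexb_def prod.inject
  show "lift_hom ?b (gen (1,3)) = g" by (simp add: s)
  show "lift_hom ?b gp0 = p" by (simp add: gp0_def s group_word_simps del: add_uminus_conv_diff)
  show "lift_hom ?b gq0 = q" by (simp add: gq0_def s group_word_simps del: add_uminus_conv_diff)
  show "lift_hom ?b gr0 = r" by (simp add: gr0_def s group_word_simps del: add_uminus_conv_diff)
  show "lift_hom ?b gt1 = t1" by (simp add: gt1_def s group_word_simps del: add_uminus_conv_diff)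
  show "lift_hom ?b gt3 = t3" by (simp add: gt3_def s group_word_simps del: add_uminus_conv_diff)
qed

section \<open>Vanishing above degree two\<close>

text \<open>Conjugation by \<open>t1\<close> and by \<open>t3\<close> as substitutions that make
  sense in any group, with inverses \<open>psi1\<close> and \<open>psi3\<close>. A triple
  \<open>p, q, r\<close> is a sequence with entries 0, 1, 2; later entries stay fixed.\<close>

definition phi1 :: "(nat \<Rightarrow> 'a::group_add) \<Rightarrow> nat \<Rightarrow> 'a" where
  "phi1 f = f(1 := f 0 + f 2 + f 1 - f 2 - f 0)"

definition psi1 :: "(nat \<Rightarrow> 'a::group_add) \<Rightarrow> nat \<Rightarrow> 'a" where
  "psi1 f = f(1 := - f 2 - f 0 + f 1 + f 0 + f 2)"

definition phi3 :: "(nat \<Rightarrow> 'a::group_add) \<Rightarrow> nat \<Rightarrow> 'a" where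
  "phi3 f = f(2 := f 1 + f 0 + f 2 - f 0 - f 1)"

definition psi3 :: "(nat \<Rightarrow> 'a::group_add) \<Rightarrow> nat \<Rightarrow> 'a" where
  "psi3 f = f(2 := - f 0 - f 1 + f 2 + f 1 + f 0)"

definition trip :: "'a::zero \<Rightarrow> 'a \<Rightarrow> 'a \<Rightarrow> nat \<Rightarrow> 'a" where
  "trip p q r n = (if n = 0 then p else if n = 1 then q else if n = 2 then r else 0)"

lemma semidirect_relI:
  assumes "\<And>n. w n + t1 = t1 + phi1 w n" "\<And>n. w n + t3 = t3 + phi3 w n"
  shows "semidirect_rel (w 0) (w 1) (w 2) t1 t3"
  using assms(1)[of 0] assms(1)[of 1] assms(1)[of 2] assms(2)[of 0] assms(2)[of 1] assms(2)[of 2]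
  by (simp add: semidirect_rel_def phi1_def phi3_def)

lemma semidirect_relD:
  assumes "semidirect_rel p q r t1 t3"
  shows "trip p q r n + t1 = t1 + phi1 (trip p q r) n" "trip p q r n + t3 = t3 + phi3 (trip p q r) n"
  using assms by (auto simp: semidirect_rel_def phi1_def phi3_def trip_def)

lemma psi_phi:
  "psi1 (phi1 f) = f" "phi1 (psi1 f) = f" "psi3 (phi3 f) = f" "phi3 (psi3 f) = f"
  by (auto simp: psi1_def phi1_def psi3_def phi3_def fun_eq_iff group_word_simps
      simp del: add_uminus_conv_diff)

lemma additive_phi:
  fixes h :: "'a::group_add \<Rightarrow> 'b::group_add"
  assumes "additive h"
  shows "h (phi1 f n) = phi1 (\<lambda>k. h (f k)) n" "h (psi1 f n) = psi1 (\<lambda>k. h (f k)) n"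
    "h (phi3 f n) = phi3 (\<lambda>k. h (f k)) n" "h (psi3 f n) = psi3 (\<lambda>k. h (f k)) n"
  by (auto simp: psi1_def phi1_def psi3_def phi3_def additive_simps[OF assms])

text \<open>Substitutions of words commute with every relation that is compatible with the group operations;
  ternary relations suffice for the applications.\<close>

definition closed3 :: "('a::group_add \<Rightarrow> 'a \<Rightarrow> 'a \<Rightarrow> bool) \<Rightarrow> bool" where
  "closed3 R \<longleftrightarrow> (\<forall>x y z x' y' z'. R x y z \<longrightarrow> R x' y' z' \<longrightarrow> R (x + x') (y + y') (z + z'))
     \<and> (\<forall>x y z. R x y z \<longrightarrow> R (- x) (- y) (- z))"

text \<open>Relational parametricity of a substitution. It will transport vanishing at short lists
  (a unary relation), agreement of two families (binary) and additivity (ternary).\<close>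

definition natural3 :: "((nat \<Rightarrow> 'a::group_add) \<Rightarrow> nat \<Rightarrow> 'a) \<Rightarrow> bool" where
  "natural3 \<phi> \<longleftrightarrow> (\<forall>R f g h. closed3 R \<longrightarrow> (\<forall>n. R (f n) (g n) (h n)) \<longrightarrow>
     (\<forall>n. R (\<phi> f n) (\<phi> g n) (\<phi> h n)))"

lemma natural3D:
  "natural3 \<phi> \<Longrightarrow> closed3 R \<Longrightarrow> (\<And>n. R (f n) (g n) (h n)) \<Longrightarrow> R (\<phi> f n) (\<phi> g n) (\<phi> h n)"
  unfolding natural3_def by blast

lemma natural3_phi: "natural3 phi1" "natural3 phi3"
  unfolding natural3_def phi1_def phi3_def closed3_def diff_conv_add_uminus
  by (auto simp del: add_uminus_conv_diff)

text \<open>A triple of cochains \<open>Y\<close> extends the assignment on \<open>w\<close> to \<open>t\<close>, with defect \<open>e\<close>, iff it is a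
  fixed point of \<open>bstep\<close>.\<close>

definition bstep :: "((nat \<Rightarrow> 'a::group_add sdp) \<Rightarrow> nat \<Rightarrow> 'a sdp) \<Rightarrow> (nat \<Rightarrow> 'a) \<Rightarrow> 'a \<Rightarrow>
    (nat \<Rightarrow> 'a list \<Rightarrow> int) \<Rightarrow> (nat \<Rightarrow> 'a list \<Rightarrow> int) \<Rightarrow> nat \<Rightarrow> 'a list \<Rightarrow> int" where
  "bstep \<phi> w t e Y n = act (\<lambda>xs. fn (\<phi> (\<lambda>k. Sdp (w k) (Y k)) n) xs + e n xs) (- t)"

text \<open>To invert, undo the translation and the defect, which yields the cochain parts over the
  base points \<open>\<phi>g w\<close>, and apply the inverse substitution
  \<open>\<psi>\<close>.\<close>

lemma bij_bstep:
  fixes \<phi> :: "(nat \<Rightarrow> 'a::group_add sdp) \<Rightarrow> nat \<Rightarrow> 'a sdp"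
  assumes "\<And>f. \<psi> (\<phi> f) = f" "\<And>f. \<phi> (\<psi> f) = f" "\<psi>g (\<phi>g w) = w"
    and gp\<phi>: "\<And>f n. gp (\<phi> f n) = \<phi>g (\<lambda>k. gp (f k)) n"
    and gp\<psi>: "\<And>f n. gp (\<psi> f n) = \<psi>g (\<lambda>k. gp (f k)) n"
  shows "bij (bstep \<phi> w t e)"
proof (rule o_bij)
  define B where "B Z n = fn (\<psi> (\<lambda>k. Sdp (\<phi>g w k) (\<lambda>xs. act (Z k) t xs - e k xs)) n)" for Z n
  have eta: "Sdp a (fn b) = b" if "gp b = a" for a and b :: "'a sdp" using that by (cases b) auto
  have "bstep \<phi> w t e (B Z) = Z" for Z
  proof -
    let ?V = "\<lambda>k. Sdp (\<phi>g w k) (\<lambda>xs. act (Z k) t xs - e k xs)"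
    have "Sdp (w k) (B Z k) = \<psi> ?V k" for k
      unfolding B_def using assms(3) by (intro eta) (simp add: gp\<psi>)
    then have "bstep \<phi> w t e (B Z) n = Z n" for n
      unfolding bstep_def by (simp add: assms act_act)
    then show ?thesis by auto
  qed
  then show "bstep \<phi> w t e \<circ> B = id" by auto
  have "B (bstep \<phi> w t e Y) = Y" for Y
  proof -
    let ?F = "\<lambda>k. Sdp (w k) (Y k)"
    have "(\<lambda>k. Sdp (\<phi>g w k) (\<lambda>xs. act (bstep \<phi> w t e Y k) t xs - e k xs)) = \<phi> ?F"
    proof
      fix k
      have "(\<lambda>xs. act (bstep \<phi> w t e Y k) t xs - e k xs) = fn (\<phi> ?F k)"
        by (simp add: bstep_def act_act)
      then show "Sdp (\<phi>g w k) (\<lambda>xs. act (bstep \<phi> w t e Y k) t xs - e k xs) = \<phi> ?F k"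
        by (simp add: eta gp\<phi>)
    qed
    then show ?thesis unfolding B_def by (simp add: assms)
  qed
  then show "B \<circ> bstep \<phi> w t e = id" by auto
qed

text \<open>The value of \<open>bstep \<phi> w t e Y\<close> at \<open>xs\<close> involves \<open>Y\<close> only at translates of \<open>- t + xs\<close> by elements
  of the kernel of \<open>\<gamma>\<close>. Hence letting \<open>Y\<close> at \<open>xs\<close> be given by the orbit of zero at the first entry
  of \<open>xs\<close> yields a fixed point.\<close>

lemma bstep_fixed_point:
  fixes \<gamma> :: "'a::group_add \<Rightarrow> (nat \<Rightarrow> 'a list \<Rightarrow> int) bijn"
  assumes nat: "natural3 \<phi>" and \<gamma>: "additive \<gamma>" and w: "\<And>k. \<gamma> (w k) = 0"
    and t: "bapp (\<gamma> t) = bstep \<phi> w t e" and e: "\<And>n. e n [] = 0"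
    and Y: "\<And>n xs. Y n xs = (if xs = [] then 0 else bapp (\<gamma> (hd xs)) (\<lambda>_ _. 0) n xs)"
  shows "bstep \<phi> w t e Y = Y"
proof (intro ext)
  fix n xs
  note \<gamma>s = additive_simps[OF \<gamma>]
  show "bstep \<phi> w t e Y n xs = Y n xs"
  proof (cases "xs = []")
    case True
    \<comment> \<open>Translations fix the empty list, so vanishing there passes to sums and
      inverses.\<close>
    have "closed3 (\<lambda>a b c :: 'a sdp. fn a [] = 0)"
      by (auto simp: closed3_def fn_simps act_def)
    from natural3D[OF nat this, of "\<lambda>k. Sdp (w k) (Y k)" n]
    show ?thesis using True by (simp add: bstep_def act_def e Y)
  next
    case False
    define ys where "ys = map ((+) (- t)) xs"
    \<comment> \<open>\<open>Z\<close> freezes the orbit parameter at the first entry of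
      \<open>ys\<close>. On translates of \<open>ys\<close> by kernel elements \<open>Y\<close> and
      \<open>Z\<close> agree, because \<open>\<gamma>\<close> does not change along them.
      \<open>R\<close> carries this agreement through \<open>\<phi>\<close>; it is closed since
      group components stay in the kernel.\<close>
    define Z where "Z = bapp (\<gamma> (- t + hd xs)) (\<lambda>_ _. 0)"
    define R where "R a b c \<longleftrightarrow> gp a = gp b \<and> \<gamma> (gp a) = 0
      \<and> (\<forall>u. \<gamma> u = 0 \<longrightarrow> fn a (map ((+) u) ys) = fn b (map ((+) u) ys))" for a b c :: "'a sdp"
    have eq: "fn a (map ((+) u) ys) = fn b (map ((+) u) ys)" if "R a b c" "\<gamma> u = 0" for a b c u
      using that by (auto simp: R_def)
    have "closed3 R"
      unfolding closed3_def
    proof (intro conjI allI impI)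
      fix a b c a' b' c' assume h: "R a b c" "R a' b' c'"
      then have g: "gp a = gp b" "gp a' = gp b'" "\<gamma> (gp a) = 0" "\<gamma> (gp a') = 0" by (auto simp: R_def)
      then show "R (a + a') (b + b') (c + c')"
        using eq[OF h(1), of "gp b' + _"] eq[OF h(2)]
        by (auto simp: R_def \<gamma>s fn_simps act_def o_def add.assoc[symmetric])
    next
      fix a b c assume h: "R a b c"
      then have g: "gp a = gp b" "\<gamma> (gp a) = 0" by (auto simp: R_def)
      then show "R (- a) (- b) (- c)"
        using eq[OF h, of "- gp b + _"]
        by (auto simp: R_def \<gamma>s fn_simps act_def o_def add.assoc[symmetric])
    qed
    moreover have "R (Sdp (w k) (Y k)) (Sdp (w k) (Z k)) c" for k c
      using False by (auto simp: R_def w Y Z_def ys_def hd_map \<gamma>s)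
    ultimately have "R (\<phi> (\<lambda>k. Sdp (w k) (Y k)) n) (\<phi> (\<lambda>k. Sdp (w k) (Z k)) n) (\<phi> undefined n)"
      by (rule natural3D[OF nat])
    from eq[OF this, of 0] have "fn (\<phi> (\<lambda>k. Sdp (w k) (Y k)) n) ys = fn (\<phi> (\<lambda>k. Sdp (w k) (Z k)) n) ys"
      by (simp add: \<gamma>s map_idI)
    then have "bstep \<phi> w t e Y n xs = bstep \<phi> w t e Z n xs"
      by (simp add: bstep_def act_def ys_def)
    \<comment> \<open>\<open>bstep\<close> is the bijection \<open>\<gamma> t\<close>, so it moves
      the orbit point at \<open>- t + hd xs\<close> to the one at \<open>hd xs\<close>.\<close>
    also have "\<dots> = bapp (\<gamma> t + \<gamma> (- t + hd xs)) (\<lambda>_ _. 0) n xs"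
      by (simp add: Z_def t plus_bijn.rep_eq)
    also have "\<dots> = Y n xs"
      using False by (simp add: Y \<gamma>s add.assoc[symmetric])
    finally show ?thesis .
  qed
qed

lemma bij_bstep_phi1: "bij (bstep phi1 w t e)"
  by (rule bij_bstep[of psi1 phi1 psi1 phi1])
    (auto simp: psi_phi additive_phi additive_def)

lemma bij_bstep_phi3: "bij (bstep phi3 w t e)"
  by (rule bij_bstep[of psi3 phi3 psi3 phi3])
    (auto simp: psi_phi additive_phi additive_def)

section \<open>Lifting a derivation through the coboundary\<close>

definition gw :: "nat \<Rightarrow> pv3" where
  "gw = trip gp0 gq0 gr0"

lemma gw_rel: "gw n + gt1 = gt1 + phi1 gw n" "gw n + gt3 = gt3 + phi3 gw n"
  unfolding gw_def using semidirect_relD[OF semidirect_rel_gen] by blast+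

lemma gw_simps: "gw 0 = gp0" "gw 1 = gq0" "gw 2 = gr0" "n \<ge> 3 \<Longrightarrow> gw n = 0"
  by (auto simp: gw_def trip_def)

lemma ex_bstep_fixed_point:
  fixes e1 e3 :: "nat \<Rightarrow> pv3 list \<Rightarrow> int"
  assumes "\<And>n. e1 n [] = 0" "\<And>n. e3 n [] = 0"
  obtains Y where "bstep phi1 gw gt1 e1 Y = Y" "bstep phi3 gw gt3 e3 Y = Y" "\<And>n. Y n [] = 0"
proof -
  let ?B1 = "Bijn (bstep phi1 gw gt1 e1)" and ?B3 = "Bijn (bstep phi3 gw gt3 e3)"
  have B: "bapp ?B1 = bstep phi1 gw gt1 e1" "bapp ?B3 = bstep phi3 gw gt3 e3"
    by (simp_all add: Bijn_inverse bij_bstep_phi1 bij_bstep_phi3)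
  \<comment> \<open>With \<open>p, q, r\<close> sent to the identity all six relations are trivial,
    so the two affine maps need not satisfy any relation: \<open>t1\<close> and \<open>t3\<close>
    act through a free group.\<close>
  have "semidirect_rel 0 0 0 ?B1 ?B3" by (simp add: semidirect_rel_def)
  then obtain \<gamma> where \<gamma>: "additive \<gamma>" "\<gamma> gp0 = 0" "\<gamma> gq0 = 0" "\<gamma> gr0 = 0" "\<gamma> gt1 = ?B1" "\<gamma> gt3 = ?B3"
    by (rule ex_hom_semidirect[where g = 0])
  have w: "\<gamma> (gw k) = 0" for k
    using \<gamma> by (simp add: gw_def trip_def additive_simps)
  define Y where "Y n xs = (if xs = [] then 0 else bapp (\<gamma> (hd xs)) (\<lambda>_ _. 0) n xs)" for n xs
  show ?thesis
  proof
    show "bstep phi1 gw gt1 e1 Y = Y"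
      by (rule bstep_fixed_point[OF natural3_phi(1) \<gamma>(1) w]) (simp_all add: \<gamma> B assms Y_def)
    show "bstep phi3 gw gt3 e3 Y = Y"
      by (rule bstep_fixed_point[OF natural3_phi(2) \<gamma>(1) w]) (simp_all add: \<gamma> B assms Y_def)
  qed (simp add: Y_def)
qed

text \<open>The pointwise primitives \<open>m\<close> violate the relation between \<open>w\<close>
  and \<open>t\<close> by a cochain \<open>\<delta> n\<close>. It is closed, because its coboundary
  compares two values of the derivation \<open>D\<close> at the same element; hence it is the
  coboundary of \<open>cone (\<delta> n)\<close>. Taking coboundaries in the fixed point equation
  shows that adding \<open>hd_cob (Y n)\<close> cancels \<open>\<delta> n\<close>, without changing
  the coboundary of \<open>m (w n)\<close>.\<close>

lemma natural3_lift:
  fixes w :: "nat \<Rightarrow> 'a::group_add"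
  assumes nat: "natural3 \<phi>" and phi_gp: "\<And>f n. gp (\<phi> f n) = \<phi>g (\<lambda>k. gp (f k)) n"
    and phi_cob: "\<And>f n. sdp_cob (\<phi> f n) = \<phi> (\<lambda>k. sdp_cob (f k)) n"
    and rel: "\<And>n. w n + t = t + \<phi>g w n"
    and D: "\<And>n. \<phi> (\<lambda>k. Sdp (w k) (D (w k))) n = Sdp (\<phi>g w n) (D (\<phi>g w n))"
    and DD: "\<And>g h. D (g + h) = (\<lambda>xs. act (D g) h xs + D h xs)"
    and m: "\<And>g. hd_cob (m g) = D g"
    and fix_Y: "bstep \<phi> w t (\<lambda>n. cone (\<lambda>xs. fn (Sdp t (m t) + \<phi> (\<lambda>k. Sdp (w k) (m (w k))) n) xs
       - fn (Sdp (w n) (m (w n)) + Sdp t (m t)) xs)) Y = Y"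
  defines "P \<equiv> \<lambda>n. Sdp (w n) (\<lambda>xs. m (w n) xs + hd_cob (Y n) xs)"
  shows "P n + Sdp t (m t) = Sdp t (m t) + \<phi> P n"
proof -
  let ?M = "\<lambda>k. Sdp (w k) (m (w k))" and ?T = "Sdp t (m t)" and ?Y = "\<lambda>k. Sdp (w k) (Y k)"
  define \<delta> where "\<delta> n xs = fn (?T + \<phi> ?M n) xs - fn (?M n + ?T) xs" for n xs
  have "hd_cob (fn (?T + \<phi> ?M n)) = fn (sdp_cob (?T + \<phi> ?M n))"
    by (simp add: sdp_cob_def)
  also have "\<dots> = fn (Sdp t (D t) + Sdp (\<phi>g w n) (D (\<phi>g w n)))"
    by (simp add: sdp_cob_add phi_cob) (simp add: sdp_cob_def m D)
  also have "\<dots> = fn (sdp_cob (?M n + ?T))"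
    by (simp add: sdp_cob_add) (simp add: sdp_cob_def m fn_simps DD[symmetric] rel)
  finally have "hd_cob (\<delta> n) = (\<lambda>_. 0)"
    by (simp add: \<delta>_def[abs_def] hd_cob_simps sdp_cob_def)
  then have \<delta>: "hd_cob (cone (\<delta> n)) = \<delta> n" by (rule hd_cob_cone)
  have "act (Y n) t = act (bstep \<phi> w t (\<lambda>n. cone (\<delta> n)) Y n) t"
    unfolding \<delta>_def[abs_def] fix_Y ..
  also have "\<dots> = (\<lambda>xs. fn (\<phi> ?Y n) xs + cone (\<delta> n) xs)"
    by (simp add: bstep_def act_act)
  finally have "hd_cob (act (Y n) t) = (\<lambda>xs. hd_cob (fn (\<phi> ?Y n)) xs + \<delta> n xs)"
    by (simp add: hd_cob_simps \<delta>)
  then have Y: "act (hd_cob (Y n)) t = (\<lambda>xs. fn (\<phi> (\<lambda>k. sdp_cob (?Y k)) n) xs + \<delta> n xs)"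
    by (simp add: hd_cob_act phi_cob[symmetric]) (simp add: sdp_cob_def)
  \<comment> \<open>Addition of cochain parts over one group element. Transported through
    \<open>\<phi>\<close>, it splits \<open>\<phi> P\<close> into the contributions of
    \<open>m\<close> and of the correction.\<close>
  define R where "R a b c \<longleftrightarrow> gp a = gp b \<and> gp a = gp c \<and> fn a = (\<lambda>xs. fn b xs + fn c xs)"
    for a b c :: "'a sdp"
  have "closed3 R"
    by (auto simp: closed3_def R_def fn_simps act_simps)
  moreover have "R (P k) (?M k) (sdp_cob (?Y k))" for k
    by (simp add: R_def P_def sdp_cob_def)
  ultimately have "R (\<phi> P n) (\<phi> ?M n) (\<phi> (\<lambda>k. sdp_cob (?Y k)) n)"
    by (rule natural3D[OF nat])
  then have P: "fn (\<phi> P n) = (\<lambda>xs. fn (\<phi> ?M n) xs + fn (\<phi> (\<lambda>k. sdp_cob (?Y k)) n) xs)"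
    by (simp add: R_def)
  have gpP: "gp (\<phi> P n) = \<phi>g w n" "gp (\<phi> ?M n) = \<phi>g w n" by (simp_all add: phi_gp P_def)
  show ?thesis
  proof (rule sdp.expand, intro conjI)
    show "gp (P n + ?T) = gp (?T + \<phi> P n)" by (simp add: gpP rel) (simp add: P_def rel)
    show "fn (P n + ?T) = fn (?T + \<phi> P n)"
      by (simp add: fn_simps P gpP) (simp add: P_def act_simps Y \<delta>_def[abs_def] fn_simps gpP fun_eq_iff)
  qed
qed

text \<open>The derivation \<open>D\<close> measures the failure of \<open>F\<close> to be invariant
  and takes closed values. Lift it through the coboundary to a derivation \<open>\<rho>\<close> with
  values in all cochains; that one is principal on nonempty lists, given by some
  \<open>\<mu>\<close>, and subtracting \<open>hd_cob \<mu>\<close> from \<open>F\<close> restores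
  invariance.\<close>

theorem invariant_primitive:
  fixes F :: "pv3 list \<Rightarrow> int"
  assumes inv: "\<And>g. act (hd_cob F) g = hd_cob F" and F0: "\<And>xs. length xs < 3 \<Longrightarrow> F xs = 0"
  obtains H where "hd_cob H = hd_cob F" "\<And>g xs. length xs \<ge> 2 \<Longrightarrow> act H g xs = H xs"
proof -
  define D where "D g = (\<lambda>xs. act F g xs - F xs)" for g
  define m where "m g = cone (D g)" for g
  define \<Delta> where "\<Delta> g = Sdp g (D g)" for g
  have m: "hd_cob (m g) = D g" for g
    unfolding m_def by (rule hd_cob_cone) (simp add: D_def hd_cob_simps hd_cob_act inv)
  have m0: "m g xs = 0" if "length xs < 2" for g xs
    using that F0 by (simp add: m_def cone_def D_def act_def)
  have DD: "D (g + h) = (\<lambda>xs. act (D g) h xs + D h xs)" for g h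
    by (simp add: D_def act_simps act_act)
  have \<Delta>: "additive \<Delta>"
    by (simp add: additive_def \<Delta>_def plus_sdp_def DD)
  define e where "e \<phi> t n = cone (\<lambda>xs. fn (Sdp t (m t) + \<phi> (\<lambda>k. Sdp (gw k) (m (gw k))) n) xs
       - fn (Sdp (gw n) (m (gw n)) + Sdp t (m t)) xs)" for \<phi> t n
  \<comment> \<open>\<open>cone\<close> at the empty list evaluates at \<open>[0]\<close>. There
    every \<open>m g\<close> vanishes because \<open>F\<close> vanishes below length three.\<close>
  have e0: "e \<phi> t n [] = 0" if "natural3 \<phi>" for \<phi> t n
  proof -
    have "closed3 (\<lambda>a b c :: pv3 sdp. \<forall>xs. length xs < 2 \<longrightarrow> fn a xs = 0)"
      by (auto simp: closed3_def fn_simps act_def)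
    from natural3D[OF that this, of "\<lambda>k. Sdp (gw k) (m (gw k))" n] show ?thesis
      by (simp add: e_def cone_def fn_simps act_def m0)
  qed
  obtain Y where Y: "bstep phi1 gw gt1 (e phi1 gt1) Y = Y" "bstep phi3 gw gt3 (e phi3 gt3) Y = Y"
    using ex_bstep_fixed_point[of "e phi1 gt1" "e phi3 gt3"] e0 natural3_phi by metis
  define P where "P n = Sdp (gw n) (\<lambda>xs. m (gw n) xs + hd_cob (Y n) xs)" for n
  have gp_add: "additive gp" and cob_add: "additive sdp_cob"
    by (auto simp: additive_def sdp_cob_add)
  have "P n + Sdp gt1 (m gt1) = Sdp gt1 (m gt1) + phi1 P n" for n
    unfolding P_def
    by (rule natural3_lift[OF natural3_phi(1) additive_phi(1)[OF gp_add] additive_phi(1)[OF cob_add]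
          gw_rel(1) _ DD m Y(1)[unfolded e_def]])
      (use additive_phi(1)[OF \<Delta>, of gw] in \<open>simp add: \<Delta>_def\<close>)
  moreover have "P n + Sdp gt3 (m gt3) = Sdp gt3 (m gt3) + phi3 P n" for n
    unfolding P_def
    by (rule natural3_lift[OF natural3_phi(2) additive_phi(3)[OF gp_add] additive_phi(3)[OF cob_add]
          gw_rel(2) _ DD m Y(2)[unfolded e_def]])
      (use additive_phi(3)[OF \<Delta>, of gw] in \<open>simp add: \<Delta>_def\<close>)
  ultimately have "semidirect_rel (P 0) (P 1) (P 2) (Sdp gt1 (m gt1)) (Sdp gt3 (m gt3))"
    by (rule semidirect_relI)
  then obtain \<rho> where \<rho>: "additive \<rho>" "\<rho> gp0 = P 0" "\<rho> gq0 = P 1" "\<rho> gr0 = P 2"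
    "\<rho> gt1 = Sdp gt1 (m gt1)" "\<rho> gt3 = Sdp gt3 (m gt3)" "\<rho> (gen (1,3)) = Sdp (gen (1,3)) (m (gen (1,3)))"
    by (rule ex_hom_semidirect)
  \<comment> \<open>Two identities between homomorphisms, checked on the semidirect generators:
    \<open>\<rho>\<close> is a section over the group, and its coboundary is
    \<open>\<Delta>\<close>.\<close>
  have gp: "gp (\<rho> g) = g" for g
    by (rule hom_ext_semidirect[where h = "\<lambda>g. gp (\<rho> g)" and k = "\<lambda>g. g"])
      (use \<rho> in \<open>simp_all add: additive_def P_def gw_simps gw_simps(2)[unfolded One_nat_def]\<close>)
  have "additive (\<lambda>g. sdp_cob (\<rho> g))"
    by (simp add: additive_def sdp_cob_add additive_simps(1)[OF \<rho>(1)])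
  then have "sdp_cob (\<rho> g) = \<Delta> g" for g
    by (rule hom_ext_semidirect[OF _ \<Delta>])
      (use \<rho> in \<open>simp_all add: P_def gw_simps
         gw_simps(2)[unfolded One_nat_def] sdp_cob_def \<Delta>_def hd_cob_simps m\<close>)
  then have cob: "hd_cob (fn (\<rho> g)) = D g" for g
    by (simp add: sdp_cob_def \<Delta>_def)
  \<comment> \<open>Unrestricted cochains form a coinduced module, so derivations into them are
    principal: translate a list to start at 0 and use the derivation at its first entry. The empty
    list has none; hence the default 0 and the restriction to length at least two, where all faces
    are nonempty.\<close>
  define \<mu> where "\<mu> xs = (if xs = [] then 0 else fn (\<rho> (hd xs)) (map ((+) (- hd xs)) xs))" for xs
  have \<mu>: "act \<mu> g xs = fn (\<rho> g) xs + \<mu> xs" if "xs \<noteq> []" for g xs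
  proof -
    have "fn (\<rho> (g + h)) = (\<lambda>xs. act (fn (\<rho> g)) h xs + fn (\<rho> h) xs)" for h
      using additive_simps(1)[OF \<rho>(1)] by (simp add: fn_simps gp)
    then show ?thesis
      using that by (simp add: \<mu>_def act_def hd_map o_def minus_add add.assoc
        del: add_uminus_conv_diff)
  qed
  show ?thesis
  proof
    show "hd_cob (\<lambda>xs. F xs - hd_cob \<mu> xs) = hd_cob F"
      by (simp add: hd_cob_simps)
    fix g and xs :: "pv3 list" assume xs: "length xs \<ge> 2"
    have "act (hd_cob \<mu>) g xs = hdiff xs (act \<mu> g)"
      by (simp add: hd_cob_act[symmetric] hd_cob_def)
    also have "\<dots> = hdiff xs (\<lambda>ys. fn (\<rho> g) ys + \<mu> ys)"
      using xs by (intro hdiff_cong \<mu>) auto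
    also have "\<dots> = hd_cob (fn (\<rho> g)) xs + hd_cob \<mu> xs"
      by (simp add: hdiff_add hd_cob_def)
    also have "\<dots> = act F g xs - F xs + hd_cob \<mu> xs"
      by (simp add: cob D_def)
    finally show "act (\<lambda>xs. F xs - hd_cob \<mu> xs) g xs = F xs - hd_cob \<mu> xs"
      by (simp add: act_simps)
  qed
qed

section \<open>Two-cocycles\<close>

text \<open>Value of \<open>f\<close> on the bar two-chain of a relator: the cells that multiply out
  its left side, minus those for its right side.\<close>

definition rel_eval :: "(pv3 \<Rightarrow> pv3 \<Rightarrow> int) \<Rightarrow> nat \<Rightarrow> nat \<Rightarrow> nat \<Rightarrow> int" where
  "rel_eval f k i j = f (gen (k,i)) (gen (k,j)) + f (gen (k,i) + gen (k,j)) (gen (i,j))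
     - f (gen (i,j)) (gen (k,j)) - f (gen (i,j) + gen (k,j)) (gen (k,i))"

text \<open>The hypothesis on relators says that the lifts \<open>E (gen s) 0\<close> satisfy the
  defining relations. So the central extension given by \<open>f\<close> splits, and the splitting,
  compared with the lifts \<open>E g 0\<close>, yields a primitive.\<close>

theorem cocycle2_primitive:
  fixes f :: "pv3 \<Rightarrow> pv3 \<Rightarrow> int"
  assumes f: "\<And>x y z. f y z - f (x + y) z + f x (y + z) - f x y = 0"
    and rel: "\<And>k i j. {k, i, j} = {1, 2, 3} \<Longrightarrow> rel_eval f k i j = 0"
  obtains c where "\<And>x y. f x y = c x - c (x + y) + c y"
proof -
  \<comment> \<open>The pairs \<open>E g a\<close> form the central extension defined by \<open>f\<close>, embedded in the semidirect product.\<close>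
  define E where "E g a = Sdp g (\<lambda>xs. if xs = [] then 0 else a + f g (hd xs))" for g a
  have add: "E g a + E h b = E (g + h) (a + b + f g h)" for g h a b
    unfolding E_def plus_sdp_def
    by (auto simp: act_def hd_map fun_eq_iff) (use f[of h _ g] in \<open>simp add: algebra_simps\<close>)
  have inj: "a = b" if "E g a = E g b" for g a b
  proof -
    have "fn (E g a) [0] = fn (E g b) [0]" using that by simp
    then show ?thesis by (simp add: E_def)
  qed
  \<comment> \<open>\<open>f\<close> is not assumed normalised, so the neutral element of the
    extension has central part \<open>- f 0 0\<close>.\<close>
  have "f 0 x = f 0 0" for x using f[of 0 x 0] by simp
  then have E_zero: "E 0 (- f 0 0) = 0"
    by (auto simp: E_def zero_sdp_def fun_eq_iff)
  have "pv3_rel (\<lambda>s. E (gen s) 0)"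
    unfolding pv3_rel_def
  proof (intro allI impI)
    fix k i j :: nat assume h: "{k, i, j} = {1, 2, 3}"
    then have "gen (k,i) + gen (k,j) + gen (i,j) = gen (i,j) + gen (k,j) + gen (k,i)"
      using pv3_rel_gen unfolding pv3_rel_def by blast
    moreover from rel[OF h] have "f (gen (k,i)) (gen (k,j)) + f (gen (k,i) + gen (k,j)) (gen (i,j))
        = f (gen (i,j)) (gen (k,j)) + f (gen (i,j) + gen (k,j)) (gen (k,i))"
      by (simp add: rel_eval_def)
    ultimately show "E (gen (k,i)) 0 + E (gen (k,j)) 0 + E (gen (i,j)) 0
        = E (gen (i,j)) 0 + E (gen (k,j)) 0 + E (gen (k,i)) 0"
      by (simp add: add)
  qed
  then obtain \<rho> where \<rho>: "additive \<rho>" "\<And>s. s \<in> idxs \<Longrightarrow> \<rho> (gen s) = E (gen s) 0"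
    using additive_lift_hom lift_hom_gen by blast
  have "\<exists>a. \<rho> g = E g a" for g
  proof (induction g rule: pv3_induct)
    case zero
    then show ?case using E_zero by (metis additive_simps(2)[OF \<rho>(1)])
  next
    case (uminus g)
    then obtain a where a: "\<rho> g = E g a" ..
    have "E g a + E (- g) (- f 0 0 - a - f g (- g)) = 0"
      by (simp add: add E_zero)
    from minus_unique[OF this] show ?case
      by (auto simp: additive_simps[OF \<rho>(1)] a)
  qed (auto simp: \<rho>(2) additive_simps[OF \<rho>(1)] add)
  then obtain c where c: "\<And>g. \<rho> g = E g (c g)" by metis
  have "c (x + y) = c x + c y + f x y" for x y
    using additive_simps(1)[OF \<rho>(1), of x y] by (intro inj[of "x + y"]) (simp add: c add)
  then show ?thesis by (intro that[of "\<lambda>x. - c x"]) simp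
qed

section \<open>Cohomology classes\<close>

subsection \<open>Inhomogeneous and homogeneous cochains\<close>

fun diffs :: "'a::group_add list \<Rightarrow> 'a list" where
  "diffs (x # y # zs) = (- x + y) # diffs (y # zs)"
| "diffs _ = []"

text \<open>The representative starting at 0 in the translation orbit that belongs to a bar
  symbol.\<close>

primrec psums :: "'a::group_add list \<Rightarrow> 'a list" where
  "psums [] = [0]"
| "psums (g # gs) = 0 # map ((+) g) (psums gs)"

lemma length_diffs [simp]: "length (diffs xs) = length xs - 1"
  by (induction xs rule: diffs.induct) auto

lemma length_psums [simp]: "length (psums gs) = Suc (length gs)"
  by (induction gs) auto

lemma diffs_map: "diffs (map ((+) g) xs) = diffs xs"
  by (induction xs rule: diffs.induct) (auto simp: minus_add add.assoc simp del: add_uminus_conv_diff)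

lemma psums_Cons: "psums gs = 0 # tl (psums gs)"
  by (cases gs) auto

lemma diffs_psums: "diffs (psums gs) = gs"
proof (induction gs)
  case (Cons g gs)
  obtain ys where "psums gs = 0 # ys" using psums_Cons by blast
  then show ?case using diffs_map[of g "psums gs"] Cons.IH by simp
qed simp

lemma psums_diffs: "xs \<noteq> [] \<Longrightarrow> psums (diffs xs) = map ((+) (- hd xs)) xs"
  by (induction xs rule: diffs.induct)
    (auto simp: o_def add.assoc simp del: add_uminus_conv_diff)

lemma diffs_tl: "diffs (tl xs) = tl (diffs xs)"
  by (cases xs rule: diffs.cases) auto

lemma diffs_take: "diffs (take (Suc n) xs) = take n (diffs xs)"
proof (induction xs arbitrary: n rule: diffs.induct)
  case (1 x y zs)
  then show ?case by (cases n) auto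
qed auto

lemma diffs_drop: "diffs (drop n xs) = drop n (diffs xs)"
  by (induction n arbitrary: xs) (simp_all add: drop_Suc diffs_tl)

lemma diffs_remove:
  assumes "Suc (Suc j) < length xs"
  shows "diffs (take (Suc j) xs @ drop (Suc (Suc j)) xs)
    = take j (diffs xs) @ [diffs xs ! j + diffs xs ! Suc j] @ drop (Suc (Suc j)) (diffs xs)"
  using assms
proof (induction j arbitrary: xs)
  case 0
  then obtain x y z zs where "xs = x # y # z # zs"
    by (cases xs rule: diffs.cases; cases "tl (tl xs)") auto
  then show ?case by (simp add: add.assoc del: add_uminus_conv_diff)
next
  case (Suc j)
  then obtain x y ys where xs: "xs = x # y # ys"
    by (cases xs rule: diffs.cases) auto
  then show ?case using Suc.IH[of "y # ys"] Suc.prems by simp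
qed

text \<open>A list \<open>[x\<^sub>0, \<dots>, x\<^sub>n]\<close> of a homogeneous cochain corresponds to the bar notation
  \<open>[-x\<^sub>0 + x\<^sub>1, \<dots>, -x\<^sub>n\<^sub>-\<^sub>1 + x\<^sub>n]\<close>. The empty list has no counterpart, hence the junk value 0.\<close>

definition hmg :: "(letter list set list \<Rightarrow> int) \<Rightarrow> pv3 list \<Rightarrow> int" where
  "hmg f xs = (if xs = [] then 0 else f (map Rep_pv3 (diffs xs)))"

lemma set_Rep: "set (map Rep_pv3 gs) \<subseteq> carrier PV3"
  using Rep_pv3 by auto

lemma carrier_list_cases:
  assumes "set ks \<subseteq> carrier PV3" "length ks = n"
  obtains gs where "ks = map Rep_pv3 gs" "length gs = n"
proof
  show "ks = map Rep_pv3 (map Abs_pv3 ks)"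
    using assms by (induction ks arbitrary: n) (auto simp: Abs_pv3_inverse)
qed (use assms in simp)

lemma carrier_list_diffs:
  assumes "set ks \<subseteq> carrier PV3" "length ks = n"
  obtains xs where "ks = map Rep_pv3 (diffs xs)" "length xs = Suc n"
  using carrier_list_cases[OF assms] diffs_psums length_psums by metis

lemma coboundary_hdiff:
  assumes "length xs = n + 2"
  shows "coboundary PV3 n f (map Rep_pv3 (diffs xs)) = hdiff xs (hmg f)"
proof -
  let ?t = "\<lambda>i. (-1) ^ i * hmg f (take i xs @ drop (Suc i) xs)"
  let ?d = "map Rep_pv3 (diffs xs)"
  have mid: "?t i = (-1) ^ i * f (take (i - 1) ?d @ [?d ! (i - 1) \<otimes>\<^bsub>PV3\<^esub> ?d ! i] @ drop (i + 1) ?d)"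
    if i: "i \<in> {1..n}" for i
  proof -
    obtain j where j: "i = Suc j" using i by (cases i) auto
    have "xs \<noteq> []" using assms by auto
    then have "hmg f (take i xs @ drop (Suc i) xs) = f (map Rep_pv3 (diffs (take i xs @ drop (Suc i) xs)))"
      unfolding hmg_def by (simp add: j)
    also have "diffs (take i xs @ drop (Suc i) xs) = take j (diffs xs) @ [diffs xs ! j + diffs xs ! i]
      @ drop (Suc i) (diffs xs)"
      unfolding j by (rule diffs_remove) (use i j assms in simp)
    finally show ?thesis
      using i assms by (simp add: j take_map drop_map mult_PV3 map_nth)
  qed
  have first: "?t 0 = f (tl ?d)"
    using assms by (cases xs) (auto simp: hmg_def map_tl[symmetric] diffs_tl[symmetric])
  have "take (Suc n) xs \<noteq> []" using assms by (cases xs) auto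
  then have last: "?t (Suc n) = (-1) ^ Suc n * f (take n ?d)"
    using assms by (simp add: hmg_def take_map diffs_take)
  have "hdiff xs (hmg f) = (\<Sum>i\<in>{0..Suc n}. ?t i)"
    unfolding hdiff_sum using assms by (intro sum.cong) auto
  also have "\<dots> = ?t 0 + (\<Sum>i\<in>{1..n}. ?t i) + ?t (Suc n)"
    by (simp add: sum.atLeast_Suc_atMost)
  also have "\<dots> = coboundary PV3 n f ?d"
    unfolding coboundary_def first last using assms set_Rep[of "diffs xs"] mid by simp
  finally show ?thesis by simp
qed

lemma cocycles_iff:
  "f \<in> cocycles PV3 n \<longleftrightarrow> f \<in> cochains PV3 n \<and> (\<forall>xs. length xs = n + 2 \<longrightarrow> hdiff xs (hmg f) = 0)"
proof -
  have "coboundary PV3 n f = (\<lambda>_. 0)" if h: "\<forall>xs. length xs = n + 2 \<longrightarrow> hdiff xs (hmg f) = 0"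
  proof
    fix ks
    show "coboundary PV3 n f ks = 0"
    proof (cases "length ks = Suc n \<and> set ks \<subseteq> carrier PV3")
      case True
      then obtain xs where xs: "ks = map Rep_pv3 (diffs xs)" "length xs = n + 2"
        using carrier_list_diffs[of ks "Suc n"] by auto
      with h show ?thesis by (simp add: coboundary_hdiff)
    qed (auto simp: coboundary_def)
  qed
  then show ?thesis
    unfolding cocycles_def using coboundary_hdiff[of _ n f] by auto
qed

lemma hmg_eq_0: "f \<in> cochains PV3 n \<Longrightarrow> length xs \<noteq> Suc n \<Longrightarrow> hmg f xs = 0"
  by (cases xs) (auto simp: cochains_def hmg_def)

lemma hd_cob_hmg:
  assumes "f \<in> cocycles PV3 n"
  shows "hd_cob (hmg f) = (\<lambda>_. 0)"
proof
  fix xs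
  show "hd_cob (hmg f) xs = 0"
  proof (cases "length xs = n + 2")
    case False
    have "hdiff xs (hmg f) = hdiff xs (\<lambda>_. 0)"
      using assms False by (intro hdiff_cong hmg_eq_0[of f n]) (auto simp: cocycles_iff)
    then show ?thesis by (simp add: hd_cob_def hdiff_zero)
  qed (use assms in \<open>auto simp: cocycles_iff hd_cob_def\<close>)
qed

lemma cochains_eqI:
  assumes "f \<in> cochains PV3 n" "g \<in> cochains PV3 n"
    "\<And>gs. length gs = n \<Longrightarrow> f (map Rep_pv3 gs) = g (map Rep_pv3 gs)"
  shows "f = g"
proof
  fix ks
  show "f ks = g ks"
  proof (cases "length ks = n \<and> set ks \<subseteq> carrier PV3")
    case True
    then obtain gs where "ks = map Rep_pv3 gs" "length gs = n"
      by (elim conjE carrier_list_cases)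
    then show ?thesis using assms(3) by simp
  next
    case False
    then have "f ks = 0" "g ks = 0" using assms(1,2) unfolding cochains_def by blast+
    then show ?thesis by simp
  qed
qed

lemma coboundary_in_cochains: "coboundary G n f \<in> cochains G (Suc n)"
  by (auto simp: coboundary_def cochains_def split: if_splits)

text \<open>The cone of \<open>hmg f\<close> is a primitive, and for \<open>n \<ge> 3\<close> it
  vanishes on lists shorter than three, so it can be made invariant. Invariance is what lets the
  result descend to bar notation.\<close>

theorem cocycles_subset_coboundaries:
  assumes "n \<ge> 3" "f \<in> cocycles PV3 n"
  shows "f \<in> coboundaries PV3 n"
proof -
  have fc: "f \<in> cochains PV3 n" using assms by (simp add: cocycles_def)
  obtain m where n: "n = Suc m" "m \<ge> 2" using assms(1) by (cases n) auto
  have F: "hd_cob (cone (hmg f)) = hmg f"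
    by (rule hd_cob_cone[OF hd_cob_hmg[OF assms(2)]])
  have "act (hmg f) g = hmg f" for g
    by (auto simp: fun_eq_iff act_def hmg_def diffs_map)
  moreover have "cone (hmg f) xs = 0" if "length xs < 3" for xs
    unfolding cone_def using that assms(1) by (intro hmg_eq_0[OF fc]) simp
  ultimately obtain H where H: "hd_cob H = hmg f" "\<And>g xs. length xs \<ge> 2 \<Longrightarrow> act H g xs = H xs"
    using invariant_primitive[of "cone (hmg f)"] unfolding F by metis
  \<comment> \<open>Evaluate at the tuple starting at 0; by invariance this agrees with
    \<open>H\<close> on every translate.\<close>
  define h where "h ks = (if length ks = m \<and> set ks \<subseteq> carrier PV3 then H (psums (map Abs_pv3 ks)) else 0)"
    for ks
  have h: "h \<in> cochains PV3 m" by (auto simp: cochains_def h_def)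
  have hH: "hmg h ys = H ys" if "length ys = Suc m" for ys
  proof -
    have "ys \<noteq> []" using that by auto
    moreover have "length ys \<ge> 2" using that n by simp
    ultimately show ?thesis
      using that set_Rep[of "diffs ys"] H(2)[of ys "- hd ys"]
      by (simp add: hmg_def h_def o_def Rep_pv3_inverse psums_diffs act_def)
  qed
  have "coboundary PV3 m h = f"
  proof (rule cochains_eqI[of _ n])
    fix gs :: "pv3 list" assume "length gs = n"
    then have l: "length (psums gs) = m + 2" by (simp add: n)
    have "coboundary PV3 m h (map Rep_pv3 (diffs (psums gs))) = hdiff (psums gs) (hmg h)"
      by (rule coboundary_hdiff[OF l])
    also have "\<dots> = hdiff (psums gs) H"
      using l by (intro hdiff_cong hH) simp
    also have "\<dots> = hmg f (psums gs)"
      using H(1) by (metis hd_cob_def)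
    also have "\<dots> = f (map Rep_pv3 gs)"
      using l by (simp add: hmg_def diffs_psums flip: length_0_conv)
    finally show "coboundary PV3 m h (map Rep_pv3 gs) = f (map Rep_pv3 gs)"
      by (simp add: diffs_psums)
  qed (use coboundary_in_cochains fc n in auto)
  then show ?thesis using h by (auto simp: coboundaries_def n)
qed

subsection \<open>Cup products of cocycles\<close>

text \<open>Leibniz rule. The front and back factors share the vertex at position \<open>p\<close>;
  in the induction the head of the list is a vertex of the front factor only, so it can be absorbed
  into \<open>F\<close>.\<close>

lemma hdiff_cup:
  fixes F G :: "'a list \<Rightarrow> int"
  assumes "length xs \<ge> p + 2"
  shows "hdiff xs (\<lambda>ys. F (take (Suc p) ys) * G (drop p ys))
    = hdiff (take (p + 2) xs) F * G (drop (Suc p) xs) + (-1) ^ p * F (take (Suc p) xs) * hdiff (drop p xs) G"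
  using assms
proof (induction p arbitrary: xs F)
  case 0
  then obtain x y zs where "xs = x # y # zs"
    by (cases xs; cases "tl xs") auto
  then show ?case by (simp add: hdiff_scale algebra_simps)
next
  case (Suc p)
  then obtain x ys where xs: "xs = x # ys" and "length ys \<ge> p + 2"
    by (cases xs) auto
  have "hdiff ys (\<lambda>zs. F (x # take (Suc p) zs) * G (drop p zs)) =
      hdiff (take (p + 2) ys) (\<lambda>zs. F (x # zs)) * G (drop (Suc p) ys)
      + (-1) ^ p * F (x # take (Suc p) ys) * hdiff (drop p ys) G"
    by (rule Suc.IH) fact
  then show ?case by (simp add: xs algebra_simps)
qed

lemma cup_cocycle:
  assumes "f \<in> cocycles PV3 p" "g \<in> cocycles PV3 q"
  shows "cup p f g \<in> cocycles PV3 (p + q)"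
  unfolding cocycles_iff
proof (intro conjI allI impI)
  have cf: "\<forall>xs. f xs \<noteq> 0 \<longrightarrow> length xs = p \<and> set xs \<subseteq> carrier PV3"
    and cg: "\<forall>xs. g xs \<noteq> 0 \<longrightarrow> length xs = q \<and> set xs \<subseteq> carrier PV3"
    using assms unfolding cocycles_def cochains_def by blast+
  have "length xs = p + q \<and> set xs \<subseteq> carrier PV3" if "f (take p xs) \<noteq> 0" "g (drop p xs) \<noteq> 0" for xs
  proof -
    have l: "length (take p xs) = p" "length (drop p xs) = q" "set (take p xs) \<subseteq> carrier PV3"
      "set (drop p xs) \<subseteq> carrier PV3"
      using that cf cg by blast+
    have "length xs = p + q"
      using l(1,2) by (metis append_take_drop_id length_append)
    moreover have "set xs \<subseteq> carrier PV3"
      using l(3,4) by (metis append_take_drop_id set_append Un_subset_iff)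
    ultimately show ?thesis ..
  qed
  then show "cup p f g \<in> cochains PV3 (p + q)"
    unfolding cochains_def cup_def mult_eq_0_iff mem_Collect_eq by blast
next
  fix xs :: "pv3 list" assume l: "length xs = p + q + 2"
  have "hdiff xs (hmg (cup p f g)) = hdiff xs (\<lambda>ys. hmg f (take (Suc p) ys) * hmg g (drop p ys))"
  proof (rule hdiff_cong)
    fix ys :: "pv3 list" assume "Suc (length ys) = length xs"
    then have "take (Suc p) ys \<noteq> []" "drop p ys \<noteq> []" "ys \<noteq> []" using l by auto
    then show "hmg (cup p f g) ys = hmg f (take (Suc p) ys) * hmg g (drop p ys)"
      by (simp add: hmg_def cup_def take_map drop_map diffs_take diffs_drop)
  qed
  also have "\<dots> = 0"
  proof -
    have "hdiff ys (hmg f) = 0" "hdiff ys (hmg g) = 0" for ys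
      using fun_cong[OF hd_cob_hmg[OF assms(1)], of ys] fun_cong[OF hd_cob_hmg[OF assms(2)], of ys]
      by (simp_all add: hd_cob_def)
    then show ?thesis using l by (simp add: hdiff_cup)
  qed
  finally show "hdiff xs (hmg (cup p f g)) = 0" .
qed

section \<open>Linear structure, cohomology classes and their representatives\<close>

lemma coboundary_add:
  "coboundary G n (\<lambda>xs. f xs + g xs) = (\<lambda>xs. coboundary G n f xs + coboundary G n g xs)"
  by (auto simp: fun_eq_iff coboundary_def sum.distrib algebra_simps)

lemma coboundary_scale: "coboundary G n (\<lambda>xs. k * f xs) = (\<lambda>xs. k * coboundary G n f xs)"
  by (auto simp: fun_eq_iff coboundary_def sum_distrib_left algebra_simps)

lemma coboundary_zero: "coboundary G n (\<lambda>_. 0) = (\<lambda>_. 0)"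
  by (auto simp: fun_eq_iff coboundary_def)

lemma cochains_closed:
  "(\<lambda>_. 0) \<in> cochains G n"
  "f \<in> cochains G n \<Longrightarrow> g \<in> cochains G n \<Longrightarrow> (\<lambda>xs. f xs + g xs) \<in> cochains G n"
  "f \<in> cochains G n \<Longrightarrow> (\<lambda>xs. k * f xs) \<in> cochains G n"
proof -
  show "(\<lambda>_. 0) \<in> cochains G n" by (simp add: cochains_def)
  show "(\<lambda>xs. f xs + g xs) \<in> cochains G n" if "f \<in> cochains G n" "g \<in> cochains G n"
    using that unfolding cochains_def mem_Collect_eq by (metis add_0)
  show "(\<lambda>xs. k * f xs) \<in> cochains G n" if "f \<in> cochains G n"
    using that unfolding cochains_def mem_Collect_eq mult_eq_0_iff by blast
qed

lemma cocycles_closed: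
  "(\<lambda>_. 0) \<in> cocycles G n"
  "f \<in> cocycles G n \<Longrightarrow> g \<in> cocycles G n \<Longrightarrow> (\<lambda>xs. f xs + g xs) \<in> cocycles G n"
  "f \<in> cocycles G n \<Longrightarrow> (\<lambda>xs. k * f xs) \<in> cocycles G n"
  by (simp_all add: cocycles_def cochains_closed coboundary_add coboundary_scale coboundary_zero)

lemma cocycles_diff:
  "f \<in> cocycles G n \<Longrightarrow> g \<in> cocycles G n \<Longrightarrow> (\<lambda>xs. f xs - g xs) \<in> cocycles G n"
  using cocycles_closed(2)[of f G n "\<lambda>xs. (-1) * g xs"] cocycles_closed(3)[of g G n "-1"] by simp

lemma cocycles_sum:
  assumes "finite A" "\<And>i. i \<in> A \<Longrightarrow> F i \<in> cocycles G n"
  shows "(\<lambda>xs. \<Sum>i\<in>A. F i xs) \<in> cocycles G n"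
  using assms by (induction A rule: finite_induct) (simp_all add: cocycles_closed)

lemma coboundaries_closed:
  "(\<lambda>_. 0) \<in> coboundaries G n"
  "f \<in> coboundaries G n \<Longrightarrow> g \<in> coboundaries G n \<Longrightarrow> (\<lambda>xs. f xs + g xs) \<in> coboundaries G n"
  "f \<in> coboundaries G n \<Longrightarrow> (\<lambda>xs. k * f xs) \<in> coboundaries G n"
proof -
  have cob: "coboundaries G (Suc m) = coboundary G m ` cochains G m" for m
    by (simp add: coboundaries_def)
  have 0: "coboundaries G 0 = {\<lambda>_. 0}" by (simp add: coboundaries_def)
  show "(\<lambda>_. 0) \<in> coboundaries G n"
  proof (cases n)
    case (Suc m)
    show ?thesis unfolding Suc cob
      by (rule image_eqI[of _ _ "\<lambda>_. 0"]) (simp_all add: coboundary_zero cochains_closed)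
  qed (simp add: 0)
  show "(\<lambda>xs. f xs + g xs) \<in> coboundaries G n" if h: "f \<in> coboundaries G n" "g \<in> coboundaries G n"
  proof (cases n)
    case (Suc m)
    with h obtain a b where ab: "a \<in> cochains G m" "b \<in> cochains G m"
      "f = coboundary G m a" "g = coboundary G m b"
      unfolding Suc cob by blast
    show ?thesis unfolding Suc cob ab(3,4)
      by (rule image_eqI[of _ _ "\<lambda>xs. a xs + b xs"]) (simp_all add: coboundary_add cochains_closed ab)
  qed (use h in \<open>simp add: 0\<close>)
  show "(\<lambda>xs. k * f xs) \<in> coboundaries G n" if h: "f \<in> coboundaries G n"
  proof (cases n)
    case (Suc m)
    with h obtain a where a: "a \<in> cochains G m" "f = coboundary G m a"
      unfolding Suc cob by blast
    show ?thesis unfolding Suc cob a(2)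
      by (rule image_eqI[of _ _ "\<lambda>xs. k * a xs"]) (simp_all add: coboundary_scale cochains_closed a)
  qed (use h in \<open>simp add: 0\<close>)
qed

lemma cohom_class_eq_iff:
  assumes "f \<in> cocycles G n" "g \<in> cocycles G n"
  shows "cohom_class G n f = cohom_class G n g \<longleftrightarrow> (\<lambda>xs. f xs - g xs) \<in> coboundaries G n"
proof
  have "g \<in> cohom_class G n g"
    using assms coboundaries_closed(1) by (simp add: cohom_class_def)
  moreover assume "cohom_class G n f = cohom_class G n g"
  ultimately have "g \<in> cohom_class G n f" by (simp only:)
  then show "(\<lambda>xs. f xs - g xs) \<in> coboundaries G n" by (simp add: cohom_class_def)
next
  assume h: "(\<lambda>xs. f xs - g xs) \<in> coboundaries G n"
  have "(\<lambda>xs. f xs - u xs) \<in> coboundaries G n \<longleftrightarrow> (\<lambda>xs. g xs - u xs) \<in> coboundaries G n" for u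
  proof
    assume "(\<lambda>xs. f xs - u xs) \<in> coboundaries G n"
    from coboundaries_closed(2)[OF this coboundaries_closed(3)[OF h, of "-1"]]
    show "(\<lambda>xs. g xs - u xs) \<in> coboundaries G n" by simp
  next
    assume "(\<lambda>xs. g xs - u xs) \<in> coboundaries G n"
    from coboundaries_closed(2)[OF this h]
    show "(\<lambda>xs. f xs - u xs) \<in> coboundaries G n" by simp
  qed
  then show "cohom_class G n f = cohom_class G n g"
    by (simp add: cohom_class_def)
qed

lemma cohom_rep:
  assumes "x n \<in> cohom_class G n ` cocycles G n"
  shows "cohom_rep x n \<in> cocycles G n" "cohom_class G n (cohom_rep x n) = x n"
proof -
  obtain f where f: "f \<in> cocycles G n" "x n = cohom_class G n f" using assms by auto
  have "f \<in> x n" using f coboundaries_closed(1) by (simp add: cohom_class_def)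
  then have "cohom_rep x n \<in> x n" unfolding cohom_rep_def by (rule someI[of "\<lambda>f. f \<in> x n"])
  then have r: "cohom_rep x n \<in> cocycles G n" "(\<lambda>xs. f xs - cohom_rep x n xs) \<in> coboundaries G n"
    by (simp_all add: f cohom_class_def)
  then show "cohom_rep x n \<in> cocycles G n" "cohom_class G n (cohom_rep x n) = x n"
    using cohom_class_eq_iff[OF f(1) r(1)] f by simp_all
qed

subsection \<open>Numerical invariants of cohomology classes\<close>

definition triples :: "(nat \<times> nat \<times> nat) set" where
  "triples = {(1,2,3), (1,3,2), (2,1,3), (2,3,1), (3,1,2), (3,2,1)}"

lemma triples_iff: "(k, i, j) \<in> triples \<longleftrightarrow> {k, i, j} = {1, 2, 3}"
  unfolding triples_def three_eq ..

definition inv1 :: "(letter list set list \<Rightarrow> int) \<Rightarrow> nat \<times> nat \<Rightarrow> int" where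
  "inv1 f s = f [Rep_pv3 (gen s)]"

definition inv2 :: "(letter list set list \<Rightarrow> int) \<Rightarrow> nat \<times> nat \<times> nat \<Rightarrow> int" where
  "inv2 f = (\<lambda>(k, i, j). rel_eval (\<lambda>x y. f [Rep_pv3 x, Rep_pv3 y]) k i j)"

lemma inv1_simps [simp]:
  "inv1 (\<lambda>xs. f xs + g xs) s = inv1 f s + inv1 g s"
  "inv1 (\<lambda>xs. f xs - g xs) s = inv1 f s - inv1 g s"
  "inv1 (\<lambda>xs. k * f xs) s = k * inv1 f s"
  "inv1 (\<lambda>xs. 0) s = 0"
  by (simp_all add: inv1_def)

lemma inv2_simps [simp]:
  "inv2 (\<lambda>xs. f xs + g xs) s = inv2 f s + inv2 g s"
  "inv2 (\<lambda>xs. f xs - g xs) s = inv2 f s - inv2 g s"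
  "inv2 (\<lambda>xs. k * f xs) s = k * inv2 f s"
  "inv2 (\<lambda>xs. 0) s = 0"
  by (simp_all add: inv2_def rel_eval_def case_prod_beta algebra_simps)

lemma inv_sum [simp]:
  "inv1 (\<lambda>xs. \<Sum>i\<in>A. F i xs) s = (\<Sum>i\<in>A. inv1 (F i) s)"
  "inv2 (\<lambda>xs. \<Sum>i\<in>A. F i xs) t = (\<Sum>i\<in>A. inv2 (F i) t)"
  by (induction A rule: infinite_finite_induct; simp)+

lemma set_carrier [simp]: "Rep_pv3 x \<in> carrier PV3"
  by (rule Rep_pv3)

lemma cocycles1_iff:
  assumes "f \<in> cochains PV3 1"
  shows "f \<in> cocycles PV3 1 \<longleftrightarrow> additive (\<lambda>x. f [Rep_pv3 x])"
proof
  assume f: "f \<in> cocycles PV3 1"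
  show "additive (\<lambda>x. f [Rep_pv3 x])"
    unfolding additive_def
  proof (intro allI)
    fix x y
    have "coboundary PV3 1 f [Rep_pv3 x, Rep_pv3 y] = 0" using f by (simp add: cocycles_def)
    then show "f [Rep_pv3 (x + y)] = f [Rep_pv3 x] + f [Rep_pv3 y]"
      by (simp add: coboundary_def mult_PV3)
  qed
next
  assume a: "additive (\<lambda>x. f [Rep_pv3 x])"
  show "f \<in> cocycles PV3 1"
    unfolding cocycles_def
  proof (intro CollectI conjI assms cochains_eqI[OF coboundary_in_cochains cochains_closed(1)])
    fix gs :: "pv3 list" assume "length gs = Suc 1"
    then obtain x y where "gs = [x, y]" by (auto simp: length_Suc_conv)
    then show "coboundary PV3 1 f (map Rep_pv3 gs) = 0"
      using a by (simp add: coboundary_def mult_PV3 additive_def)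
  qed
qed

lemma coboundaries1: "coboundaries PV3 1 = {\<lambda>_. 0}"
proof -
  have "coboundary PV3 0 f = (\<lambda>_. 0)" for f
  proof (rule cochains_eqI[OF coboundary_in_cochains cochains_closed(1)])
    fix gs :: "pv3 list" assume "length gs = Suc 0"
    then obtain x where "gs = [x]" by (auto simp: length_Suc_conv)
    then show "coboundary PV3 0 f (map Rep_pv3 gs) = 0" by (simp add: coboundary_def)
  qed
  then show ?thesis using cochains_closed(1) by (auto simp: coboundaries_def)
qed

text \<open>The two-chain of a relator is a cycle, since both sides of the relator are the same
  group element.\<close>

lemma inv2_coboundary:
  assumes "f \<in> coboundaries PV3 2" "t \<in> triples"
  shows "inv2 f t = 0"
proof -
  obtain k i j where t: "t = (k, i, j)" by (cases t)
  have rel: "gen (k,i) + gen (k,j) + gen (i,j) = gen (i,j) + gen (k,j) + gen (k,i)"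
    using assms(2) pv3_rel_gen unfolding t triples_iff pv3_rel_def by blast
  obtain c where "f = coboundary PV3 1 c"
    using assms(1) by (auto simp: coboundaries_def numeral_2_eq_2)
  then have "f [Rep_pv3 x, Rep_pv3 y] = c [Rep_pv3 y] - c [Rep_pv3 (x + y)] + c [Rep_pv3 x]" for x y
    by (simp add: coboundary_def mult_PV3)
  then show ?thesis by (simp add: t inv2_def rel_eval_def rel)
qed

lemma inv2_eq_0:
  assumes f: "f \<in> cocycles PV3 2" and 0: "\<And>t. t \<in> triples \<Longrightarrow> inv2 f t = 0"
  shows "f \<in> coboundaries PV3 2"
proof -
  have cocycle: "f [Rep_pv3 y, Rep_pv3 z] - f [Rep_pv3 (x + y), Rep_pv3 z] + f [Rep_pv3 x, Rep_pv3 (y + z)]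
      - f [Rep_pv3 x, Rep_pv3 y] = 0" for x y z
  proof -
    have "coboundary PV3 2 f [Rep_pv3 x, Rep_pv3 y, Rep_pv3 z] = 0" using f by (simp add: cocycles_def)
    moreover have "{1..2::nat} = {1, 2}" by auto
    ultimately show ?thesis by (simp add: coboundary_def mult_PV3)
  qed
  obtain c where c: "\<And>x y. f [Rep_pv3 x, Rep_pv3 y] = c x - c (x + y) + c y"
    by (rule cocycle2_primitive[of "\<lambda>x y. f [Rep_pv3 x, Rep_pv3 y]", OF cocycle])
      (use 0 in \<open>auto simp: inv2_def triples_iff\<close>)
  define h where "h ks = (if length ks = 1 \<and> set ks \<subseteq> carrier PV3 then c (Abs_pv3 (hd ks)) else 0)" for ks
  have h: "h \<in> cochains PV3 1" by (auto simp: cochains_def h_def)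
  have "f = coboundary PV3 1 h"
  proof (rule cochains_eqI)
    show "f \<in> cochains PV3 2" using f by (simp add: cocycles_def)
    show "coboundary PV3 1 h \<in> cochains PV3 2"
      using coboundary_in_cochains[of PV3 1 h] by (simp add: numeral_2_eq_2)
    fix gs :: "pv3 list" assume "length gs = 2"
    then obtain x y where "gs = [x, y]" by (auto simp: length_Suc_conv numeral_2_eq_2)
    then show "f (map Rep_pv3 gs) = coboundary PV3 1 h (map Rep_pv3 gs)"
      by (simp add: coboundary_def mult_PV3 c h_def Rep_pv3_inverse)
  qed
  then show ?thesis using h by (auto simp: coboundaries_def numeral_2_eq_2)
qed

definition same_inv :: "nat \<Rightarrow> (letter list set list \<Rightarrow> int) \<Rightarrow> (letter list set list \<Rightarrow> int) \<Rightarrow> bool" where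
  "same_inv n f g \<longleftrightarrow> (n = 0 \<longrightarrow> f [] = g []) \<and> (n = 1 \<longrightarrow> (\<forall>s\<in>idxs. inv1 f s = inv1 g s))
     \<and> (n = 2 \<longrightarrow> (\<forall>t\<in>triples. inv2 f t = inv2 g t))"

text \<open>Nonzero coboundaries do not occur in degrees 0 and 1, and one-cocycles are
  homomorphisms, determined on generators; in degree two the relators decide; from degree three on
  every cocycle bounds.\<close>

lemma cohom_class_PV3_eq_iff:
  assumes f: "f \<in> cocycles PV3 n" and g: "g \<in> cocycles PV3 n"
  shows "cohom_class PV3 n f = cohom_class PV3 n g \<longleftrightarrow> same_inv n f g"
proof -
  let ?u = "\<lambda>xs. f xs - g xs"
  have u: "?u \<in> cocycles PV3 n" by (rule cocycles_diff[OF f g])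
  then have uc: "?u \<in> cochains PV3 n" by (simp add: cocycles_def)
  consider "n = 0" | "n = 1" | "n = 2" | "n \<ge> 3" by linarith
  then have "?u \<in> coboundaries PV3 n \<longleftrightarrow> same_inv n f g"
  proof cases
    case 1
    have "?u = (\<lambda>_. 0)" if "f [] = g []"
      using uc by (rule cochains_eqI[OF _ cochains_closed(1)]) (simp add: 1 that)
    then show ?thesis using 1 by (auto simp: coboundaries_def same_inv_def fun_eq_iff)
  next
    case 2
    have "?u = (\<lambda>_. 0)" if h: "\<forall>s\<in>idxs. inv1 f s = inv1 g s"
      using uc
    proof (rule cochains_eqI[OF _ cochains_closed(1)])
      fix gs :: "pv3 list" assume "length gs = n"
      then obtain x where gs: "gs = [x]" using 2 by (auto simp: length_Suc_conv)
      have "additive (\<lambda>x. f [Rep_pv3 x])" "additive (\<lambda>x. g [Rep_pv3 x])"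
        using f g cocycles1_iff by (auto simp: 2 cocycles_def)
      from hom_ext_gen[OF this, of x] h show "f (map Rep_pv3 gs) - g (map Rep_pv3 gs) = 0"
        by (simp add: gs inv1_def)
    qed
    then show ?thesis
      unfolding 2 coboundaries1 by (auto simp: same_inv_def fun_eq_iff inv1_def)
  next
    case 3
    then show ?thesis
      using inv2_coboundary[of ?u] inv2_eq_0[of ?u] u by (auto simp: same_inv_def)
  next
    case 4
    then show ?thesis using cocycles_subset_coboundaries[OF 4 u] by (simp add: same_inv_def)
  qed
  then show ?thesis by (simp add: cohom_class_eq_iff[OF f g])
qed

section \<open>Cup products on generators and relators\<close>

lemma inv1_cup:
  "inv1 (cup 0 f g) s = f [] * inv1 g s" "inv1 (cup 1 f g) s = inv1 f s * g []"
  by (simp_all add: inv1_def cup_def)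

definition alt :: "('a \<Rightarrow> int) \<Rightarrow> ('a \<Rightarrow> int) \<Rightarrow> 'a \<Rightarrow> 'a \<Rightarrow> int" where
  "alt a b s t = a s * b t - a t * b s"

text \<open>For two homomorphisms, bilinear expansion of the relator chain leaves the
  antisymmetrised products over the three pairs of letters, in the order in which they occur in the
  word.\<close>

lemma inv2_cup:
  "inv2 (cup 0 f g) t = f [] * inv2 g t" "inv2 (cup 2 f g) t = inv2 f t * g []"
  "f \<in> cocycles PV3 1 \<Longrightarrow> g \<in> cocycles PV3 1 \<Longrightarrow> inv2 (cup 1 f g) (k, i, j)
    = alt (inv1 f) (inv1 g) (k,i) (k,j) + alt (inv1 f) (inv1 g) (k,i) (i,j) + alt (inv1 f) (inv1 g) (k,j) (i,j)"
proof -
  assume "f \<in> cocycles PV3 1" "g \<in> cocycles PV3 1"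
  then have "additive (\<lambda>x. f [Rep_pv3 x])" "additive (\<lambda>x. g [Rep_pv3 x])"
    using cocycles1_iff by (auto simp: cocycles_def)
  then show "inv2 (cup 1 f g) (k, i, j)
    = alt (inv1 f) (inv1 g) (k,i) (k,j) + alt (inv1 f) (inv1 g) (k,i) (i,j) + alt (inv1 f) (inv1 g) (k,j) (i,j)"
    by (simp add: inv2_def rel_eval_def cup_def alt_def inv1_def additive_def algebra_simps)
qed (auto simp: inv2_def rel_eval_def cup_def case_prod_beta algebra_simps)

text \<open>The exponent sum evaluates a word at the indicator function of \<open>s\<close>; the
  integers are commutative, so all relators hold for it.\<close>

lemma lamstar_cocycle: "lamstar s \<in> cocycles PV3 1"
  and inv1_lamstar: "t \<in> idxs \<Longrightarrow> inv1 (lamstar s) t = (if t = s then 1 else 0)"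
proof -
  let ?b = "\<lambda>t. if t = s then 1 else 0 :: int"
  have "expsum s w = ev ?b w" for w
    by (induction w) (auto simp: expsum_def prod_eq_iff)
  then have eq: "lamstar s [Rep_pv3 x] = lift_hom ?b x" for x
    by (simp add: lamstar_def lift_hom_def rep_word_def)
  have rel: "pv3_rel ?b" by (simp add: pv3_rel_def add_ac)
  have "lamstar s \<in> cochains PV3 1" by (auto simp: cochains_def lamstar_def)
  then show "lamstar s \<in> cocycles PV3 1"
    using additive_lift_hom[OF rel] by (subst cocycles1_iff) (simp_all add: eq)
  show "inv1 (lamstar s) t = (if t = s then 1 else 0)" if "t \<in> idxs"
    using lift_hom_gen[OF rel that] by (simp add: inv1_def eq)
qed

section \<open>The exterior algebra\<close>

lemma finite_idxs [simp]: "finite idxs"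
  by (rule finite_subset[of _ "{1,2,3} \<times> {1,2,3}"]) (auto simp: idxs_def)

lemma ext_sign_empty [simp]: "ext_sign {} U = 1" "ext_sign T {} = 1"
  by (simp_all add: ext_sign_def)

lemma finite_inversions:
  "finite T \<Longrightarrow> finite U \<Longrightarrow> finite {(t, u). t \<in> T \<and> u \<in> U \<and> rk u < rk t}"
  by (rule finite_subset[of _ "T \<times> U"]) auto

lemma ext_sign_Un_left:
  assumes "finite T" "finite T'" "finite U" "T \<inter> T' = {}"
  shows "ext_sign (T \<union> T') U = ext_sign T U * ext_sign T' U"
proof -
  have "{(t, u). t \<in> T \<union> T' \<and> u \<in> U \<and> rk u < rk t} =
      {(t, u). t \<in> T \<and> u \<in> U \<and> rk u < rk t} \<union> {(t, u). t \<in> T' \<and> u \<in> U \<and> rk u < rk t}"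
    by auto
  then show ?thesis
    unfolding ext_sign_def power_add[symmetric] using assms
    by (subst card_Un_disjoint[symmetric]) (auto simp: finite_inversions)
qed

lemma ext_sign_Un_right:
  assumes "finite T" "finite U" "finite U'" "U \<inter> U' = {}"
  shows "ext_sign T (U \<union> U') = ext_sign T U * ext_sign T U'"
proof -
  have "{(t, u). t \<in> T \<and> u \<in> U \<union> U' \<and> rk u < rk t} =
      {(t, u). t \<in> T \<and> u \<in> U \<and> rk u < rk t} \<union> {(t, u). t \<in> T \<and> u \<in> U' \<and> rk u < rk t}"
    by auto
  then show ?thesis
    unfolding ext_sign_def power_add[symmetric] using assms
    by (subst card_Un_disjoint[symmetric]) (auto simp: finite_inversions)
qed

definition emul :: "((nat \<times> nat) set \<Rightarrow> int) \<Rightarrow> ((nat \<times> nat) set \<Rightarrow> int) \<Rightarrow> (nat \<times> nat) set \<Rightarrow> int" where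
  "emul a b S = (if S \<subseteq> idxs then (\<Sum>T\<in>Pow S. ext_sign T (S - T) * a T * b (S - T)) else 0)"

definition ext_carrier :: "((nat \<times> nat) set \<Rightarrow> int) set" where
  "ext_carrier = {a. \<forall>S. a S \<noteq> 0 \<longrightarrow> S \<subseteq> idxs}"

lemma ext_alg_simps [simp]:
  "carrier ext_alg = ext_carrier" "a \<otimes>\<^bsub>ext_alg\<^esub> b = emul a b" "a \<oplus>\<^bsub>ext_alg\<^esub> b = (\<lambda>S. a S + b S)"
  "\<one>\<^bsub>ext_alg\<^esub> = (\<lambda>S. if S = {} then 1 else 0)" "\<zero>\<^bsub>ext_alg\<^esub> = (\<lambda>S. 0)"
  by (simp_all add: ext_alg_def ext_carrier_def emul_def[abs_def])

lemma ext_carrierD: "a \<in> ext_carrier \<Longrightarrow> \<not> S \<subseteq> idxs \<Longrightarrow> a S = 0"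
  by (auto simp: ext_carrier_def)

lemma ext_carrierI: "(\<And>S. \<not> S \<subseteq> idxs \<Longrightarrow> a S = 0) \<Longrightarrow> a \<in> ext_carrier"
  by (auto simp: ext_carrier_def)

lemma ext_carrier_closed [simp, intro]:
  "(\<lambda>S. 0) \<in> ext_carrier" "(\<lambda>S. if S = {} then k else 0) \<in> ext_carrier"
  "a \<in> ext_carrier \<Longrightarrow> b \<in> ext_carrier \<Longrightarrow> (\<lambda>S. a S + b S) \<in> ext_carrier"
  "a \<in> ext_carrier \<Longrightarrow> b \<in> ext_carrier \<Longrightarrow> (\<lambda>S. a S - b S) \<in> ext_carrier"
  "a \<in> ext_carrier \<Longrightarrow> (\<lambda>S. k * a S) \<in> ext_carrier" "a \<in> ext_carrier \<Longrightarrow> (\<lambda>S. - a S) \<in> ext_carrier"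
  "emul a b \<in> ext_carrier"
  by (rule ext_carrierI; auto simp: ext_carrierD emul_def)+

lemma emul_distrib:
  "emul (\<lambda>S. a S + b S) c = (\<lambda>S. emul a c S + emul b c S)"
  "emul c (\<lambda>S. a S + b S) = (\<lambda>S. emul c a S + emul c b S)"
  by (auto simp: fun_eq_iff emul_def sum.distrib algebra_simps)

lemma emul_scale:
  "emul (\<lambda>S. k * a S) b = (\<lambda>S. k * emul a b S)"
  "emul a (\<lambda>S. k * b S) = (\<lambda>S. k * emul a b S)"
  by (auto simp: fun_eq_iff emul_def sum_distrib_left algebra_simps)

lemma emul_const:
  assumes "a \<in> ext_carrier"
  shows "emul (\<lambda>S. if S = {} then k else 0) a = (\<lambda>S. k * a S)"
    "emul a (\<lambda>S. if S = {} then k else 0) = (\<lambda>S. k * a S)"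
proof -
  show "emul (\<lambda>S. if S = {} then k else 0) a = (\<lambda>S. k * a S)"
  proof
    fix S
    show "emul (\<lambda>S. if S = {} then k else 0) a S = k * a S"
    proof (cases "S \<subseteq> idxs")
      case True
      then have "finite S" by (rule finite_subset) simp
      have "(\<Sum>T\<in>Pow S. ext_sign T (S - T) * (if T = {} then k else 0) * a (S - T))
          = (\<Sum>T\<in>{{}}. ext_sign T (S - T) * (if T = {} then k else 0) * a (S - T))"
        using \<open>finite S\<close> by (intro sum.mono_neutral_right) auto
      then show ?thesis using True by (simp add: emul_def)
    qed (simp add: emul_def ext_carrierD[OF assms])
  qed
  show "emul a (\<lambda>S. if S = {} then k else 0) = (\<lambda>S. k * a S)"
  proof
    fix S
    show "emul a (\<lambda>S. if S = {} then k else 0) S = k * a S"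
    proof (cases "S \<subseteq> idxs")
      case True
      then have "finite S" by (rule finite_subset) simp
      have "(\<Sum>T\<in>Pow S. ext_sign T (S - T) * a T * (if S - T = {} then k else 0))
          = (\<Sum>T\<in>{S}. ext_sign T (S - T) * a T * (if S - T = {} then k else 0))"
        using \<open>finite S\<close> by (intro sum.mono_neutral_right) auto
      then show ?thesis using True by (simp add: emul_def)
    qed (simp add: emul_def ext_carrierD[OF assms])
  qed
qed

text \<open>Both sides sum over ordered partitions of \<open>S\<close> into three parts. The signs
  agree because \<open>ext_sign\<close> is multiplicative over disjoint unions in either
  argument.\<close>

lemma emul_assoc: "emul (emul a b) c = emul a (emul b c)"
proof
  fix S
  show "emul (emul a b) c S = emul a (emul b c) S"
  proof (cases "S \<subseteq> idxs")
    case True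
    then have fin: "finite S" by (rule finite_subset) simp
    have fin': "finite T" if "T \<subseteq> S" for T using that fin by (rule finite_subset)
    have "emul (emul a b) c S = (\<Sum>T\<in>Pow S. \<Sum>U\<in>Pow T.
        ext_sign T (S - T) * ext_sign U (T - U) * a U * b (T - U) * c (S - T))"
    proof -
      have "emul (emul a b) c S = (\<Sum>T\<in>Pow S. ext_sign T (S - T) * emul a b T * c (S - T))"
        using True by (simp add: emul_def[of "emul a b"])
      also have "\<dots> = (\<Sum>T\<in>Pow S. \<Sum>U\<in>Pow T.
          ext_sign T (S - T) * ext_sign U (T - U) * a U * b (T - U) * c (S - T))"
      proof (rule sum.cong[OF HOL.refl])
        fix T assume "T \<in> Pow S"
        with True have "T \<subseteq> idxs" by blast
        then show "ext_sign T (S - T) * emul a b T * c (S - T)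
            = (\<Sum>U\<in>Pow T. ext_sign T (S - T) * ext_sign U (T - U) * a U * b (T - U) * c (S - T))"
          by (simp add: emul_def sum_distrib_left sum_distrib_right mult.assoc)
      qed
      finally show ?thesis .
    qed
    also have "\<dots> = (\<Sum>(T, U)\<in>Sigma (Pow S) Pow.
        ext_sign T (S - T) * ext_sign U (T - U) * a U * b (T - U) * c (S - T))"
      by (rule sum.Sigma) (auto intro: fin fin')
    also have "\<dots> = (\<Sum>(U, V)\<in>Sigma (Pow S) (\<lambda>U. Pow (S - U)).
        ext_sign U (S - U) * ext_sign V (S - U - V) * a U * b V * c (S - U - V))"
    \<comment> \<open>The pair \<open>(U, V)\<close> of first and second part corresponds to
      \<open>(U \<union> V, U)\<close>. The fifth goal is the equality of summands.\<close>
    proof (rule sum.reindex_bij_witness[of _ "\<lambda>(U, V). (U \<union> V, U)" "\<lambda>(T, U). (U, T - U)"], goal_cases)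
      case (5 TU)
      then obtain T U where TU: "TU = (T, U)" "U \<subseteq> T" "T \<subseteq> S" by auto
      define V W where "V = T - U" and "W = S - T"
      have eqs: "T = U \<union> V" "S - U = V \<union> W" "S - U - V = W" "T - U = V" "S - T = W"
        and disj: "U \<inter> V = {}" "V \<inter> W = {}" "U \<inter> W = {}"
        using TU by (auto simp: V_def W_def)
      have vw: "V \<union> W - V = W" by (auto simp: V_def W_def)
      have f: "finite U" "finite V" "finite W"
        using TU fin by (auto simp: V_def W_def intro: finite_subset)
      have "ext_sign U (V \<union> W) * ext_sign V W = ext_sign (U \<union> V) W * ext_sign U V"
        using f disj by (simp add: ext_sign_Un_left ext_sign_Un_right)
      then have "ext_sign U (S - U) * ext_sign V (S - U - V) * a U * b V * c (S - U - V)
          = ext_sign T (S - T) * ext_sign U (T - U) * a U * b (T - U) * c (S - T)"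
        unfolding eqs(2) eqs(4) eqs(5) vw eqs(1)[symmetric] by (simp only:)
      then show ?case by (simp add: TU(1) V_def)
    qed auto
    also have "\<dots> = (\<Sum>U\<in>Pow S. \<Sum>V\<in>Pow (S - U).
        ext_sign U (S - U) * ext_sign V (S - U - V) * a U * b V * c (S - U - V))"
      by (rule sum.Sigma[symmetric]) (auto intro: fin fin')
    also have "\<dots> = emul a (emul b c) S"
    proof -
      have "emul a (emul b c) S = (\<Sum>U\<in>Pow S. ext_sign U (S - U) * a U * emul b c (S - U))"
        using True by (simp add: emul_def[of a])
      also have "\<dots> = (\<Sum>U\<in>Pow S. \<Sum>V\<in>Pow (S - U).
          ext_sign U (S - U) * ext_sign V (S - U - V) * a U * b V * c (S - U - V))"
      proof (rule sum.cong[OF HOL.refl])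
        fix U
        have "S - U \<subseteq> idxs" using True by blast
        then show "ext_sign U (S - U) * a U * emul b c (S - U)
            = (\<Sum>V\<in>Pow (S - U). ext_sign U (S - U) * ext_sign V (S - U - V) * a U * b V * c (S - U - V))"
          by (simp add: emul_def sum_distrib_left mult_ac)
      qed
      finally show ?thesis ..
    qed
    finally show ?thesis .
  qed (simp add: emul_def)
qed

lemma ring_ext_alg: "ring ext_alg"
proof (rule ringI)
  show "abelian_group ext_alg"
  proof (rule abelian_groupI)
    fix a assume "a \<in> carrier ext_alg"
    then show "\<exists>b\<in>carrier ext_alg. b \<oplus>\<^bsub>ext_alg\<^esub> a = \<zero>\<^bsub>ext_alg\<^esub>"
      by (intro bexI[of _ "\<lambda>S. - a S"]) auto
  qed auto
  show "monoid ext_alg"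
    by (rule monoidI) (auto simp: emul_assoc emul_const)
qed (simp_all add: emul_distrib)

interpretation ext: ring ext_alg
  by (rule ring_ext_alg)

lemma ext_minus:
  assumes "a \<in> ext_carrier" "b \<in> ext_carrier"
  shows "a \<ominus>\<^bsub>ext_alg\<^esub> b = (\<lambda>S. a S - b S)"
proof -
  have "\<ominus>\<^bsub>ext_alg\<^esub> b = (\<lambda>S. - b S)"
    using assms by (intro ext.minus_equality) auto
  then show ?thesis by (simp add: a_minus_def)
qed

definition emon :: "(nat \<times> nat) set \<Rightarrow> (nat \<times> nat) set \<Rightarrow> int" where
  "emon S Z = (if Z = S then 1 else 0)"

lemma emon_carrier [simp]: "S \<subseteq> idxs \<Longrightarrow> emon S \<in> ext_carrier"
  by (rule ext_carrierI) (auto simp: emon_def)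

lemma egen_emon: "egen i j = emon {(i, j)}"
  by (auto simp: egen_def emon_def fun_eq_iff)

lemma emul_emon:
  assumes "S \<subseteq> idxs" "T \<subseteq> idxs"
  shows "emul (emon S) (emon T) = (if S \<inter> T = {} then (\<lambda>Z. ext_sign S T * emon (S \<union> T) Z) else (\<lambda>Z. 0))"
proof
  fix Z
  show "emul (emon S) (emon T) Z = (if S \<inter> T = {} then (\<lambda>Z. ext_sign S T * emon (S \<union> T) Z) else (\<lambda>Z. 0)) Z"
  proof (cases "Z \<subseteq> idxs")
    case True
    then have fin: "finite Z" by (rule finite_subset) simp
    have "emul (emon S) (emon T) Z = (\<Sum>U\<in>Pow Z. if U = S then ext_sign S (Z - S) * emon T (Z - S) else 0)"
      using True by (auto simp: emul_def emon_def intro!: sum.cong)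
    also have "\<dots> = (if S \<subseteq> Z then ext_sign S (Z - S) * emon T (Z - S) else 0)"
      using fin by simp
    also have "\<dots> = (if S \<inter> T = {} then (\<lambda>Z. ext_sign S T * emon (S \<union> T) Z) else (\<lambda>Z. 0)) Z"
      by (auto simp: emon_def)
    finally show ?thesis .
  next
    case False
    then show ?thesis using assms by (auto simp: emul_def emon_def)
  qed
qed

subsection \<open>The quotient by the quadratic relations\<close>

lemma egen_carrier [simp]: "(i, j) \<in> idxs \<Longrightarrow> egen i j \<in> ext_carrier"
  by (simp add: egen_emon)

lemma idxs_iff:
  "s \<in> idxs \<longleftrightarrow> s = (1,2) \<or> s = (2,1) \<or> s = (2,3) \<or> s = (3,2) \<or> s = (1,3) \<or> s = (3,1)"
  by (cases s) (auto simp: idxs_def)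

lemma idxs_mem [simp]:
  "(Suc 0,2) \<in> idxs" "(2,Suc 0) \<in> idxs" "(2,3) \<in> idxs" "(3,2) \<in> idxs" "(Suc 0,3) \<in> idxs" "(3,Suc 0) \<in> idxs"
  by (auto simp: idxs_iff)

lemma pv3_relations_carrier: "pv3_relations \<subseteq> ext_carrier"
proof -
  have "(i, j) \<in> idxs \<Longrightarrow> egen i j \<ominus>\<^bsub>ext_alg\<^esub> egen k l \<in> ext_carrier"
    if "(k, l) \<in> idxs" for i j k l
    using that by (simp add: ext_minus)
  then show ?thesis
    unfolding pv3_relations_def
    by (auto simp: ext_minus)
qed

lemma ideal_pv3_ideal: "ideal pv3_ideal ext_alg"
  unfolding pv3_ideal_def using pv3_relations_carrier by (intro ext.genideal_ideal) simp

lemmas rcos_pv3_ideal = ideal.rcos_ring_hom[OF ideal_pv3_ideal]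

lemma pv3_ideal_closed:
  "(\<lambda>S. 0) \<in> pv3_ideal"
  "a \<in> pv3_ideal \<Longrightarrow> b \<in> pv3_ideal \<Longrightarrow> (\<lambda>S. a S + b S) \<in> pv3_ideal"
  "a \<in> pv3_ideal \<Longrightarrow> b \<in> ext_carrier \<Longrightarrow> emul a b \<in> pv3_ideal"
  "a \<in> pv3_ideal \<Longrightarrow> a \<in> ext_carrier"
  "a \<in> pv3_ideal \<Longrightarrow> (\<lambda>S. k * a S) \<in> pv3_ideal"
proof -
  note sub = ideal.axioms(1)[OF ideal_pv3_ideal]
  show "(\<lambda>S. 0) \<in> pv3_ideal" using additive_subgroup.zero_closed[OF sub] by simp
  show "(\<lambda>S. a S + b S) \<in> pv3_ideal" if "a \<in> pv3_ideal" "b \<in> pv3_ideal"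
    using additive_subgroup.a_closed[OF sub that] by simp
  show "emul a b \<in> pv3_ideal" if "a \<in> pv3_ideal" "b \<in> ext_carrier"
    using ideal.I_r_closed[OF ideal_pv3_ideal, of a b] that by simp
  show carr: "a \<in> ext_carrier" if "a \<in> pv3_ideal"
    using ideal.Icarr[OF ideal_pv3_ideal that] by simp
  show "(\<lambda>S. k * a S) \<in> pv3_ideal" if "a \<in> pv3_ideal"
    using ideal.I_l_closed[OF ideal_pv3_ideal that, of "\<lambda>S. if S = {} then k else 0"]
    by (simp add: emul_const carr[OF that])
qed

lemma pv3_ideal_sum:
  "finite A \<Longrightarrow> (\<And>i. i \<in> A \<Longrightarrow> F i \<in> pv3_ideal) \<Longrightarrow> (\<lambda>S. \<Sum>i\<in>A. F i S) \<in> pv3_ideal"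
  by (induction A rule: finite_induct) (simp_all add: pv3_ideal_closed)

interpretation Q: ring "ext_alg Quot pv3_ideal"
  by (rule ideal.quotient_is_ring[OF ideal_pv3_ideal])

lemma pv3_relations_ideal: "r \<in> pv3_relations \<Longrightarrow> r \<in> pv3_ideal"
  unfolding pv3_ideal_def using ext.genideal_self[of pv3_relations] pv3_relations_carrier by auto

text \<open>A type for the quotient makes the simplifier's arithmetic for type classes available.\<close>

typedef qalg = "carrier (ext_alg Quot pv3_ideal)"
  using Q.zero_closed by blast

instantiation qalg :: ring
begin

definition zero_qalg :: qalg where "0 = Abs_qalg \<zero>\<^bsub>ext_alg Quot pv3_ideal\<^esub>"
definition plus_qalg :: "qalg \<Rightarrow> qalg \<Rightarrow> qalg" where
  "plus_qalg x y = Abs_qalg (Rep_qalg x \<oplus>\<^bsub>ext_alg Quot pv3_ideal\<^esub> Rep_qalg y)"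
definition times_qalg :: "qalg \<Rightarrow> qalg \<Rightarrow> qalg" where
  "times_qalg x y = Abs_qalg (Rep_qalg x \<otimes>\<^bsub>ext_alg Quot pv3_ideal\<^esub> Rep_qalg y)"
definition uminus_qalg :: "qalg \<Rightarrow> qalg" where
  "uminus_qalg x = Abs_qalg (\<ominus>\<^bsub>ext_alg Quot pv3_ideal\<^esub> Rep_qalg x)"
definition minus_qalg :: "qalg \<Rightarrow> qalg \<Rightarrow> qalg" where
  "minus_qalg x y = x + - y"

instance
proof
  fix x y z :: qalg
  note defs = zero_qalg_def plus_qalg_def times_qalg_def uminus_qalg_def Abs_qalg_inverse Rep_qalg
    Rep_qalg_inverse
  show "x * y * z = x * (y * z)" by (simp add: defs Q.m_assoc)
  show "x + y + z = x + (y + z)" by (simp add: defs Q.a_assoc)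
  show "x + y = y + x" by (simp add: defs Q.a_comm)
  show "0 + x = x" by (simp add: defs)
  show "- x + x = 0" by (simp add: defs Q.l_neg)
  show "x - y = x + - y" by (simp add: minus_qalg_def)
  show "(x + y) * z = x * z + y * z" by (simp add: defs Q.l_distr)
  show "x * (y + z) = x * y + x * z" by (simp add: defs Q.r_distr)
qed

end

definition qcls :: "((nat \<times> nat) set \<Rightarrow> int) \<Rightarrow> qalg" where
  "qcls a = Abs_qalg (pv3_ideal +>\<^bsub>ext_alg\<^esub> a)"

lemma qcls_closed: "a \<in> ext_carrier \<Longrightarrow> pv3_ideal +>\<^bsub>ext_alg\<^esub> a \<in> carrier (ext_alg Quot pv3_ideal)"
  using ring_hom_closed[OF rcos_pv3_ideal] by simp

lemma Rep_qcls: "a \<in> ext_carrier \<Longrightarrow> Rep_qalg (qcls a) = pv3_ideal +>\<^bsub>ext_alg\<^esub> a"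
  by (simp add: qcls_def Abs_qalg_inverse qcls_closed)

lemma qcls_add: "a \<in> ext_carrier \<Longrightarrow> b \<in> ext_carrier \<Longrightarrow> qcls (\<lambda>S. a S + b S) = qcls a + qcls b"
  using ring_hom_add[OF rcos_pv3_ideal, of a b]
  by (simp add: plus_qalg_def Rep_qcls) (simp add: qcls_def)

lemma qcls_mult: "a \<in> ext_carrier \<Longrightarrow> b \<in> ext_carrier \<Longrightarrow> qcls (emul a b) = qcls a * qcls b"
  using ring_hom_mult[OF rcos_pv3_ideal, of a b]
  by (simp add: times_qalg_def Rep_qcls) (simp add: qcls_def)

lemma qcls_eq_0_iff: "a \<in> ext_carrier \<Longrightarrow> qcls a = 0 \<longleftrightarrow> a \<in> pv3_ideal"
proof -
  assume a: "a \<in> ext_carrier"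
  have "qcls a = 0 \<longleftrightarrow> Rep_qalg (qcls a) = Rep_qalg 0" by (simp add: Rep_qalg_inject)
  also have "\<dots> \<longleftrightarrow> pv3_ideal +>\<^bsub>ext_alg\<^esub> a = pv3_ideal"
    by (simp add: Rep_qcls a zero_qalg_def Abs_qalg_inverse) (simp add: FactRing_def)
  also have "\<dots> \<longleftrightarrow> a \<in> pv3_ideal"
    using a ideal.rcos_const_imp_mem[OF ideal_pv3_ideal, of a]
      abelian_subgroup.a_rcos_const[OF abelian_subgroupI3[OF ideal.axioms(1)[OF ideal_pv3_ideal]
        ext.is_abelian_group], of a] by auto
  finally show ?thesis .
qed

lemma qcls_simps:
  "qcls (\<lambda>S. 0) = 0"
  "a \<in> ext_carrier \<Longrightarrow> qcls (\<lambda>S. - a S) = - qcls a"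
  "a \<in> ext_carrier \<Longrightarrow> b \<in> ext_carrier \<Longrightarrow> qcls (\<lambda>S. a S - b S) = qcls a - qcls b"
proof -
  show 0: "qcls (\<lambda>S. 0) = 0"
    using pv3_ideal_closed(1) by (simp add: qcls_eq_0_iff)
  have neg: "qcls (\<lambda>S. - a S) = - qcls a" if "a \<in> ext_carrier" for a
    using qcls_add[of "\<lambda>S. - a S" a] that by (simp add: 0 eq_neg_iff_add_eq_0)
  then show "qcls (\<lambda>S. - a S) = - qcls a" if "a \<in> ext_carrier"
    using that by blast
  show "qcls (\<lambda>S. a S - b S) = qcls a - qcls b" if "a \<in> ext_carrier" "b \<in> ext_carrier"
    using qcls_add[of a "\<lambda>S. - b S"] that by (simp add: neg)
qed

definition xq :: "nat \<times> nat \<Rightarrow> qalg" where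
  "xq s = qcls (emon {s})"

lemma xq_egen: "xq (i, j) = qcls (egen i j)"
  by (simp add: xq_def egen_emon)

lemma rk_inj: "s \<in> idxs \<Longrightarrow> t \<in> idxs \<Longrightarrow> rk s = rk t \<longleftrightarrow> s = t"
  unfolding idxs_iff by (elim disjE) (simp_all add: rk_def)

lemma ext_sign_single: "ext_sign {s} {t} = (if rk t < rk s then -1 else 1)"
proof -
  have "{(t', u). t' \<in> {s} \<and> u \<in> {t} \<and> rk u < rk t'} = (if rk t < rk s then {(s, t)} else {})"
    by auto
  then show ?thesis by (simp add: ext_sign_def)
qed

lemma ext_sign_swap: "s \<in> idxs \<Longrightarrow> t \<in> idxs \<Longrightarrow> s \<noteq> t \<Longrightarrow> ext_sign {t} {s} = - ext_sign {s} {t}"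
  using rk_inj[of s t] by (auto simp: ext_sign_single)

lemma ext_sign_square: "ext_sign S T * ext_sign S T = 1"
  by (simp add: ext_sign_def power_add[symmetric] mult_2[symmetric])

lemma xq_square: "s \<in> idxs \<Longrightarrow> xq s * xq s = 0"
  unfolding xq_def by (simp add: qcls_mult[symmetric] emul_emon qcls_simps)

lemma xq_anticomm: "s \<in> idxs \<Longrightarrow> t \<in> idxs \<Longrightarrow> xq t * xq s = - (xq s * xq t)"
proof (cases "s = t")
  case False
  assume st: "s \<in> idxs" "t \<in> idxs"
  then have "emul (emon {t}) (emon {s}) = (\<lambda>Z. - emul (emon {s}) (emon {t}) Z)"
    using False ext_sign_swap[OF st False] by (simp add: emul_emon insert_commute)
  then show ?thesis
    unfolding xq_def using st by (simp add: qcls_mult[symmetric] qcls_simps)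
qed (simp add: xq_square)

lemma xq_relations:
  "xq (1,2) * xq (2,1) = 0" "xq (1,3) * xq (3,1) = 0" "xq (2,3) * xq (3,2) = 0"
  "s \<in> idxs \<Longrightarrow> (xq (1,3) - xq (3,1)) * xq s = (xq (1,2) - xq (2,1)) * xq s + (xq (2,3) - xq (3,2)) * xq s"
  "xq (2,1) * xq (3,1) = xq (2,1) * xq (3,2) + xq (2,3) * xq (3,1)"
proof -
  have opp: "xq (i,j) * xq (j,i) = 0" if "1 \<le> i" "i < j" "j \<le> 3" for i j
  proof -
    have "emul (egen i j) (egen j i) \<in> pv3_ideal"
      using that by (intro pv3_relations_ideal) (auto simp: pv3_relations_def)
    moreover have "(i, j) \<in> idxs" "(j, i) \<in> idxs" using that by (auto simp: idxs_def)
    ultimately show ?thesis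
      by (simp add: xq_egen qcls_mult[symmetric] qcls_eq_0_iff)
  qed
  show "xq (1,2) * xq (2,1) = 0" "xq (1,3) * xq (3,1) = 0" "xq (2,3) * xq (3,2) = 0"
    by (rule opp; simp)+
  show "(xq (1,3) - xq (3,1)) * xq s = (xq (1,2) - xq (2,1)) * xq s + (xq (2,3) - xq (3,2)) * xq s"
    if "s \<in> idxs"
  proof -
    obtain i j where s: "s = (i, j)" by (cases s)
    have ij: "(i, j) \<in> idxs" using that s by simp
    let ?r = "((egen 1 3 \<ominus>\<^bsub>ext_alg\<^esub> egen 3 1) \<otimes>\<^bsub>ext_alg\<^esub> egen i j)
        \<ominus>\<^bsub>ext_alg\<^esub> (((egen 1 2 \<ominus>\<^bsub>ext_alg\<^esub> egen 2 1) \<otimes>\<^bsub>ext_alg\<^esub> egen i j)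
                   \<oplus>\<^bsub>ext_alg\<^esub> ((egen 2 3 \<ominus>\<^bsub>ext_alg\<^esub> egen 3 2) \<otimes>\<^bsub>ext_alg\<^esub> egen i j))"
    have "?r \<in> pv3_relations" unfolding pv3_relations_def using ij by blast
    then have "?r \<in> pv3_ideal" by (rule pv3_relations_ideal)
    moreover have "?r \<in> ext_carrier" using ij by (simp add: ext_minus)
    ultimately have "qcls ?r = 0" by (simp only: qcls_eq_0_iff)
    then show ?thesis
      using ij by (simp add: ext_minus qcls_simps qcls_add qcls_mult xq_egen s)
  qed
  let ?r = "(egen 2 1 \<otimes>\<^bsub>ext_alg\<^esub> egen 3 1)
        \<ominus>\<^bsub>ext_alg\<^esub> ((egen 2 1 \<otimes>\<^bsub>ext_alg\<^esub> egen 3 2) \<oplus>\<^bsub>ext_alg\<^esub> (egen 2 3 \<otimes>\<^bsub>ext_alg\<^esub> egen 3 1))"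
  have "?r \<in> pv3_relations" unfolding pv3_relations_def by blast
  then have "?r \<in> pv3_ideal" by (rule pv3_relations_ideal)
  moreover have "?r \<in> ext_carrier" by (simp add: ext_minus)
  ultimately have "qcls ?r = 0" by (simp only: qcls_eq_0_iff)
  then show "xq (2,1) * xq (3,1) = xq (2,1) * xq (3,2) + xq (2,3) * xq (3,1)"
    by (simp add: ext_minus qcls_simps qcls_add qcls_mult xq_egen)
qed

section \<open>Products of two and three generators, for six abstract letters\<close>

context
  fixes a a' b b' c c' :: "'r::ring"
  assumes squares: "a * a = 0" "a' * a' = 0" "b * b = 0" "b' * b' = 0" "c * c = 0" "c' * c' = 0"
    and anti: "a' * a = - (a * a')" "b * a = - (a * b)" "b' * a = - (a * b')" "c * a = - (a * c)"
      "c' * a = - (a * c')" "b * a' = - (a' * b)" "b' * a' = - (a' * b')" "c * a' = - (a' * c)"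
      "c' * a' = - (a' * c')" "b' * b = - (b * b')" "c * b = - (b * c)" "c' * b = - (b * c')"
      "c * b' = - (b' * c)" "c' * b' = - (b' * c')" "c' * c = - (c * c')"
    and opp: "a * a' = 0" "b * b' = 0" "c * c' = 0"
    and rel2: "\<forall>z\<in>{a, a', b, b', c, c'}. (c - c') * z = (a - a') * z + (b - b') * z"
    and rel3: "a' * c' = a' * b' + b * c'"
begin

text \<open>The letters \<open>a, a', b, b', c, c'\<close> stand for the pairs 12, 21, 23, 32, 13,
  31. Of the fifteen products three vanish by \<open>opp\<close>, and
  \<open>a * b, a * c', a' * b', a' * c, b * c', b' * c\<close> are the chains up to sign.
  \<open>rel3\<close> rewrites \<open>a' * c'\<close>; multiplying \<open>rel2\<close> by
  \<open>c', b', a, c, b\<close> in turn, each time using the preceding result, gives the other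
  five.\<close>

lemma quadratic_normal_forms:
  "b' * c' = a * c' - a' * b'" "a * b' = a * c' - b' * c" "a * c = a * b + b' * c"
  "b * c = a' * c - a * b" "a' * b = a' * c - b * c'"
proof -
  note s = squares anti opp algebra_simps
  have 1: "b' * c' - (a * c' - a' * b') =
      ((c - c') * c' - ((a - a') * c' + (b - b') * c')) - (a' * c' - (a' * b' + b * c'))"
    by (simp add: s)
  then show bc: "b' * c' = a * c' - a' * b'" using bspec[OF rel2, of c'] rel3 by simp
  have "a * b' - (a * c' - b' * c) =
      - ((c - c') * b' - ((a - a') * b' + (b - b') * b')) + (b' * c' - (a * c' - a' * b'))"
    by (simp add: s)
  then show ab: "a * b' = a * c' - b' * c" using bspec[OF rel2, of b'] bc by simp
  have "a * c - (a * b + b' * c) =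
      - ((c - c') * a - ((a - a') * a + (b - b') * a)) - (a * b' - (a * c' - b' * c))"
    by (simp add: s)
  then show ac: "a * c = a * b + b' * c" using bspec[OF rel2, of a] ab by simp
  have "b * c - (a' * c - a * b) =
      - ((c - c') * c - ((a - a') * c + (b - b') * c)) - (a * c - (a * b + b' * c))"
    by (simp add: s)
  then show bc2: "b * c = a' * c - a * b" using bspec[OF rel2, of c] ac by simp
  have "a' * b - (a' * c - b * c') =
      ((c - c') * b - ((a - a') * b + (b - b') * b)) + (b * c - (a' * c - a * b))"
    by (simp add: s)
  then show "a' * b = a' * c - b * c'" using bspec[OF rel2, of b] bc2 by simp
qed

text \<open>Only monomials with one letter from each opposite pair can survive, which leaves eight.
  Multiply a normal form by a letter so that every monomial but one contains a square or an opposite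
  pair.\<close>

lemma cubic_zero:
  "a * (b * c) = 0" "a * (b' * c) = 0" "a' * (b * c) = 0" "a' * (b * c') = 0" "a * (b' * c') = 0"
  "a' * (b' * c') = 0" "a * (b * c') = 0" "a' * (b' * c) = 0"
proof -
  have anti': "y * (x * z) = - (x * (y * z))" if "y * x = - (x * y)" for x y z :: 'r
    using that by (metis mult.assoc mult_minus_left)
  have zero': "x * (y * z) = 0" if "x * y = 0" for x y z :: 'r
    using that by (metis mult.assoc mult_zero_left)
  note s = squares opp anti[THEN anti'] squares[THEN zero'] opp[THEN zero'] anti mult.assoc
    distrib_left distrib_right left_diff_distrib right_diff_distrib
  have "(a * c) * b = (a * b + b' * c) * b" "(a * c) * b' = (a * b + b' * c) * b'"
    by (simp_all only: quadratic_normal_forms)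
  then show "a * (b * c) = 0" "a * (b' * c) = 0" by (simp_all add: s)
  have "(a' * b) * c = (a' * c - b * c') * c" "(a' * b) * c' = (a' * c - b * c') * c'"
    by (simp_all only: quadratic_normal_forms)
  then show "a' * (b * c) = 0" "a' * (b * c') = 0" by (simp_all add: s)
  have "a * (b' * c') = a * (a * c' - a' * b')" "a' * (b' * c') = a' * (a * c' - a' * b')"
    by (simp_all only: quadratic_normal_forms)
  then show "a * (b' * c') = 0" "a' * (b' * c') = 0" by (simp_all add: s)
  have "(b * c) * c' = (a' * c - a * b) * c'" by (simp only: quadratic_normal_forms)
  then show "a * (b * c') = 0" by (simp add: s)
  have "a' * (a * b') = a' * (a * c' - b' * c)" by (simp only: quadratic_normal_forms)
  then show "a' * (b' * c) = 0" by (simp add: s)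
qed

end

lemmas xq_anti =
  xq_anticomm[OF idxs_mem(1) idxs_mem(2)] xq_anticomm[OF idxs_mem(1) idxs_mem(3)] xq_anticomm[OF idxs_mem(1) idxs_mem(4)] xq_anticomm[OF idxs_mem(1) idxs_mem(5)] xq_anticomm[OF idxs_mem(1) idxs_mem(6)]
  xq_anticomm[OF idxs_mem(2) idxs_mem(3)] xq_anticomm[OF idxs_mem(2) idxs_mem(4)] xq_anticomm[OF idxs_mem(2) idxs_mem(5)] xq_anticomm[OF idxs_mem(2) idxs_mem(6)]
  xq_anticomm[OF idxs_mem(3) idxs_mem(4)] xq_anticomm[OF idxs_mem(3) idxs_mem(5)] xq_anticomm[OF idxs_mem(3) idxs_mem(6)]
  xq_anticomm[OF idxs_mem(4) idxs_mem(5)] xq_anticomm[OF idxs_mem(4) idxs_mem(6)]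
  xq_anticomm[OF idxs_mem(5) idxs_mem(6)]

lemma xq_rel2:
  "\<forall>z\<in>{xq (1,2), xq (2,1), xq (2,3), xq (3,2), xq (1,3), xq (3,1)}.
    (xq (1,3) - xq (3,1)) * z = (xq (1,2) - xq (2,1)) * z + (xq (2,3) - xq (3,2)) * z"
  using xq_relations(4)[OF idxs_mem(1)] xq_relations(4)[OF idxs_mem(2)] xq_relations(4)[OF idxs_mem(3)] xq_relations(4)[OF idxs_mem(4)] xq_relations(4)[OF idxs_mem(5)] xq_relations(4)[OF idxs_mem(6)]
  by (intro ballI, elim insertE emptyE) (simp_all only: One_nat_def)

lemmas xq_squares = xq_square[OF idxs_mem(1)] xq_square[OF idxs_mem(2)] xq_square[OF idxs_mem(3)] xq_square[OF idxs_mem(4)] xq_square[OF idxs_mem(5)] xq_square[OF idxs_mem(6)]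

lemmas xq_facts = xq_squares xq_anti
  xq_relations(1,3,2)[unfolded One_nat_def] xq_rel2[unfolded One_nat_def] xq_relations(5)[unfolded One_nat_def]

lemmas xq_normal_forms = quadratic_normal_forms[OF xq_facts] xq_relations(5)[unfolded One_nat_def]

lemmas xq_cubic_zero = cubic_zero[OF xq_facts]

lemma xq_triple:
  assumes "s \<in> idxs" "t \<in> idxs" "u \<in> idxs"
  shows "xq s * xq t * xq u = 0"
proof -
  have anti': "y * (x * z) = - (x * (y * z))" if "y * x = - (x * y)" for x y z :: qalg
    using that by (metis mult.assoc mult_minus_left)
  have zero': "x * (y * z) = 0" if "x * y = 0" for x y z :: qalg
    using that by (metis mult.assoc mult_zero_left)
  note s = xq_facts(1-24) xq_facts(1-6)[THEN zero'] xq_facts(7-21)[THEN anti'] xq_facts(22-24)[THEN zero']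
    xq_cubic_zero mult.assoc mult_minus_right mult_minus_left mult_zero_right mult_zero_left
    minus_minus minus_zero One_nat_def
  show ?thesis
    using assms unfolding idxs_iff by (elim disjE; simp only: s)
qed

subsection \<open>Generators of the ideal\<close>

text \<open>\<open>pr a s t\<close> is the coefficient of \<open>s t\<close> in \<open>a\<close>, alternating in \<open>s\<close> and \<open>t\<close>; \<open>wt\<close> is the value of the
  resulting two-cocycle on a relator.\<close>

definition pr :: "((nat \<times> nat) set \<Rightarrow> int) \<Rightarrow> nat \<times> nat \<Rightarrow> nat \<times> nat \<Rightarrow> int" where
  "pr a s t = ext_sign {s} {t} * a {s, t}"

definition wt :: "nat \<times> nat \<times> nat \<Rightarrow> ((nat \<times> nat) set \<Rightarrow> int) \<Rightarrow> int" where
  "wt = (\<lambda>(k, i, j) a. pr a (k,i) (k,j) + pr a (k,i) (i,j) + pr a (k,j) (i,j))"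

lemma triples_idxs:
  assumes "(k, i, j) \<in> triples"
  shows "(k, i) \<in> idxs" "(k, j) \<in> idxs" "(i, j) \<in> idxs"
    "(k, i) \<noteq> (k, j)" "(k, i) \<noteq> (i, j)" "(k, j) \<noteq> (i, j)"
  using assms unfolding triples_def by (auto simp: idxs_def)

lemma finite_triples [simp]: "finite triples"
  by (simp add: triples_def)

lemma wt_linear:
  "wt \<tau> (\<lambda>S. a S + b S) = wt \<tau> a + wt \<tau> b" "wt \<tau> (\<lambda>S. k * a S) = k * wt \<tau> a"
  by (simp_all add: wt_def pr_def case_prod_beta algebra_simps)

lemma emul_empty: "emul a b {} = a {} * b {}"
  by (simp add: emul_def)

lemma emul_single: "s \<in> idxs \<Longrightarrow> emul a b {s} = a {} * b {s} + a {s} * b {}"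
proof -
  assume s: "s \<in> idxs"
  have "Pow {s} = {{}, {s}}" by auto
  then show ?thesis using s by (simp add: emul_def)
qed

lemma pr_emul:
  assumes "u \<in> idxs" "v \<in> idxs" "u \<noteq> v"
  shows "pr (emul a b) u v = a {} * pr b u v + alt (\<lambda>s. a {s}) (\<lambda>s. b {s}) u v + pr a u v * b {}"
proof -
  have P: "Pow {u, v} = {{}, {u}, {v}, {u, v}}" by auto
  have d: "{u, v} - {u} = {v}" "{u, v} - {v} = {u}" using assms by auto
  have n: "{} \<noteq> {u}" "{u} \<noteq> {v}" "{} \<noteq> {v}" "{u} \<noteq> {u, v}" "{v} \<noteq> {u, v}" "{} \<noteq> {u, v}" using assms by auto
  have "emul a b {u, v} = a {} * b {u, v} + ext_sign {u} {v} * a {u} * b {v}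
      + ext_sign {v} {u} * a {v} * b {u} + a {u, v} * b {}"
    unfolding emul_def P using assms n by (simp add: d)
  moreover have "ext_sign {v} {u} = - ext_sign {u} {v}" by (rule ext_sign_swap[OF assms])
  ultimately show ?thesis
    using ext_sign_single[of u v]
    by (cases "rk v < rk u") (simp_all add: pr_def alt_def algebra_simps)
qed

definition chain :: "nat \<times> nat \<times> nat \<Rightarrow> (nat \<times> nat) set \<Rightarrow> int" where
  "chain = (\<lambda>(k, i, j). emul (emon {(k, i)}) (emon {(i, j)}))"

lemma chain_carrier [simp]: "chain \<tau> \<in> ext_carrier"
  by (cases \<tau>) (simp add: chain_def)

lemma qcls_chain: "(k, i, j) \<in> triples \<Longrightarrow> qcls (chain (k, i, j)) = xq (k, i) * xq (i, j)"
  using triples_idxs[of k i j] by (simp add: chain_def qcls_mult xq_def)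

text \<open>The value of \<open>wt\<close> on the product of the generators \<open>s\<close> and
  \<open>t\<close>, in a form that the simplifier can compute.\<close>

definition wsym :: "nat \<times> nat \<times> nat \<Rightarrow> nat \<times> nat \<Rightarrow> nat \<times> nat \<Rightarrow> int" where
  "wsym = (\<lambda>(k, i, j) s t. let d = (\<lambda>u v. if v = u then 1 else 0) in
     alt (d s) (d t) (k,i) (k,j) + alt (d s) (d t) (k,i) (i,j) + alt (d s) (d t) (k,j) (i,j))"

lemma wt_emul_emon:
  assumes "\<tau> \<in> triples"
  shows "wt \<tau> (emul (emon {s}) (emon {t})) = wsym \<tau> s t"
proof -
  obtain k i j where \<tau>: "\<tau> = (k, i, j)" by (cases \<tau>)
  note ix = triples_idxs[OF assms[unfolded \<tau>]]
  have d: "(\<lambda>v. emon {u} {v}) = (\<lambda>v. if v = u then 1 else 0)" "emon {u} {} = 0" for u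
    by (auto simp: emon_def)
  show ?thesis
    using ix by (simp add: \<tau> wt_def wsym_def pr_emul d)
qed

lemma sum_triples:
  "(\<Sum>\<tau>\<in>triples. f \<tau>) = f (1,2,3) + f (1,3,2) + f (2,1,3) + f (2,3,1) + f (3,1,2) + f (3,2,1)"
  for f :: "_ \<Rightarrow> int"
  by (simp add: triples_def add.assoc)

text \<open>\<open>qalg\<close> is only a ring, with no integer scalars as a primitive operation; as
  all coefficients that occur are -1, 0 or 1, \<open>z\<close> spells the multiples out.\<close>

lemma qcls_triples:
  assumes "\<And>\<tau>. \<tau> \<in> triples \<Longrightarrow> n \<tau> \<in> {-1, 0, 1}"
  defines "z \<equiv> \<lambda>k x :: qalg. if k = (1::int) then x else if k = 0 then 0 else - x"
  shows "qcls (\<lambda>S. \<Sum>\<tau>\<in>triples. n \<tau> * chain \<tau> S) =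
    z (n (1,2,3)) (xq (1,2) * xq (2,3)) + z (n (1,3,2)) (xq (1,3) * xq (3,2))
    + z (n (2,1,3)) (xq (2,1) * xq (1,3)) + z (n (2,3,1)) (xq (2,3) * xq (3,1))
    + z (n (3,1,2)) (xq (3,1) * xq (1,2)) + z (n (3,2,1)) (xq (3,2) * xq (2,1))"
proof -
  have t: "(1,2,3) \<in> triples" "(1,3,2) \<in> triples" "(2,1,3) \<in> triples" "(2,3,1) \<in> triples"
    "(3,1,2) \<in> triples" "(3,2,1) \<in> triples"
    by (simp_all add: triples_def)
  have q: "qcls (\<lambda>S. n (k, i, j) * chain (k, i, j) S) = z (n (k, i, j)) (xq (k, i) * xq (i, j))"
    if "(k, i, j) \<in> triples" for k i j
    using assms(1)[OF that] by (auto simp: z_def qcls_simps qcls_chain that)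
  show ?thesis
    unfolding sum_triples
    by (simp only: qcls_add ext_carrier_closed chain_carrier q[OF t(1)] q[OF t(2)] q[OF t(3)]
        q[OF t(4)] q[OF t(5)] q[OF t(6)])
qed

lemma wsym_range:
  assumes "\<tau> \<in> triples"
  shows "wsym \<tau> s t \<in> {-1, 0, 1}"
proof -
  obtain k i j where \<tau>: "\<tau> = (k, i, j)" by (cases \<tau>)
  define u v w where "u = (k, i)" and "v = (k, j)" and "w = (i, j)"
  have "u \<noteq> v" "u \<noteq> w" "v \<noteq> w" using triples_idxs[OF assms[unfolded \<tau>]] by (auto simp: u_def v_def w_def)
  moreover have "wsym \<tau> s t = (let d = (\<lambda>u v. if v = u then 1 else 0) in
     alt (d s) (d t) u v + alt (d s) (d t) u w + alt (d s) (d t) v w)"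
    by (simp add: \<tau> wsym_def u_def v_def w_def)
  ultimately show ?thesis by (auto simp: alt_def)
qed

text \<open>Duality of the chains with \<open>wt\<close> suggests the coefficients; the normal forms
  confirm them in the quotient for all 36 pairs.\<close>

lemma product_in_terms_of_chains:
  assumes "s \<in> idxs" "t \<in> idxs"
  shows "qcls (emul (emon {s}) (emon {t})) = qcls (\<lambda>S. \<Sum>\<tau>\<in>triples. wsym \<tau> s t * chain \<tau> S)"
proof -
  have l: "qcls (emul (emon {s}) (emon {t})) = xq s * xq t"
    using assms by (simp add: xq_def qcls_mult)
  note nf = xq_facts(1-24) xq_normal_forms
  show ?thesis
    unfolding l
    apply (subst qcls_triples[of "\<lambda>\<tau>. wsym \<tau> s t"])
    apply (erule wsym_range)
    using assms unfolding idxs_iff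
    by (elim disjE; simp add: wsym_def alt_def nf)
qed

lemma wt_zero [simp]: "wt \<tau> (\<lambda>S. 0) = 0"
  by (simp add: wt_def pr_def case_prod_beta)

lemma wt_sum: "finite A \<Longrightarrow> wt \<tau> (\<lambda>Z. \<Sum>i\<in>A. k i * F i Z) = (\<Sum>i\<in>A. k i * wt \<tau> (F i))"
  by (induction A rule: finite_induct) (simp_all add: wt_linear)

lemma wt_emon_card:
  assumes "\<tau> \<in> triples" "card S \<noteq> 2"
  shows "wt \<tau> (emon S) = 0"
proof -
  obtain k i j where \<tau>: "\<tau> = (k, i, j)" by (cases \<tau>)
  have "emon S {u, v} = 0" if "u \<noteq> v" for u v
    using that assms(2) by (auto simp: emon_def)
  then show ?thesis
    using triples_idxs[OF assms(1)[unfolded \<tau>]] by (simp add: \<tau> wt_def pr_def)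
qed

text \<open>A monomial minus its expansion in chains. In degree at least two this lies in the
  ideal.\<close>

definition residue :: "(nat \<times> nat) set \<Rightarrow> (nat \<times> nat) set \<Rightarrow> int" where
  "residue S Z = emon S Z - (\<Sum>\<tau>\<in>triples. wt \<tau> (emon S) * chain \<tau> Z)"

lemma chains_carrier [simp]: "(\<lambda>Z. \<Sum>\<tau>\<in>triples. k \<tau> * chain \<tau> Z) \<in> ext_carrier"
  unfolding sum_triples by (intro ext_carrier_closed chain_carrier)

lemma residue_ideal_2:
  assumes "s \<in> idxs" "t \<in> idxs" "s \<noteq> t"
  shows "residue {s, t} \<in> pv3_ideal"
proof -
  let ?e = "ext_sign {s} {t}" and ?E = "emul (emon {s}) (emon {t})"
  have E: "?E = (\<lambda>Z. ?e * emon {s, t} Z)"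
    using assms by (simp add: emul_emon insert_commute)
  let ?D = "\<lambda>Z. \<Sum>\<tau>\<in>triples. wsym \<tau> s t * chain \<tau> Z"
  have "qcls (\<lambda>Z. ?E Z - ?D Z) = 0"
    using product_in_terms_of_chains[OF assms(1,2)] by (simp add: qcls_simps)
  then have "(\<lambda>Z. ?E Z - ?D Z) \<in> pv3_ideal"
    by (simp add: qcls_eq_0_iff)
  then have "(\<lambda>Z. ?e * (?E Z - ?D Z)) \<in> pv3_ideal"
    by (rule pv3_ideal_closed(5))
  moreover have "residue {s, t} = (\<lambda>Z. ?e * (?E Z - ?D Z))"
  proof
    fix Z
    have "wsym \<tau> s t = ?e * wt \<tau> (emon {s, t})" if "\<tau> \<in> triples" for \<tau>
      using wt_emul_emon[OF that, of s t] by (simp add: E wt_linear)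
    then have "?D Z = (\<Sum>\<tau>\<in>triples. ?e * wt \<tau> (emon {s, t}) * chain \<tau> Z)"
      by (intro sum.cong) simp_all
    also have "\<dots> = ?e * (\<Sum>\<tau>\<in>triples. wt \<tau> (emon {s, t}) * chain \<tau> Z)"
      by (simp add: sum_distrib_left mult.assoc)
    finally have D: "?D Z = ?e * (\<Sum>\<tau>\<in>triples. wt \<tau> (emon {s, t}) * chain \<tau> Z)" .
    have "?e * (?E Z - ?D Z) = (?e * ?e) * (emon {s, t} Z - (\<Sum>\<tau>\<in>triples. wt \<tau> (emon {s, t}) * chain \<tau> Z))"
      unfolding D unfolding E by (simp only: algebra_simps)
    then show "residue {s, t} Z = ?e * (?E Z - ?D Z)"
      unfolding residue_def ext_sign_square by simp
  qed
  ultimately show ?thesis by simp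
qed

text \<open>Up to sign the monomial is a product of three generators, which vanishes in the
  quotient, times the rest. As \<open>wt\<close> only sees degree two, the residue is the monomial
  itself.\<close>

lemma residue_ideal_3:
  assumes "S \<subseteq> idxs" "card S \<ge> 3"
  shows "residue S \<in> pv3_ideal"
proof -
  have fin: "finite S" using assms(1) by (rule finite_subset) simp
  obtain T where T: "T \<subseteq> S" "card T = 3"
    using obtain_subset_with_card_n[OF assms(2)] by blast
  then obtain s t u where "T = {s, t, u}" and d: "s \<noteq> t" "t \<noteq> u" "s \<noteq> u"
    by (auto simp: card_3_iff)
  with T have s: "s \<in> S" and t: "t \<in> S" "t \<noteq> s" and u: "u \<in> S" "u \<noteq> s" "u \<noteq> t" by auto
  have ix: "s \<in> idxs" "t \<in> idxs" "u \<in> idxs" "S - {s, t, u} \<subseteq> idxs" using s t u assms(1) by auto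
  let ?P = "emul (emul (emon {s}) (emon {t})) (emon {u})"
  have "qcls ?P = 0"
    using xq_triple[OF ix(1-3)] ix by (simp add: qcls_mult xq_def)
  then have "?P \<in> pv3_ideal" by (simp add: qcls_eq_0_iff)
  from pv3_ideal_closed(3)[OF this emon_carrier[OF ix(4)]]
  have E: "emul ?P (emon (S - {s, t, u})) \<in> pv3_ideal" .
  define k1 k2 k3 where "k1 = ext_sign {s} {t}" and "k2 = ext_sign {s, t} {u}"
    and "k3 = ext_sign {s, t, u} (S - {s, t, u})"
  have "{s} \<union> {t} = {s, t}" "{s, t} \<union> {u} = {s, t, u}" "{s, t, u} \<union> (S - {s, t, u}) = S"
    using s t u by auto
  moreover have "{s} \<inter> {t} = {}" "{s, t} \<inter> {u} = {}" "{s, t, u} \<inter> (S - {s, t, u}) = {}"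
    using t u by auto
  ultimately have "emul ?P (emon (S - {s, t, u})) = (\<lambda>Z. k1 * (k2 * (k3 * emon S Z)))"
    using ix by (simp add: emul_emon emul_scale k1_def k2_def k3_def)
  \<comment> \<open>The signs are their own inverses, so multiplying by them again isolates
    \<open>emon S\<close>.\<close>
  with E have "(\<lambda>Z. k3 * k2 * k1 * (k1 * (k2 * (k3 * emon S Z)))) \<in> pv3_ideal"
    using pv3_ideal_closed(5) by metis
  moreover have "k3 * k2 * k1 * (k1 * (k2 * (k3 * x))) = x" for x
  proof -
    have "k3 * k2 * k1 * (k1 * (k2 * (k3 * x))) = (k1 * k1) * (k2 * k2) * (k3 * k3) * x"
      by (simp only: mult_ac)
    then show ?thesis by (simp only: k1_def k2_def k3_def ext_sign_square mult_1)
  qed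
  ultimately have "emon S \<in> pv3_ideal" by simp
  moreover have "residue S = emon S"
    using wt_emon_card[of _ S] assms(2) by (auto simp: residue_def fun_eq_iff)
  ultimately show ?thesis by simp
qed

text \<open>Expand \<open>a\<close> in monomials. Since all \<open>wt \<tau> a\<close> vanish, each
  monomial may be replaced by its residue; degrees 0 and 1 drop out by hypothesis, and the remaining
  residues lie in the ideal.\<close>

lemma mem_pv3_idealI:
  assumes a: "a \<in> ext_carrier" and a0: "a {} = 0" "\<And>s. s \<in> idxs \<Longrightarrow> a {s} = 0"
    and w: "\<And>\<tau>. \<tau> \<in> triples \<Longrightarrow> wt \<tau> a = 0"
  shows "a \<in> pv3_ideal"
proof -
  have exp: "a = (\<lambda>Z. \<Sum>S\<in>Pow idxs. a S * emon S Z)"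
  proof
    fix Z
    have "(\<Sum>S\<in>Pow idxs. a S * emon S Z) = (\<Sum>S\<in>Pow idxs. if S = Z then a S else 0)"
      by (intro sum.cong) (auto simp: emon_def)
    also have "\<dots> = a Z" using ext_carrierD[OF a, of Z] by simp
    finally show "a Z = (\<Sum>S\<in>Pow idxs. a S * emon S Z)" ..
  qed
  have w': "(\<Sum>S\<in>Pow idxs. a S * wt \<tau> (emon S)) = 0" if "\<tau> \<in> triples" for \<tau>
    using w[OF that] wt_sum[of "Pow idxs" \<tau> a emon] exp by simp
  have "a Z = (\<Sum>S\<in>Pow idxs. a S * residue S Z)" for Z
  proof -
    have "(\<Sum>S\<in>Pow idxs. a S * (\<Sum>\<tau>\<in>triples. wt \<tau> (emon S) * chain \<tau> Z))
        = (\<Sum>\<tau>\<in>triples. (\<Sum>S\<in>Pow idxs. a S * wt \<tau> (emon S)) * chain \<tau> Z)"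
      unfolding sum_distrib_left sum_distrib_right by (subst sum.swap) (simp add: mult.assoc)
    also have "\<dots> = 0" using w' by simp
    finally show ?thesis
      using fun_cong[OF exp, of Z] by (simp add: residue_def right_diff_distrib sum_subtractf)
  qed
  moreover have "(\<lambda>Z. \<Sum>S\<in>Pow idxs. a S * residue S Z) \<in> pv3_ideal"
  proof (intro pv3_ideal_sum)
    fix S assume S: "S \<in> Pow idxs"
    then have fin: "finite S" using finite_subset[of S idxs] by simp
    consider "card S = 0" | "card S = 1" | "card S = 2" | "card S \<ge> 3" by linarith
    then show "(\<lambda>Z. a S * residue S Z) \<in> pv3_ideal"
    proof cases
      case 1
      then have "S = {}" using fin by simp
      then show ?thesis by (simp add: a0 pv3_ideal_closed)
    next
      case 2
      then obtain s where "S = {s}" by (auto simp: card_1_singleton_iff)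
      then show ?thesis using S by (simp add: a0 pv3_ideal_closed)
    next
      case 3
      then obtain s t where "S = {s, t}" "s \<noteq> t" by (auto simp: card_2_iff)
      then show ?thesis using S by (auto intro!: pv3_ideal_closed(5) simp: residue_ideal_2)
    next
      case 4
      then show ?thesis using S by (auto intro!: pv3_ideal_closed(5) simp: residue_ideal_3)
    qed
  qed simp
  ultimately show ?thesis by (metis (no_types, lifting) ext)
qed

section \<open>The isomorphism\<close>

definition lamcup :: "nat \<times> nat \<times> nat \<Rightarrow> letter list set list \<Rightarrow> int" where
  "lamcup = (\<lambda>(k, i, j). cup 1 (lamstar (k, i)) (lamstar (i, j)))"

text \<open>A representative written in dual bases, so that its invariants are the coefficients of
  \<open>a\<close> in degrees 0 and 1 and the numbers \<open>wt \<tau> a\<close> in degree two. The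
  value 0 above represents the only class there.\<close>

definition ext_cocycle :: "((nat \<times> nat) set \<Rightarrow> int) \<Rightarrow> nat \<Rightarrow> letter list set list \<Rightarrow> int" where
  "ext_cocycle a n =
    (if n = 0 then (\<lambda>xs. if xs = [] then a {} else 0)
     else if n = 1 then (\<lambda>xs. \<Sum>s\<in>idxs. a {s} * lamstar s xs)
     else if n = 2 then (\<lambda>xs. \<Sum>\<tau>\<in>triples. wt \<tau> a * lamcup \<tau> xs)
     else (\<lambda>_. 0))"

lemma const_cocycle: "(\<lambda>xs. if xs = [] then k else 0) \<in> cocycles PV3 0"
  unfolding cocycles_def
proof (intro CollectI conjI cochains_eqI[OF coboundary_in_cochains cochains_closed(1)])
  show "(\<lambda>xs. if xs = [] then k else 0) \<in> cochains PV3 0" by (simp add: cochains_def)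
  fix gs :: "pv3 list" assume "length gs = Suc 0"
  then obtain x where "gs = [x]" by (auto simp: length_Suc_conv)
  then show "coboundary PV3 0 (\<lambda>xs. if xs = [] then k else 0) (map Rep_pv3 gs) = 0"
    by (simp add: coboundary_def)
qed

lemma lamcup_cocycle: "lamcup \<tau> \<in> cocycles PV3 2"
proof -
  obtain k i j where "\<tau> = (k, i, j)" by (cases \<tau>)
  then show ?thesis
    using cup_cocycle[OF lamstar_cocycle[of "(k, i)"] lamstar_cocycle[of "(i, j)"]]
    by (simp add: lamcup_def numeral_2_eq_2)
qed

text \<open>The duality between chains and relators. The cup products and the exterior products give
  the same \<open>wsym\<close>, so one computation of 36 cases serves both.\<close>

lemma inv2_lamcup:
  assumes "\<sigma> \<in> triples" "\<tau> \<in> triples"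
  shows "inv2 (lamcup \<tau>) \<sigma> = (if \<sigma> = \<tau> then 1 else 0)"
    and "wt \<sigma> (chain \<tau>) = (if \<sigma> = \<tau> then 1 else 0)"
proof -
  obtain k i j where \<tau>: "\<tau> = (k, i, j)" by (cases \<tau>)
  obtain k' i' j' where \<sigma>: "\<sigma> = (k', i', j')" by (cases \<sigma>)
  have w: "wsym \<sigma> (k, i) (i, j) = (if \<sigma> = \<tau> then 1 else 0)"
    using assms unfolding \<tau> \<sigma> triples_def insert_iff empty_iff prod.inject
    by (elim disjE conjE FalseE; simp add: wsym_def alt_def)
  have "inv2 (lamcup \<tau>) \<sigma> = wsym \<sigma> (k, i) (i, j)"
    using triples_idxs[OF assms(1)[unfolded \<sigma>]]
    by (simp add: \<tau> \<sigma> lamcup_def inv2_cup(3)[OF lamstar_cocycle lamstar_cocycle, unfolded One_nat_def]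
        wsym_def alt_def inv1_lamstar)
  with w show "inv2 (lamcup \<tau>) \<sigma> = (if \<sigma> = \<tau> then 1 else 0)" by simp
  show "wt \<sigma> (chain \<tau>) = (if \<sigma> = \<tau> then 1 else 0)"
    using w wt_emul_emon[OF assms(1), of "(k, i)" "(i, j)"] by (simp add: \<tau> chain_def)
qed

lemma ext_cocycle: "ext_cocycle a n \<in> cocycles PV3 n"
proof -
  have 1: "(\<lambda>xs. \<Sum>s\<in>idxs. a {s} * lamstar s xs) \<in> cocycles PV3 1"
    by (intro cocycles_sum cocycles_closed lamstar_cocycle) simp
  have 2: "(\<lambda>xs. \<Sum>\<tau>\<in>triples. wt \<tau> a * lamcup \<tau> xs) \<in> cocycles PV3 2"
    by (intro cocycles_sum cocycles_closed lamcup_cocycle) simp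
  consider "n = 0" | "n = 1" | "n = 2" | "n \<ge> 3" by linarith
  then show ?thesis
    by cases (use 1 2 in \<open>simp_all add: ext_cocycle_def const_cocycle cocycles_closed\<close>)
qed

lemma same_inv_ext_cocycle:
  "same_inv n f (ext_cocycle a n) \<longleftrightarrow> (n = 0 \<longrightarrow> f [] = a {}) \<and> (n = 1 \<longrightarrow> (\<forall>s\<in>idxs. inv1 f s = a {s}))
     \<and> (n = 2 \<longrightarrow> (\<forall>\<tau>\<in>triples. inv2 f \<tau> = wt \<tau> a))"
proof -
  have 1: "inv1 (ext_cocycle a 1) s = a {s}" if "s \<in> idxs" for s
  proof -
    have "inv1 (ext_cocycle a 1) s = (\<Sum>t\<in>idxs. a {t} * inv1 (lamstar t) s)"
      by (simp add: ext_cocycle_def)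
    also have "\<dots> = (\<Sum>t\<in>idxs. if t = s then a {t} else 0)"
      using that by (intro sum.cong) (auto simp: inv1_lamstar)
    finally show ?thesis using that by simp
  qed
  have 2: "inv2 (ext_cocycle a 2) \<sigma> = wt \<sigma> a" if "\<sigma> \<in> triples" for \<sigma>
  proof -
    have "inv2 (ext_cocycle a 2) \<sigma> = (\<Sum>\<tau>\<in>triples. wt \<tau> a * inv2 (lamcup \<tau>) \<sigma>)"
      by (simp add: ext_cocycle_def)
    also have "\<dots> = (\<Sum>\<tau>\<in>triples. if \<tau> = \<sigma> then wt \<tau> a else 0)"
      using that by (intro sum.cong) (auto simp: inv2_lamcup)
    finally show ?thesis using that by simp
  qed
  show ?thesis
    using 1 2 by (auto simp: same_inv_def) (simp_all add: ext_cocycle_def)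
qed

definition ext_class :: "((nat \<times> nat) set \<Rightarrow> int) \<Rightarrow> nat \<Rightarrow> (letter list set list \<Rightarrow> int) set" where
  "ext_class a n = cohom_class PV3 n (ext_cocycle a n)"

lemma cohom_class_eq_ext_class:
  assumes "f \<in> cocycles PV3 n"
  shows "cohom_class PV3 n f = ext_class a n \<longleftrightarrow> same_inv n f (ext_cocycle a n)"
  unfolding ext_class_def by (rule cohom_class_PV3_eq_iff[OF assms ext_cocycle])

lemma rep_ext_class:
  "cohom_rep (ext_class a) n \<in> cocycles PV3 n"
  "same_inv n (cohom_rep (ext_class a) n) (ext_cocycle a n)"
proof -
  have "ext_class a n \<in> cohom_class PV3 n ` cocycles PV3 n"
    unfolding ext_class_def by (intro imageI ext_cocycle)
  from cohom_rep[of "ext_class a", OF this]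
  show "cohom_rep (ext_class a) n \<in> cocycles PV3 n"
    "same_inv n (cohom_rep (ext_class a) n) (ext_cocycle a n)"
    using cohom_class_eq_ext_class by simp_all
qed

lemma rep_ext_class_inv:
  "cohom_rep (ext_class a) 0 [] = a {}"
  "s \<in> idxs \<Longrightarrow> inv1 (cohom_rep (ext_class a) 1) s = a {s}"
  "\<tau> \<in> triples \<Longrightarrow> inv2 (cohom_rep (ext_class a) 2) \<tau> = wt \<tau> a"
  using rep_ext_class(2)[of 0 a] rep_ext_class(2)[of 1 a] rep_ext_class(2)[of 2 a]
  unfolding same_inv_ext_cocycle by auto

lemma ext_class_carrier: "ext_class a \<in> carrier (cohom_ring PV3)"
proof -
  have "ext_class a n = cohom_class PV3 n (\<lambda>_. 0)" if "n \<ge> 3" for n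
    using that by (simp add: ext_class_def ext_cocycle_def)
  then have "{n. ext_class a n \<noteq> cohom_class PV3 n (\<lambda>_. 0)} \<subseteq> {..<3}"
    by (auto simp: not_le[symmetric])
  then have "finite {n. ext_class a n \<noteq> cohom_class PV3 n (\<lambda>_. 0)}"
    by (rule finite_subset) simp
  then show ?thesis
    by (simp add: cohom_ring_def) (simp add: ext_class_def ext_cocycle)
qed

lemma wt_emul:
  assumes "(k, i, j) \<in> triples"
  shows "wt (k, i, j) (emul a b) = a {} * wt (k, i, j) b
    + (alt (\<lambda>s. a {s}) (\<lambda>s. b {s}) (k,i) (k,j) + alt (\<lambda>s. a {s}) (\<lambda>s. b {s}) (k,i) (i,j)
       + alt (\<lambda>s. a {s}) (\<lambda>s. b {s}) (k,j) (i,j)) + wt (k, i, j) a * b {}"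
  using triples_idxs[OF assms] by (simp add: wt_def pr_emul algebra_simps)

text \<open>Compare invariants in each degree: \<open>wt_emul\<close> on the algebraic side and
  \<open>inv2_cup\<close> on the topological side are the same bilinear formula. The chosen
  representatives enter only through their invariants.\<close>

lemma ext_class_mult: "ext_class (emul a b) = ext_class a \<otimes>\<^bsub>cohom_ring PV3\<^esub> ext_class b"
proof
  fix n :: nat
  let ?f = "cohom_rep (ext_class a)" and ?g = "cohom_rep (ext_class b)"
  let ?h = "\<lambda>xs. \<Sum>p\<in>{0..n}. cup p (?f p) (?g (n - p)) xs"
  have "cup p (?f p) (?g (n - p)) \<in> cocycles PV3 n" if "p \<le> n" for p
    using cup_cocycle[OF rep_ext_class(1)[of a p] rep_ext_class(1)[of b "n - p"]] that by simp
  then have "?h \<in> cocycles PV3 n" by (intro cocycles_sum) auto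
  moreover have "same_inv n ?h (ext_cocycle (emul a b) n)"
    unfolding same_inv_ext_cocycle
  proof (intro conjI impI ballI)
    assume "n = 0"
    then show "?h [] = emul a b {}"
      by (simp add: cup_def emul_empty rep_ext_class_inv)
  next
    fix s assume n: "n = 1" and s: "s \<in> idxs"
    have "{0..1::nat} = {0, 1}" by auto
    then show "inv1 ?h s = emul a b {s}"
      using rep_ext_class_inv(2)[OF s] inv1_cup
      by (simp add: n emul_single[OF s] rep_ext_class_inv)
  next
    fix \<tau> assume n: "n = 2" and \<tau>: "\<tau> \<in> triples"
    obtain k i j where t: "\<tau> = (k, i, j)" by (cases \<tau>)
    note ix = triples_idxs[OF \<tau>[unfolded t]]
    have "{0..2::nat} = {0, 1, 2}" by auto
    then have "inv2 ?h \<tau> = inv2 (cup 0 (?f 0) (?g 2)) \<tau> + inv2 (cup 1 (?f 1) (?g 1)) \<tau> + inv2 (cup 2 (?f 2) (?g 0)) \<tau>"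
      by (simp add: n numeral_2_eq_2[symmetric])
    also have "\<dots> = wt \<tau> (emul a b)"
      unfolding t inv2_cup inv2_cup(3)[OF rep_ext_class(1) rep_ext_class(1)] wt_emul[OF \<tau>[unfolded t]]
        alt_def rep_ext_class_inv rep_ext_class_inv(3)[OF \<tau>[unfolded t]]
        rep_ext_class_inv(2)[OF ix(1)] rep_ext_class_inv(2)[OF ix(2)] rep_ext_class_inv(2)[OF ix(3)]
      by simp
    finally show "inv2 ?h \<tau> = wt \<tau> (emul a b)" .
  qed
  ultimately have "cohom_class PV3 n ?h = ext_class (emul a b) n"
    by (simp only: cohom_class_eq_ext_class)
  then show "ext_class (emul a b) n = (ext_class a \<otimes>\<^bsub>cohom_ring PV3\<^esub> ext_class b) n"
    by (simp add: cohom_ring_def)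
qed

lemma ext_class_add: "ext_class (\<lambda>S. a S + b S) = ext_class a \<oplus>\<^bsub>cohom_ring PV3\<^esub> ext_class b"
proof
  fix n :: nat
  let ?f = "cohom_rep (ext_class a)" and ?g = "cohom_rep (ext_class b)"
  let ?h = "\<lambda>xs. ?f n xs + ?g n xs"
  have "?h \<in> cocycles PV3 n" by (intro cocycles_closed rep_ext_class)
  moreover have "same_inv n ?h (ext_cocycle (\<lambda>S. a S + b S) n)"
    unfolding same_inv_ext_cocycle by (auto simp: wt_linear rep_ext_class_inv rep_ext_class_inv[unfolded One_nat_def])
  ultimately have "cohom_class PV3 n ?h = ext_class (\<lambda>S. a S + b S) n"
    by (simp only: cohom_class_eq_ext_class)
  then show "ext_class (\<lambda>S. a S + b S) n = (ext_class a \<oplus>\<^bsub>cohom_ring PV3\<^esub> ext_class b) n"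
    by (simp add: cohom_ring_def)
qed

lemma wt_const:
  assumes "\<tau> \<in> triples"
  shows "wt \<tau> (\<lambda>S. if S = {} then k else 0) = 0"
  by (simp add: wt_def pr_def case_prod_beta)

lemma ext_class_one: "ext_class \<one>\<^bsub>ext_alg\<^esub> = \<one>\<^bsub>cohom_ring PV3\<^esub>"
proof
  fix n :: nat
  let ?h = "if n = 0 then (\<lambda>xs. if xs = [] then 1 else 0) else (\<lambda>_. 0) :: letter list set list \<Rightarrow> int"
  have "?h \<in> cocycles PV3 n" by (simp add: const_cocycle cocycles_closed)
  moreover have "same_inv n ?h (ext_cocycle \<one>\<^bsub>ext_alg\<^esub> n)"
    unfolding same_inv_ext_cocycle by (simp add: wt_const)
  ultimately have "cohom_class PV3 n ?h = ext_class \<one>\<^bsub>ext_alg\<^esub> n"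
    by (simp only: cohom_class_eq_ext_class)
  then show "ext_class \<one>\<^bsub>ext_alg\<^esub> n = \<one>\<^bsub>cohom_ring PV3\<^esub> n"
    by (simp add: cohom_ring_def)
qed

lemma ext_class_zero_iff:
  "ext_class a = \<zero>\<^bsub>cohom_ring PV3\<^esub> \<longleftrightarrow>
    a {} = 0 \<and> (\<forall>s\<in>idxs. a {s} = 0) \<and> (\<forall>\<tau>\<in>triples. wt \<tau> a = 0)"
proof -
  have "ext_class a = \<zero>\<^bsub>cohom_ring PV3\<^esub> \<longleftrightarrow> (\<forall>n. cohom_class PV3 n (\<lambda>_. 0) = ext_class a n)"
    by (auto simp: cohom_ring_def fun_eq_iff)
  also have "\<dots> \<longleftrightarrow> (\<forall>n. same_inv n (\<lambda>_. 0) (ext_cocycle a n))"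
    by (simp add: cohom_class_eq_ext_class cocycles_closed)
  also have "\<dots> \<longleftrightarrow> a {} = 0 \<and> (\<forall>s\<in>idxs. a {s} = 0) \<and> (\<forall>\<tau>\<in>triples. wt \<tau> a = 0)"
    unfolding same_inv_ext_cocycle by auto
  finally show ?thesis .
qed

lemma ext_class_surj:
  assumes "x \<in> carrier (cohom_ring PV3)"
  shows "\<exists>a\<in>ext_carrier. x = ext_class a"
proof -
  have x: "x n \<in> cohom_class PV3 n ` cocycles PV3 n" for n
    using assms by (simp add: cohom_ring_def)
  let ?f = "cohom_rep x"
  define a where "a Z = (if Z = {} then ?f 0 [] else 0)
      + ((\<Sum>s\<in>idxs. inv1 (?f 1) s * emon {s} Z) + (\<Sum>\<tau>\<in>triples. inv2 (?f 2) \<tau> * chain \<tau> Z))" for Z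
  have a: "a \<in> ext_carrier"
  proof (rule ext_carrierI)
    fix S assume "\<not> S \<subseteq> idxs"
    then have "emon {s} S = 0" if "s \<in> idxs" for s using that by (auto simp: emon_def)
    moreover have "chain \<tau> S = 0" for \<tau> using chain_carrier \<open>\<not> S \<subseteq> idxs\<close> by (rule ext_carrierD)
    ultimately show "a S = 0" using \<open>\<not> S \<subseteq> idxs\<close> by (auto simp: a_def)
  qed
  have chain_low: "chain \<tau> {} = 0" "chain \<tau> {s} = 0" if "s \<in> idxs" for \<tau> s
    using that by (auto simp: chain_def case_prod_beta emul_empty emul_single) (auto simp: emon_def)
  have a0: "a {} = ?f 0 []"
    using chain_low[of "(1,2)"] by (simp add: a_def) (simp add: emon_def)
  have a1: "a {t} = inv1 (?f 1) t" if "t \<in> idxs" for t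
  proof -
    have "(\<Sum>s\<in>idxs. inv1 (?f 1) s * emon {s} {t}) = (\<Sum>s\<in>idxs. if s = t then inv1 (?f 1) s else 0)"
      by (intro sum.cong) (auto simp: emon_def)
    then show ?thesis using that by (simp add: a_def chain_low)
  qed
  have a2: "wt \<sigma> a = inv2 (?f 2) \<sigma>" if "\<sigma> \<in> triples" for \<sigma>
  proof -
    have "wt \<sigma> a = (\<Sum>s\<in>idxs. inv1 (?f 1) s * wt \<sigma> (emon {s})) + (\<Sum>\<tau>\<in>triples. inv2 (?f 2) \<tau> * wt \<sigma> (chain \<tau>))"
      unfolding a_def[abs_def] by (simp add: wt_linear wt_sum wt_const[OF that])
    also have "(\<Sum>s\<in>idxs. inv1 (?f 1) s * wt \<sigma> (emon {s})) = 0"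
      using wt_emon_card[OF that] by simp
    also have "(\<Sum>\<tau>\<in>triples. inv2 (?f 2) \<tau> * wt \<sigma> (chain \<tau>)) = (\<Sum>\<tau>\<in>triples. if \<tau> = \<sigma> then inv2 (?f 2) \<tau> else 0)"
      using that by (intro sum.cong) (auto simp: inv2_lamcup)
    finally show ?thesis using that by simp
  qed
  have "x n = ext_class a n" for n
  proof -
    have "same_inv n (?f n) (ext_cocycle a n)"
      unfolding same_inv_ext_cocycle using a0 a1 a2 by auto
    then show ?thesis
      using cohom_class_eq_ext_class[OF cohom_rep(1)[of x n, OF x], of a] cohom_rep(2)[of x n, OF x] by simp
  qed
  then show ?thesis using a by blast
qed

lemma ext_class_ring_hom: "ring_hom_ring ext_alg (cohom_ring PV3) ext_class"
proof -
  have hom: "ext_class \<in> ring_hom ext_alg (cohom_ring PV3)"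
    using ext_class_one by (intro ring_hom_memI) (simp_all add: ext_class_carrier ext_class_mult ext_class_add)
  have img: "ext_class ` carrier ext_alg = carrier (cohom_ring PV3)"
    using ext_class_surj ext_class_carrier by auto
  have zero: "ext_class \<zero>\<^bsub>ext_alg\<^esub> = \<zero>\<^bsub>cohom_ring PV3\<^esub>"
    by (simp only: ext_class_zero_iff) simp
  \<comment> \<open>\<open>ext_class\<close> is onto and respects the operations, so the ring axioms
    for the cohomology ring are transported from the exterior algebra.\<close>
  have "ring (cohom_ring PV3 \<lparr>carrier := ext_class ` carrier ext_alg, zero := ext_class \<zero>\<^bsub>ext_alg\<^esub>\<rparr>)"
    by (rule ext.ring_hom_imp_img_ring[OF hom])
  then have "ring (cohom_ring PV3)"
    unfolding img zero by simp
  then show ?thesis by (intro ring_hom_ringI2 ring_ext_alg hom)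
qed

text \<open>The relations are combinations of products of two generators, so their low coefficients
  vanish and the six values of \<open>wt\<close> decide.\<close>

lemma ext_class_relation:
  assumes "r \<in> pv3_relations"
  shows "ext_class r = \<zero>\<^bsub>cohom_ring PV3\<^esub>"
proof -
  have diff: "emul (\<lambda>S. a S - b S) c = (\<lambda>S. emul a c S - emul b c S)" for a b c
    using emul_distrib(1)[of a "\<lambda>S. -1 * b S" c] emul_scale(1)[of "-1" b c] by simp
  have wt_diff: "wt \<tau> (\<lambda>S. a S - b S) = wt \<tau> a - wt \<tau> b" for \<tau> a b
    using wt_linear(1)[of \<tau> a "\<lambda>S. -1 * b S"] wt_linear(2)[of \<tau> "-1" b] by simp
  have low: "emul (emon {s}) (emon {t}) {} = 0" "u \<in> idxs \<Longrightarrow> emul (emon {s}) (emon {t}) {u} = 0" for s t u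
    by (auto simp: emul_empty emul_single) (auto simp: emon_def)
  have w: "P (1,2,3) \<Longrightarrow> P (1,3,2) \<Longrightarrow> P (2,1,3) \<Longrightarrow> P (2,3,1) \<Longrightarrow> P (3,1,2) \<Longrightarrow> P (3,2,1) \<Longrightarrow>
      \<forall>\<tau>\<in>triples. P \<tau>" for P
    by (simp add: triples_def)
  note s = ext_minus egen_emon diff wt_diff wt_linear low wt_emul_emon triples_def wsym_def alt_def
  from assms consider
    (1) i j where "1 \<le> i" "i < j" "j \<le> 3" "r = egen i j \<otimes>\<^bsub>ext_alg\<^esub> egen j i"
  | (2) i j where "(i, j) \<in> idxs" "r = ((egen 1 3 \<ominus>\<^bsub>ext_alg\<^esub> egen 3 1) \<otimes>\<^bsub>ext_alg\<^esub> egen i j)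
        \<ominus>\<^bsub>ext_alg\<^esub> (((egen 1 2 \<ominus>\<^bsub>ext_alg\<^esub> egen 2 1) \<otimes>\<^bsub>ext_alg\<^esub> egen i j)
                   \<oplus>\<^bsub>ext_alg\<^esub> ((egen 2 3 \<ominus>\<^bsub>ext_alg\<^esub> egen 3 2) \<otimes>\<^bsub>ext_alg\<^esub> egen i j))"
  | (3) "r = (egen 2 1 \<otimes>\<^bsub>ext_alg\<^esub> egen 3 1)
        \<ominus>\<^bsub>ext_alg\<^esub> ((egen 2 1 \<otimes>\<^bsub>ext_alg\<^esub> egen 3 2) \<oplus>\<^bsub>ext_alg\<^esub> (egen 2 3 \<otimes>\<^bsub>ext_alg\<^esub> egen 3 1))"
    unfolding pv3_relations_def by blast
  then show ?thesis
  proof cases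
    case 1
    then have "(i, j) = (1, 2) \<or> (i, j) = (1, 3) \<or> (i, j) = (2, 3)" by auto
    then show ?thesis
      unfolding ext_class_zero_iff 1
      by (elim disjE; intro conjI ballI w; simp add: s)
  next
    case 2
    show ?thesis
      using 2(1) unfolding ext_class_zero_iff 2 idxs_iff
      by (elim disjE; intro conjI w; simp add: s flip: idxs_iff)
  next
    case 3
    show ?thesis
      unfolding ext_class_zero_iff 3
      by (intro conjI ballI w; simp add: s)
  qed
qed

lemma kernel_ext_class: "a_kernel ext_alg (cohom_ring PV3) ext_class = pv3_ideal"
proof
  show "a_kernel ext_alg (cohom_ring PV3) ext_class \<subseteq> pv3_ideal"
    using mem_pv3_idealI by (auto simp: a_kernel_def' ext_class_zero_iff)
  have "pv3_relations \<subseteq> a_kernel ext_alg (cohom_ring PV3) ext_class"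
    using pv3_relations_carrier ext_class_relation by (auto simp: a_kernel_def')
  then show "pv3_ideal \<subseteq> a_kernel ext_alg (cohom_ring PV3) ext_class"
    unfolding pv3_ideal_def by (rule ext.genideal_minimal[OF ring_hom_ring.kernel_is_ideal[OF ext_class_ring_hom]])
qed

lemma ext_class_egen:
  assumes "s \<in> idxs"
  shows "ext_class (emon {s}) = deg1 PV3 (lamstar s)"
proof
  fix n :: nat
  have w: "wt \<tau> (emon {s}) = 0" if "\<tau> \<in> triples" for \<tau>
    by (rule wt_emon_card[OF that]) simp
  let ?h = "if n = 1 then lamstar s else (\<lambda>_. 0)"
  have "?h \<in> cocycles PV3 n" by (simp add: lamstar_cocycle[unfolded One_nat_def] cocycles_closed)
  moreover have "same_inv n ?h (ext_cocycle (emon {s}) n)"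
    unfolding same_inv_ext_cocycle using w by (auto simp: inv1_lamstar emon_def)
  ultimately have "cohom_class PV3 n ?h = ext_class (emon {s}) n"
    by (simp only: cohom_class_eq_ext_class)
  then show "ext_class (emon {s}) n = deg1 PV3 (lamstar s) n"
    by (simp add: deg1_def split: if_splits)
qed

theorem theorem4p3:
  shows "\<exists>\<phi>. \<phi> \<in> ring_iso (ext_alg Quot pv3_ideal) (cohom_ring PV3)
            \<and> (\<forall>ij \<in> idxs. \<phi> (pv3_ideal +>\<^bsub>ext_alg\<^esub> egen (fst ij) (snd ij)) = deg1 PV3 (lamstar ij))"
proof (intro exI conjI ballI)
  have "ext_class ` carrier ext_alg = carrier (cohom_ring PV3)"
    using ext_class_surj ext_class_carrier by auto
  from ring_hom_ring.FactRing_iso_set[OF ext_class_ring_hom this]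
  show "(\<lambda>A. the_elem (ext_class ` A)) \<in> ring_iso (ext_alg Quot pv3_ideal) (cohom_ring PV3)"
    unfolding kernel_ext_class .
  fix ij assume ij: "ij \<in> idxs"
  then have "egen (fst ij) (snd ij) \<in> carrier ext_alg" by (simp add: egen_emon)
  from ring_hom_ring.the_elem_simp[OF ext_class_ring_hom this]
  show "the_elem (ext_class ` (pv3_ideal +>\<^bsub>ext_alg\<^esub> egen (fst ij) (snd ij))) = deg1 PV3 (lamstar ij)"
    unfolding kernel_ext_class using ext_class_egen[OF ij] by (simp add: egen_emon)
qed

end
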